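(* Let $\mathbb{K}=\mathbb{F}_q$ be a finite field and let $\mathcal{C}/\mathbb{K}$ be an absolutely irreducible nonsingular projective curve of genus $g$, with distinct points $A_0,A_1,A_2,A_3\in\mathcal{C}(\mathbb{K})$ and a $\mathbb{K}$-rational non-special effective divisor $\sum_{\gamma=1}^g B_\gamma$ of degree $g$. For $(n_1,n_2,n_3)\in\mathbb{Z}^3$ let $$D(n_1,n_2,n_3)=n_1(A_0-A_1)+n_2(A_0-A_2)+n_3(A_0-A_3)+\sum_{\gamma=1}^g B_\gamma-g\cdot A_0 .$$ Then the evolutions in the variables $n_1,n_2,n_3$ define linear flows in the Jacobian: the class $[D(n_1,n_2,n_3)]\in \mathrm{Pic}^0(\mathcal{C};\mathbb{K})\cong J(\mathcal{C};\mathbb{K})$ satisfies $$[D(n_1,n_2,n_3)]=[D(0,0,0)]+\sum_{i=1}^3 n_i\,[A_0-A_i]\qquad\text{for all }(n_1,n_2,n_3)\in\mathbb{Z}^3,$$ so that increasing $n_i$ by $1$ is translation in $J(\mathcal{C};\mathbb{K})$ by the fixed element $[A_0-A_i]$, $i=1,2,3$. Here $[D(n_1,n_2,n_3)]$ is the class attached to the wave function $\psi(n_1,n_2,n_3)$: the divisor of $\psi(n_1,n_2,n_3)$ is $$\sum_{i=1}^3 n_i(A_i-A_0)+\sum_{\gamma=1}^g X_\gamma(n_1,n_2,n_3)-\sum_{\gamma=1}^g B_\gamma,$$ where $\sum_{\gamma=1}^g X_\gamma(n_1,n_2,n_3)-g\cdot A_0$ is the representative of $[D(n_1,n_2,n_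3)]$.
   Context: $\mathbb{K}$-rationality of $\sum_\gamma B_\gamma$, with $B_\gamma\in\mathcal{C}(\overline{\mathbb{K}})$, means that the Galois group $G(\overline{\mathbb{K}}/\mathbb{K})$ permutes the points $B_\gamma$. All points $A_i,B_\gamma$ are distinct. $\mathrm{Pic}^0(\mathcal{C};\mathbb{K})$ is the group of $\mathbb{K}$-rational degree zero divisors modulo principal $\mathbb{K}$-rational divisors, identified with the group $J(\mathcal{C};\mathbb{K})$ of $\mathbb{K}$-rational points of the Jacobian; $[\cdot]$ denotes the class of a divisor. Fix a $\mathbb{K}$-rational local parameter $t_0$ at $A_0$. The wave function $\psi(n_1,n_2,n_3)$ is the rational function on $\mathcal{C}$ with $\operatorname{div}\psi\ \ge\ -(n_1+n_2+n_3)A_0+\sum_{i=1}^3 n_iA_i-\sum_{\gamma=1}^g B_\gamma$ (that is: pole of order at most $n_1+n_2+n_3$ at $A_0$, zeros of order at least $n_i$ at $A_i$, at most simple poles at $B_\gamma$, and no other poles; negative orders are interpreted in the usual way) whose first nonzero coefficient in the $t_0$-expansion at $A_0$ equals $1$. General position (standing assumption): for every $(n_1,n_2,n_3)\in\mathbb{Z}^3$ the space of rational functions $f$ on $\mathcal{C}$ that are zero or satisfy $\operatorname{div}f\ \ge\ -(n_1+n_2+n_3)A_0+\sum_{i=1}^3 n_iA_i-\sum_{\gamma=1}^g B_\gamma$ is one-dimensional, so that $\psi(n_1,n_2,n_3)$ exists and is unique; equivalently, $[D(n_1,n_2,n_3)]$ has a unique representative of the form $\sum_{\gamma=1}^g X_\gamma(n_1,n_2,n_3)-g\cdot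 A_0$ with $\sum_\gamma X_\gamma$ effective (the points $X_\gamma\in\mathcal{C}(\overline{\mathbb{K}})$ need not be distinct, and some may equal $A_0$). *)

theory Defs
  imports
    "HOL-Library.Poly_Mapping"
    "HOL-Algebra.Algebra"
    "HOL-Algebra.Algebraic_Closure_Type"
begin

section \<open>Forms and projective algebraic sets\<close>

text \<open>
  The ground field is a type \<open>'k\<close>; geometry takes place over its algebraic closure
  \<open>'k alg_closure\<close>. Homogeneous coordinates are indexed by a finite type \<open>'n\<close>, so the ambient
  space has projective dimension \<open>CARD('n) - 1\<close>. A point is the set of all of its
  homogeneous coordinate vectors.
\<close>

type_synonym ('n, 'a) mpoly = "('n \<Rightarrow>\<^sub>0 nat) \<Rightarrow>\<^sub>0 'a"

type_synonym ('n, 'a) point = "('n \<Rightarrow> 'a) set"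

definition poly_at :: "('n::finite, 'a::comm_ring_1) mpoly \<Rightarrow> ('n \<Rightarrow> 'a) \<Rightarrow> 'a" where
  "poly_at F x = (\<Sum>m\<in>Poly_Mapping.keys F.
     Poly_Mapping.lookup F m * (\<Prod>i\<in>UNIV. x i ^ Poly_Mapping.lookup m i))"

definition homogeneous :: "nat \<Rightarrow> ('n::finite, 'a::zero) mpoly \<Rightarrow> bool" where
  "homogeneous d F \<longleftrightarrow>
     (\<forall>m\<in>Poly_Mapping.keys F. (\<Sum>i\<in>UNIV. Poly_Mapping.lookup m i) = d)"

definition projective_space :: "('n, 'a::field) point set" where
  "projective_space = {{\<lambda>i. c * x i | c. c \<noteq> 0} | x. \<exists>i. x i \<noteq> 0}"

definition vanishes_at :: "('n::finite, 'a::field) mpoly \<Rightarrow> ('n, 'a) point \<Rightarrow> bool" where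
  "vanishes_at F P \<longleftrightarrow> (\<forall>x\<in>P. poly_at F x = 0)"

definition vanishes_on :: "('n::finite, 'a::field) mpoly \<Rightarrow> ('n, 'a) point set \<Rightarrow> bool" where
  "vanishes_on F C \<longleftrightarrow> (\<forall>P\<in>C. vanishes_at F P)"

definition zero_locus :: "('n::finite, 'a::field) mpoly set \<Rightarrow> ('n, 'a) point set" where
  "zero_locus S = {P \<in> projective_space. \<forall>F\<in>S. vanishes_at F P}"

definition algebraic_set :: "('n::finite, 'a::field) point set \<Rightarrow> bool" where
  "algebraic_set Z \<longleftrightarrow> (\<exists>S. (\<forall>F\<in>S. \<exists>d. homogeneous d F) \<and> Z = zero_locus S)"

definition irreducible_set :: "('n::finite, 'a::field) point set \<Rightarrow> bool" where
  "irreducible_set C \<longleftrightarrow> algebraic_set C \<and> C \<noteq> {} \<and>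
     (\<forall>Y Z. algebraic_set Y \<and> algebraic_set Z \<and> C = Y \<union> Z \<longrightarrow> C = Y \<or> C = Z)"

section \<open>Function field and local rings\<close>

text \<open>
  A rational function on an irreducible \<open>C\<close> is a class of fractions of forms of equal degree whose
  denominator does not vanish identically on \<open>C\<close>; two fractions are identified when their
  cross difference vanishes on \<open>C\<close>.
\<close>

type_synonym ('n, 'a) ratfun = "(('n, 'a) mpoly \<times> ('n, 'a) mpoly) set"

definition fractions :: "('n::finite, 'a::field) point set \<Rightarrow> (('n, 'a) mpoly \<times> ('n, 'a) mpoly) set"
  where
  "fractions C = {(F, G). (\<exists>d. homogeneous d F \<and> homogeneous d G) \<and> \<not> vanishes_on G C}"

definition fraction_rel ::
  "('n::finite, 'a::field) point set \<Rightarrow>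
     ((('n, 'a) mpoly \<times> ('n, 'a) mpoly) \<times> (('n, 'a) mpoly \<times> ('n, 'a) mpoly)) set" where
  "fraction_rel C = {((F, G), (F', G')). (F, G) \<in> fractions C \<and> (F', G') \<in> fractions C \<and>
     vanishes_on (F * G' - F' * G) C}"

definition function_field :: "('n::finite, 'a::field) point set \<Rightarrow> ('n, 'a) ratfun ring" where
  "function_field C =
     \<lparr>carrier = fractions C // fraction_rel C,
      monoid.mult = (\<lambda>f h. \<Union>(F, G)\<in>f. \<Union>(F', G')\<in>h. fraction_rel C `` {(F * F', G * G')}),
      one = fraction_rel C `` {(1, 1)},
      ring.zero = fraction_rel C `` {(0, 1)},
      ring.add = (\<lambda>f h. \<Union>(F, G)\<in>f. \<Union>(F', G')\<in>h.
               fraction_rel C `` {(F * G' + F' * G, G * G')})\<rparr>"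

definition const_fun :: "('n::finite, 'a::field) point set \<Rightarrow> 'a \<Rightarrow> ('n, 'a) ratfun" where
  "const_fun C c = fraction_rel C `` {(Poly_Mapping.single 0 c, 1)}"

definition constants :: "('n::finite, 'a::field) point set \<Rightarrow> ('n, 'a) ratfun set" where
  "constants C = range (const_fun C)"

definition local_ring ::
  "('n::finite, 'a::field) point set \<Rightarrow> ('n, 'a) point \<Rightarrow> ('n, 'a) ratfun ring" where
  "local_ring C P = (function_field C)
     \<lparr>carrier := {f \<in> carrier (function_field C). \<exists>(F, G)\<in>f. \<not> vanishes_at G P}\<rparr>"

definition local_maximal_ideal ::
  "('n::finite, 'a::field) point set \<Rightarrow> ('n, 'a) point \<Rightarrow> ('n, 'a) ratfun set" where
  "local_maximal_ideal C P =
     {f \<in> carrier (function_field C). \<exists>(F, G)\<in>f. \<not> vanishes_at G P \<and> vanishes_at F P}"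

section \<open>Nonsingular projective curves\<close>

text \<open>The dimension is the transcendence degree of the function field over the constants.\<close>

definition projective_curve :: "('n::finite, 'a::field) point set \<Rightarrow> bool" where
  "projective_curve C \<longleftrightarrow> irreducible_set C \<and>
     (\<exists>x\<in>carrier (function_field C).
        (ring.transcendental (function_field C) over constants C) x \<and>
        (\<forall>y\<in>carrier (function_field C).
           (ring.algebraic (function_field C)
              over generate_field (function_field C) (insert x (constants C))) y))"

text \<open>
  A point of a curve is nonsingular if its local ring is regular; the ring having dimension 1, this
  means that the maximal ideal is generated by one element.
\<close>

definition nonsingular_curve :: "('n::finite, 'a::field) point set \<Rightarrow> bool" where
  "nonsingular_curve C \<longleftrightarrow> projective_curve C \<and>
     (\<forall>P\<in>C. principalideal (local_maximal_ideal C P) (local_ring C P))"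

definition local_parameter ::
  "('n::finite, 'a::field) point set \<Rightarrow> ('n, 'a) point \<Rightarrow> ('n, 'a) ratfun \<Rightarrow> bool" where
  "local_parameter C P t \<longleftrightarrow> t \<in> carrier (local_ring C P) \<and>
     PIdl\<^bsub>local_ring C P\<^esub> t = local_maximal_ideal C P"

definition ord_at ::
  "('n::finite, 'a::field) point set \<Rightarrow> ('n, 'a) point \<Rightarrow> ('n, 'a) ratfun \<Rightarrow> int" where
  "ord_at C P f = (THE n. \<exists>t u. local_parameter C P t \<and> u \<in> Units (local_ring C P) \<and>
     f = t [^]\<^bsub>function_field C\<^esub> (n::int) \<otimes>\<^bsub>function_field C\<^esub> u)"

text \<open>
  \<open>c\<close> is the first nonzero coefficient of the \<open>t\<close>-expansion of \<open>f\<close> at \<open>P\<close>: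
  \<open>f = c t\<^sup>m + O(t\<^sup>m\<^sup>+\<^sup>1)\<close> for some integer \<open>m\<close>.
\<close>

definition leading_coefficient ::
  "('n::finite, 'a::field) point set \<Rightarrow> ('n, 'a) point \<Rightarrow> ('n, 'a) ratfun \<Rightarrow> ('n, 'a) ratfun \<Rightarrow> 'a \<Rightarrow> bool"
  where
  "leading_coefficient C P t f c \<longleftrightarrow> c \<noteq> 0 \<and>
     (\<exists>m::int. \<exists>u\<in>carrier (local_ring C P).
        f = (const_fun C c \<otimes>\<^bsub>function_field C\<^esub> t [^]\<^bsub>function_field C\<^esub> m)
            \<oplus>\<^bsub>function_field C\<^esub> (t [^]\<^bsub>function_field C\<^esub> (m + 1) \<otimes>\<^bsub>function_field C\<^esub> u))"

section \<open>Divisors\<close>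

text \<open>Divisors on \<open>C\<close> are the elements of \<open>carrier (free_Abelian_group C)\<close>.\<close>

definition div_degree :: "('p \<Rightarrow>\<^sub>0 int) \<Rightarrow> int" where
  "div_degree D = (\<Sum>P\<in>Poly_Mapping.keys D. Poly_Mapping.lookup D P)"

definition principal_divisor ::
  "('n::finite, 'a::field) point set \<Rightarrow> ('n, 'a) ratfun \<Rightarrow> (('n, 'a) point \<Rightarrow>\<^sub>0 int)" where
  "principal_divisor C f = Abs_poly_mapping (\<lambda>P. ord_at C P f when P \<in> C)"

definition riemann_roch_space ::
  "('n::finite, 'a::field) point set \<Rightarrow> (('n, 'a) point \<Rightarrow>\<^sub>0 int) \<Rightarrow> ('n, 'a) ratfun set" where
  "riemann_roch_space C D = {f \<in> carrier (function_field C).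
     f = \<zero>\<^bsub>function_field C\<^esub> \<or> (\<forall>P\<in>C. ord_at C P f \<ge> - Poly_Mapping.lookup D P)}"

definition ell :: "('n::finite, 'a::field) point set \<Rightarrow> (('n, 'a) point \<Rightarrow>\<^sub>0 int) \<Rightarrow> nat" where
  "ell C D = (ring.dim (function_field C) over constants C) (riemann_roch_space C D)"

text \<open>
  Riemann's definition of the genus, and the index of speciality
  \<open>i(D) = l(D) - deg D + g - 1\<close>.
\<close>

definition genus :: "('n::finite, 'a::field) point set \<Rightarrow> int" where
  "genus C = (SUP D\<in>carrier (free_Abelian_group C). div_degree D - int (ell C D) + 1)"

definition nonspecial ::
  "('n::finite, 'a::field) point set \<Rightarrow> (('n, 'a) point \<Rightarrow>\<^sub>0 int) \<Rightarrow> bool" where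
  "nonspecial C D \<longleftrightarrow> int (ell C D) - div_degree D + genus C - 1 = 0"

section \<open>Rationality over the ground field\<close>

definition rational_coeffs :: "('n, 'k::field alg_closure) mpoly \<Rightarrow> bool" where
  "rational_coeffs F \<longleftrightarrow> (\<forall>m. Poly_Mapping.lookup F m \<in> range to_ac)"

definition defined_over_ground :: "('n::finite, 'k::field alg_closure) point set \<Rightarrow> bool" where
  "defined_over_ground C \<longleftrightarrow>
     (\<exists>S. (\<forall>F\<in>S. rational_coeffs F \<and> (\<exists>d. homogeneous d F)) \<and> C = zero_locus S)"

definition rational_points ::
  "('n::finite, 'k::field alg_closure) point set \<Rightarrow> ('n, 'k alg_closure) point set" where
  "rational_points C = {P \<in> C. \<exists>x\<in>P. \<forall>i. x i \<in> range to_ac}"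

definition rational_functions ::
  "('n::finite, 'k::field alg_closure) point set \<Rightarrow> ('n, 'k alg_closure) ratfun set" where
  "rational_functions C = {f \<in> carrier (function_field C).
     \<exists>(F, G)\<in>f. rational_coeffs F \<and> rational_coeffs G}"

definition galois_group :: "('k::field alg_closure \<Rightarrow> 'k alg_closure) set" where
  "galois_group = {\<sigma>. bij \<sigma> \<and> (\<forall>x y. \<sigma> (x + y) = \<sigma> x + \<sigma> y) \<and>
     (\<forall>x y. \<sigma> (x * y) = \<sigma> x * \<sigma> y) \<and> (\<forall>c. \<sigma> (to_ac c) = to_ac c)}"

definition galois_point :: "('a \<Rightarrow> 'a) \<Rightarrow> ('n, 'a) point \<Rightarrow> ('n, 'a) point" where
  "galois_point \<sigma> P = (\<lambda>x. \<sigma> \<circ> x) ` P"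

definition rational_divisor :: "(('n, 'k::field alg_closure) point \<Rightarrow>\<^sub>0 int) \<Rightarrow> bool" where
  "rational_divisor D \<longleftrightarrow> (\<forall>\<sigma>\<in>galois_group. \<forall>P.
     Poly_Mapping.lookup D (galois_point \<sigma> P) = Poly_Mapping.lookup D P)"

definition rational_div0_group ::
  "('n::finite, 'k::field alg_closure) point set \<Rightarrow> (('n, 'k alg_closure) point \<Rightarrow>\<^sub>0 int) monoid" where
  "rational_div0_group C = (free_Abelian_group C)
     \<lparr>carrier := {D \<in> carrier (free_Abelian_group C). rational_divisor D \<and> div_degree D = 0}\<rparr>"

definition rational_principal_divisors ::
  "('n::finite, 'k::field alg_closure) point set \<Rightarrow> (('n, 'k alg_closure) point \<Rightarrow>\<^sub>0 int) set" where
  "rational_principal_divisors C =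
     principal_divisor C ` (rational_functions C - {\<zero>\<^bsub>function_field C\<^esub>})"

text \<open>This group is identified with the group of rational points of the Jacobian.\<close>

definition Pic0 ::
  "('n::finite, 'k::field alg_closure) point set \<Rightarrow> (('n, 'k alg_closure) point \<Rightarrow>\<^sub>0 int) set monoid" where
  "Pic0 C = rational_div0_group C Mod rational_principal_divisors C"

definition divisor_class ::
  "('n::finite, 'k::field alg_closure) point set \<Rightarrow> (('n, 'k alg_closure) point \<Rightarrow>\<^sub>0 int) \<Rightarrow>
     (('n, 'k alg_closure) point \<Rightarrow>\<^sub>0 int) set" where
  "divisor_class C D = rational_principal_divisors C #>\<^bsub>rational_div0_group C\<^esub> D"

section \<open>The divisors of the flow and the wave function\<close>

definition points_divisor :: "nat \<Rightarrow> (nat \<Rightarrow> 'p) \<Rightarrow> ('p \<Rightarrow>\<^sub>0 int)" where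
  "points_divisor g B = (\<Sum>\<gamma>=1..g. frag_of (B \<gamma>))"

definition flow_divisor ::
  "'p \<Rightarrow> 'p \<Rightarrow> 'p \<Rightarrow> 'p \<Rightarrow> nat \<Rightarrow> (nat \<Rightarrow> 'p) \<Rightarrow> int \<Rightarrow> int \<Rightarrow> int \<Rightarrow> ('p \<Rightarrow>\<^sub>0 int)" where
  "flow_divisor A0 A1 A2 A3 g B n1 n2 n3 =
     frag_cmul n1 (frag_of A0 - frag_of A1) + frag_cmul n2 (frag_of A0 - frag_of A2)
     + frag_cmul n3 (frag_of A0 - frag_of A3)
     + points_divisor g B - frag_cmul (int g) (frag_of A0)"

definition wave_space ::
  "('n::finite, 'a::field) point set \<Rightarrow> ('n, 'a) point \<Rightarrow> ('n, 'a) point \<Rightarrow> ('n, 'a) point \<Rightarrow>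
     ('n, 'a) point \<Rightarrow> nat \<Rightarrow> (nat \<Rightarrow> ('n, 'a) point) \<Rightarrow> int \<Rightarrow> int \<Rightarrow> int \<Rightarrow> ('n, 'a) ratfun set" where
  "wave_space C A0 A1 A2 A3 g B n1 n2 n3 = riemann_roch_space C
     (frag_cmul (n1 + n2 + n3) (frag_of A0)
      - (frag_cmul n1 (frag_of A1) + frag_cmul n2 (frag_of A2) + frag_cmul n3 (frag_of A3))
      + points_divisor g B)"

definition wave_function ::
  "('n::finite, 'a::field) point set \<Rightarrow> ('n, 'a) point \<Rightarrow> ('n, 'a) point \<Rightarrow> ('n, 'a) point \<Rightarrow>
     ('n, 'a) point \<Rightarrow> nat \<Rightarrow> (nat \<Rightarrow> ('n, 'a) point) \<Rightarrow> ('n, 'a) ratfun \<Rightarrow> int \<Rightarrow> int \<Rightarrow> int \<Rightarrow>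
     ('n, 'a) ratfun \<Rightarrow> bool" where
  "wave_function C A0 A1 A2 A3 g B t0 n1 n2 n3 \<psi> \<longleftrightarrow>
     \<psi> \<in> wave_space C A0 A1 A2 A3 g B n1 n2 n3 \<and> \<psi> \<noteq> \<zero>\<^bsub>function_field C\<^esub> \<and>
     leading_coefficient C A0 t0 \<psi> 1"

end

theory Submission
  imports Defs
begin

text \<open>
  The divisor of the flow is by definition additive in \<open>(n1, n2, n3)\<close>, so the content lies in the
  wave function. Its divisor plus the divisor \<open>D\<close> of the wave space is effective; that it consists of
  exactly \<open>g\<close> points is the statement that principal divisors have degree \<open>0\<close>, and that it represents
  a class over the ground field is the statement that the wave function is rational.

  Degree \<open>0\<close>: the number of zeros of a nonconstant \<open>f\<close>, with multiplicity, is at most the degree \<open>n\<close> of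
  the function field over the field generated by \<open>f\<close>, by weak approximation; and \<open>n\<close> is at most the
  number of poles, by counting dimensions in the spaces of functions with bounded poles. Applying
  this to \<open>f\<close> and to its inverse gives equality. The second estimate needs that functions without
  poles are constant. This is read off from general position at \<open>n1 = n2 = n3 = 0\<close>: these functions
  lie in a space of dimension \<open>1\<close> that contains the constants.

  The same finiteness of \<open>n\<close> shows that no nonzero function is divisible by all powers of a
  uniformizer, so that the local rings are discrete valuation rings.

  Rationality: Frobenius maps the wave space to itself and preserves the normalization of the leading
  coefficient, hence it fixes the wave function, and an invariant function has an invariant fraction.
\<close>

section \<open>Polynomial dependence over the constants\<close>

text \<open>The obstacle is the order in which facts become available. \<open>ord_at\<close> is a
  definite description and means nothing until the local rings are known to be discrete valuation
  rings. The finiteness at hand is transcendence degree one together with finitely many generators,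
  so a bound for the degree over the field of a nonconstant function has to come first, by algebra
  alone and before any valuation exists.

  The predicate \<open>dep\<close> states this bound with polynomials in \<open>f\<close> in place
  of fractions, the form that both later estimates consume: a relation that is nontrivial modulo
  \<open>f\<close> can be compared with orders at the zeros of \<open>f\<close>, and a constant
  relation among products \<open>f ^ j * y i\<close> regroups into one with polynomial coefficients.
  The bound is strict, so the least \<open>N\<close> with \<open>dep f N\<close> exceeds the degree
  by exactly one.

  One automorphism suffices for rationality because the ground field is finite: the elements fixed
  by the \<open>q\<close>-th power map are exactly its \<open>q\<close> elements. Normalizing the
  leading coefficient turns a stable line of functions into a fixed function.\<close>

locale const_field = field K for K :: "('b, 'm) ring_scheme" (structure) +
  fixes c :: "'a::field \<Rightarrow> 'b"
  assumes c_closed [simp, intro]: "c a \<in> carrier K"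
    and c_add: "c (a + b) = c a \<oplus> c b"
    and c_mult: "c (a * b) = c a \<otimes> c b"
    and c_one [simp]: "c 1 = \<one>"
begin

lemma c_zero [simp]: "c 0 = \<zero>"
  using c_add[of 0 0] add.r_cancel_one'[of "c 0" "c 0"] by simp

lemma c_uminus: "c (- a) = \<ominus> c a"
proof -
  have "c (- a) \<oplus> c a = \<zero>" using c_add[of "- a" a] by simp
  then show ?thesis using minus_equality[of "c (- a)" "c a"] by simp
qed

lemma c_minus: "c (a - b) = c a \<ominus> c b"
  using c_add[of a "- b"] by (simp add: c_uminus a_minus_def)

lemma c_eq_zero_iff [simp]: "c a = \<zero> \<longleftrightarrow> a = 0"
proof
  assume "c a = \<zero>"
  then have "c (a * inverse a) = \<zero>" by (simp add: c_mult)
  then show "a = 0" by (cases "a = 0") auto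
qed auto

lemma c_inverse: "a \<noteq> 0 \<Longrightarrow> inv (c a) = c (inverse a)"
  by (rule comm_inv_char) (auto simp: c_mult[symmetric])

lemma inv_in_carrier [simp, intro]: "x \<in> carrier K \<Longrightarrow> x \<noteq> \<zero> \<Longrightarrow> inv x \<in> carrier K"
  by (simp add: field_Units)

lemma r_inv_nz [simp]: "x \<in> carrier K \<Longrightarrow> x \<noteq> \<zero> \<Longrightarrow> x \<otimes> inv x = \<one>"
  by (simp add: field_Units)

lemma inv_nonzero: "x \<in> carrier K \<Longrightarrow> x \<noteq> \<zero> \<Longrightarrow> inv x \<noteq> \<zero>"
  using r_inv_nz[of x] r_null one_not_zero by metis

lemma l_inv_nz [simp]: "x \<in> carrier K \<Longrightarrow> x \<noteq> \<zero> \<Longrightarrow> inv x \<otimes> x = \<one>"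
  by (simp add: field_Units)

lemma inv_inv_nz [simp]: "x \<in> carrier K \<Longrightarrow> x \<noteq> \<zero> \<Longrightarrow> inv (inv x) = x"
  by (simp add: field_Units)

lemma subfield_constants: "subfield (range c) K"
proof (rule subfieldI')
  show "subring (range c) K"
  proof (rule subringI)
    show "\<one> \<in> range c" using c_one by (metis rangeI)
    show "\<ominus> h \<in> range c" if "h \<in> range c" for h
      using that by (auto simp: c_uminus[symmetric])
    show "h1 \<otimes> h2 \<in> range c" if "h1 \<in> range c" "h2 \<in> range c" for h1 h2
      using that by (auto simp: c_mult[symmetric])
    show "h1 \<oplus> h2 \<in> range c" if "h1 \<in> range c" "h2 \<in> range c" for h1 h2
      using that by (auto simp: c_add[symmetric])
  qed auto
  show "inv k \<in> range c" if "k \<in> range c - {\<zero>}" for k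
    using that by (auto simp: c_inverse)
qed

section \<open>Evaluation of polynomials at an element of the field\<close>

definition ev :: "'b \<Rightarrow> 'a poly \<Rightarrow> 'b" where
  "ev f p = fold_coeffs (\<lambda>a y. c a \<oplus> f \<otimes> y) p \<zero>"

lemma ev_0 [simp]: "ev f 0 = \<zero>"
  by (simp add: ev_def)

lemma ev_pCons [simp]: "f \<in> carrier K \<Longrightarrow> ev f (pCons a p) = c a \<oplus> f \<otimes> ev f p"
  by (cases "p = 0 \<and> a = 0") (auto simp: ev_def)

lemma ev_closed [simp, intro]: "f \<in> carrier K \<Longrightarrow> ev f p \<in> carrier K"
  by (induction p) auto

lemma ev_1 [simp]: "f \<in> carrier K \<Longrightarrow> ev f 1 = \<one>"
  by (simp add: one_pCons)

lemma ev_add: "f \<in> carrier K \<Longrightarrow> ev f (p + q) = ev f p \<oplus> ev f q"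
proof (induction p q rule: poly_induct2)
  case (pCons a p b q)
  then show ?case
    by (simp add: c_add a_ac r_distr)
qed auto

lemma ev_smult: "f \<in> carrier K \<Longrightarrow> ev f (Polynomial.smult a p) = c a \<otimes> ev f p"
  by (induction p) (simp_all add: c_mult r_distr m_assoc m_lcomm)

lemma ev_mult: "f \<in> carrier K \<Longrightarrow> ev f (p * q) = ev f p \<otimes> ev f q"
  by (induction p) (simp_all add: ev_add ev_smult l_distr m_assoc)

lemma ev_uminus: "f \<in> carrier K \<Longrightarrow> ev f (- p) = \<ominus> ev f p"
  by (induction p) (simp_all add: c_uminus minus_add r_minus)

lemma ev_monom: "f \<in> carrier K \<Longrightarrow> ev f (Polynomial.monom a n) = c a \<otimes> f [^] n"
  by (induction n) (simp_all add: monom_0 monom_Suc nat_pow_Suc m_ac)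

lemma ev_sum: "finite I \<Longrightarrow> f \<in> carrier K \<Longrightarrow> ev f (sum p I) = (\<Oplus>i\<in>I. ev f (p i))"
  by (induction I rule: finite_induct) (auto simp: ev_add Pi_def)

lemma ev_power: "f \<in> carrier K \<Longrightarrow> ev f (p ^ n) = ev f p [^] n"
  by (induction n) (simp_all add: ev_mult m_comm)

text \<open>\<open>dep f N\<close> bounds the degree of \<open>K\<close> over the subfield generated by \<open>f\<close> and the
  constants: it is less than \<open>N\<close>.\<close>

definition dep :: "'b \<Rightarrow> nat \<Rightarrow> bool" where
  "dep f N \<longleftrightarrow> (\<forall>y\<in>{..<N} \<rightarrow> carrier K. \<exists>p. (\<exists>i<N. p i \<noteq> 0) \<and>
     (\<Oplus>i\<in>{..<N}. ev f (p i) \<otimes> y i) = \<zero>)"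

text \<open>Later families are indexed by pairs of a point and an exponent, so the definition on
  initial segments is transported along an enumeration of the index set.\<close>

lemma depD:
  fixes I :: "'i set"
  assumes d: "dep f (card I)" and I: "finite I" and y: "y \<in> I \<rightarrow> carrier K" and f: "f \<in> carrier K"
  obtains p where "\<exists>i\<in>I. p i \<noteq> 0" "(\<Oplus>i\<in>I. ev f (p i) \<otimes> y i) = \<zero>"
proof -
  obtain h where h: "bij_betw h {..<card I} I"
    using I by (metis ex_bij_betw_nat_finite lessThan_atLeast0)
  let ?g = "the_inv_into {..<card I} h"
  have "y \<circ> h \<in> {..<card I} \<rightarrow> carrier K"
    using bij_betwE[OF h] y by auto
  then obtain p where p: "\<exists>i<card I. p i \<noteq> 0"
      "(\<Oplus>i\<in>{..<card I}. ev f (p i) \<otimes> (y \<circ> h) i) = \<zero>"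
    using d unfolding dep_def by blast
  have inj: "inj_on h {..<card I}" and im: "h ` {..<card I} = I"
    using h by (auto simp: bij_betw_def)
  have "(\<Oplus>i\<in>h ` {..<card I}. ev f (p (?g i)) \<otimes> y i)
      = (\<Oplus>i\<in>{..<card I}. ev f (p (?g (h i))) \<otimes> y (h i))"
    by (rule finsum_reindex) (use y inj im f in auto)
  also have "\<dots> = (\<Oplus>i\<in>{..<card I}. ev f (p i) \<otimes> (y \<circ> h) i)"
    by (rule finsum_cong') (use y inj im f in \<open>auto simp: the_inv_into_f_f\<close>)
  finally have "(\<Oplus>i\<in>I. ev f (p (?g i)) \<otimes> y i) = \<zero>"
    using p(2) im by simp
  moreover have "\<exists>i\<in>I. p (?g i) \<noteq> 0"
    using p(1) inj im by (metis imageI lessThan_iff the_inv_into_f_f)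
  ultimately show ?thesis using that[of "p \<circ> ?g"] by simp
qed

lemma finsum_lmult:
  assumes "finite I" "a \<in> carrier K" "g \<in> I \<rightarrow> carrier K"
  shows "a \<otimes> (\<Oplus>i\<in>I. g i) = (\<Oplus>i\<in>I. a \<otimes> g i)"
  using finsum_rdistr[OF assms] .

lemma finsum_member:
  assumes "finite I" "\<zero> \<in> S" "S \<subseteq> carrier K" "\<And>x y. x \<in> S \<Longrightarrow> y \<in> S \<Longrightarrow> x \<oplus> y \<in> S"
    and "\<And>i. i \<in> I \<Longrightarrow> g i \<in> S"
  shows "(\<Oplus>i\<in>I. g i) \<in> S"
  using assms(1,5)
proof (induction I rule: finite_induct)
  case (insert i I)
  then have "g \<in> I \<rightarrow> carrier K" "g i \<in> carrier K" using assms(3) by auto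
  then show ?case using insert assms(4) by (auto simp: finsum_insert)
qed (use assms in auto)

text \<open>While all constant terms vanish, every coefficient is divisible by \<open>f\<close>, and
  \<open>f\<close> cancels because a field has no zero divisors. Each cancellation lowers the sum of
  the degrees, so the process stops at a relation that is nontrivial modulo
  \<open>f\<close>.\<close>

lemma dep_reduced:
  fixes I :: "'i set"
  assumes d: "dep f (card I)" and I: "finite I" and y: "y \<in> I \<rightarrow> carrier K"
    and f: "f \<in> carrier K" "f \<noteq> \<zero>"
  obtains p where "\<exists>i\<in>I. Polynomial.coeff (p i) 0 \<noteq> 0" "(\<Oplus>i\<in>I. ev f (p i) \<otimes> y i) = \<zero>"
proof -
  have "\<exists>p. (\<exists>i\<in>I. Polynomial.coeff (p i) 0 \<noteq> 0) \<and> (\<Oplus>i\<in>I. ev f (p i) \<otimes> y i) = \<zero>"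
    if "\<exists>i\<in>I. p i \<noteq> 0" "(\<Oplus>i\<in>I. ev f (p i) \<otimes> y i) = \<zero>" for p
    using that
  proof (induction "\<Sum>i\<in>I. Polynomial.degree (p i)" arbitrary: p rule: less_induct)
    case less
    show ?case
    proof (cases "\<exists>i\<in>I. Polynomial.coeff (p i) 0 \<noteq> 0")
      case True
      then show ?thesis using less by blast
    next
      case False
      have ex: "\<exists>q. p i = pCons 0 q" if "i \<in> I" for i
        using False that by (cases "p i") auto
      then obtain q where q: "\<And>i. i \<in> I \<Longrightarrow> p i = pCons 0 (q i)" by metis
      obtain j where j: "j \<in> I" "p j \<noteq> 0" using less by blast
      have "(\<Sum>i\<in>I. Polynomial.degree (q i)) < (\<Sum>i\<in>I. Polynomial.degree (p i))"
        by (rule sum_strict_mono_ex1) (use I j q in \<open>auto simp: degree_pCons_eq_if intro!: bexI[of _ j]\<close>)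
      moreover have "\<exists>i\<in>I. q i \<noteq> 0" using j q by force
      moreover have "(\<Oplus>i\<in>I. ev f (q i) \<otimes> y i) = \<zero>"
      proof -
        have "f \<otimes> (\<Oplus>i\<in>I. ev f (q i) \<otimes> y i) = (\<Oplus>i\<in>I. f \<otimes> (ev f (q i) \<otimes> y i))"
          by (rule finsum_lmult) (use I y f in auto)
        also have "\<dots> = (\<Oplus>i\<in>I. ev f (p i) \<otimes> y i)"
          by (rule finsum_cong') (use q y f in \<open>auto simp: m_assoc Pi_def\<close>)
        finally have "f \<otimes> (\<Oplus>i\<in>I. ev f (q i) \<otimes> y i) = \<zero>" using less by simp
        moreover have "(\<Oplus>i\<in>I. ev f (q i) \<otimes> y i) \<in> carrier K"
          by (rule finsum_closed) (use y f in auto)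
        ultimately show ?thesis using f integral_iff by blast
      qed
      ultimately show ?thesis using less(1)[of q] by blast
    qed
  qed
  note * = this
  obtain p where "\<exists>i\<in>I. p i \<noteq> 0" "(\<Oplus>i\<in>I. ev f (p i) \<otimes> y i) = \<zero>"
    using depD[OF d I y f(1)] by blast
  then show ?thesis using *[of p] that by blast
qed

section \<open>The field generated by one element, and clearing of denominators\<close>

lemma nat_pow_nonzero: "x \<in> carrier K \<Longrightarrow> x \<noteq> \<zero> \<Longrightarrow> x [^] (n::nat) \<noteq> \<zero>"
  by (induction n) (auto simp: integral_iff)

lemma inv_mult_nz:
  assumes "x \<in> carrier K" "y \<in> carrier K" "x \<noteq> \<zero>" "y \<noteq> \<zero>"
  shows "inv (x \<otimes> y) = inv x \<otimes> inv y"
proof (rule comm_inv_char)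
  have "x \<otimes> y \<otimes> (inv x \<otimes> inv y) = (x \<otimes> inv x) \<otimes> (y \<otimes> inv y)"
    using assms by (simp only: m_ac inv_in_carrier m_closed not_False_eq_True)
  then show "x \<otimes> y \<otimes> (inv x \<otimes> inv y) = \<one>" using assms by simp
qed (use assms in auto)

lemma finsum_swap:
  assumes "finite I" "finite J" "\<And>i j. i \<in> I \<Longrightarrow> j \<in> J \<Longrightarrow> t i j \<in> carrier K"
  shows "(\<Oplus>i\<in>I. \<Oplus>j\<in>J. t i j) = (\<Oplus>j\<in>J. \<Oplus>i\<in>I. t i j)"
  using assms(1,3)
proof (induction I rule: finite_induct)
  case (insert a I)
  have "(\<Oplus>i\<in>insert a I. \<Oplus>j\<in>J. t i j) = (\<Oplus>j\<in>J. t a j) \<oplus> (\<Oplus>j\<in>J. \<Oplus>i\<in>I. t i j)"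
    using insert by (subst finsum_insert) (auto intro!: finsum_closed)
  also have "\<dots> = (\<Oplus>j\<in>J. t a j \<oplus> (\<Oplus>i\<in>I. t i j))"
    using insert by (subst finsum_addf) (auto intro!: finsum_closed)
  also have "\<dots> = (\<Oplus>j\<in>J. \<Oplus>i\<in>insert a I. t i j)"
    using insert by (intro finsum_cong') (auto simp: finsum_insert Pi_def intro!: finsum_closed)
  finally show ?case .
qed auto

text \<open>\<open>eval\<close> reads coefficient lists from the leading coefficient downwards,
  hence \<open>rev\<close>.\<close>

lemma eval_coefficient_list:
  assumes "x \<in> carrier K" "\<And>j. j < D \<Longrightarrow> g j \<in> carrier K"
  shows "eval (map g (rev [0..<D])) x = (\<Oplus>j\<in>{..<D}. g j \<otimes> x [^] j)"
  using assms(2)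
proof (induction D)
  case (Suc D)
  then show ?case using assms(1) by (simp add: lessThan_Suc finsum_insert Pi_def)
qed simp

text \<open>Induction over the generation of the subfield: quotients of values of polynomials are
  closed under the field operations. Denominators are required to be nonzero in the field and not
  merely as polynomials, so an \<open>f\<close> that satisfies a polynomial equation is covered
  too.\<close>

lemma ev_quotients_subfield:
  assumes f: "f \<in> carrier K"
  shows "generate_field K (insert f (range c)) \<subseteq>
    {ev f p \<otimes> inv (ev f q) | p q. ev f q \<noteq> \<zero>}"
proof
  note [simp] = f inv_nonzero integral_iff ev_mult ev_add ev_uminus
  fix h assume "h \<in> generate_field K (insert f (range c))"
  then show "h \<in> {ev f p \<otimes> inv (ev f q) | p q. ev f q \<noteq> \<zero>}"
  proof (induction rule: generate_field.induct)
    case one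
    have "\<one> = ev f 1 \<otimes> inv (ev f 1)" by simp
    moreover have "ev f 1 \<noteq> \<zero>" by simp
    ultimately show ?case by blast
  next
    case (incl h)
    then consider "h = f" | a where "h = c a" by auto
    then show ?case
    proof cases
      case 1
      then have "h = ev f [:0, 1:] \<otimes> inv (ev f 1)" by simp
      moreover have "ev f 1 \<noteq> \<zero>" by simp
      ultimately show ?thesis by blast
    next
      case 2
      then have "h = ev f [:a:] \<otimes> inv (ev f 1)" by simp
      moreover have "ev f 1 \<noteq> \<zero>" by simp
      ultimately show ?thesis by blast
    qed
  next
    case (a_inv h)
    then obtain p q where h: "h = ev f p \<otimes> inv (ev f q)" "ev f q \<noteq> \<zero>" by blast
    then have "\<ominus> h = ev f (- p) \<otimes> inv (ev f q)" by (simp add: l_minus)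
    then show ?case using h by blast
  next
    case (m_inv h)
    then obtain p q where h: "h = ev f p \<otimes> inv (ev f q)" "ev f q \<noteq> \<zero>" by blast
    then have p: "ev f p \<noteq> \<zero>" using m_inv by auto
    have "h \<otimes> (ev f q \<otimes> inv (ev f p)) = (ev f p \<otimes> inv (ev f p)) \<otimes> (inv (ev f q) \<otimes> ev f q)"
      using h p by (simp only: m_ac f ev_closed inv_in_carrier m_closed not_False_eq_True)
    also have "\<dots> = \<one>" using h p by simp
    finally have "inv h = ev f q \<otimes> inv (ev f p)"
      using h p by (intro comm_inv_char) auto
    then show ?case using p by blast
  next
    case (eng_add h1 h2)
    then obtain p q p' q' where h: "h1 = ev f p \<otimes> inv (ev f q)" "ev f q \<noteq> \<zero>"
      "h2 = ev f p' \<otimes> inv (ev f q')" "ev f q' \<noteq> \<zero>" by blast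
    let ?A = "ev f p" and ?B = "ev f q" and ?A' = "ev f p'" and ?B' = "ev f q'"
    have "inv (?B \<otimes> ?B') = inv ?B \<otimes> inv ?B'"
      using h by (simp add: inv_mult_nz)
    then have "ev f (p * q' + p' * q) \<otimes> inv (ev f (q * q'))
      = (?A \<otimes> ?B' \<oplus> ?A' \<otimes> ?B) \<otimes> (inv ?B \<otimes> inv ?B')" using h by simp
    also have "\<dots> = ?A \<otimes> inv ?B \<otimes> (?B' \<otimes> inv ?B') \<oplus> ?A' \<otimes> inv ?B' \<otimes> (?B \<otimes> inv ?B)"
      using h by (simp only: l_distr m_ac f ev_closed inv_in_carrier m_closed not_False_eq_True)
    also have "\<dots> = h1 \<oplus> h2" using h by simp
    finally have "h1 \<oplus> h2 = ev f (p * q' + p' * q) \<otimes> inv (ev f (q * q'))" ..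
    moreover have "ev f (q * q') \<noteq> \<zero>" using h by simp
    ultimately show ?case by blast
  next
    case (eng_mult h1 h2)
    then obtain p q p' q' where h: "h1 = ev f p \<otimes> inv (ev f q)" "ev f q \<noteq> \<zero>"
      "h2 = ev f p' \<otimes> inv (ev f q')" "ev f q' \<noteq> \<zero>" by blast
    let ?A = "ev f p" and ?B = "ev f q" and ?A' = "ev f p'" and ?B' = "ev f q'"
    have "inv (?B \<otimes> ?B') = inv ?B \<otimes> inv ?B'"
      using h by (simp add: inv_mult_nz)
    then have "ev f (p * p') \<otimes> inv (ev f (q * q')) = (?A \<otimes> ?A') \<otimes> (inv ?B \<otimes> inv ?B')" using h by simp
    also have "\<dots> = h1 \<otimes> h2"
      using h by (simp only: m_ac f ev_closed inv_in_carrier m_closed not_False_eq_True)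
    finally have "h1 \<otimes> h2 = ev f (p * p') \<otimes> inv (ev f (q * q'))" ..
    moreover have "ev f (q * q') \<noteq> \<zero>" using h by simp
    ultimately show ?case by blast
  qed
qed

lemma combine_eq_finsum:
  "length Ks = length Us \<Longrightarrow> set Ks \<subseteq> carrier K \<Longrightarrow> set Us \<subseteq> carrier K \<Longrightarrow>
     combine Ks Us = (\<Oplus>i\<in>{..<length Us}. Ks ! i \<otimes> Us ! i)"
proof (induction Ks Us rule: list_induct2)
  case (Cons k Ks u Us)
  then have cl: "Ks ! i \<in> carrier K" "Us ! i \<in> carrier K" if "i < length Us" for i using that by auto
  have "(\<Oplus>i\<in>{..<Suc (length Us)}. (k # Ks) ! i \<otimes> (u # Us) ! i)
     = k \<otimes> u \<oplus> (\<Oplus>i\<in>Suc ` {..<length Us}. (k # Ks) ! i \<otimes> (u # Us) ! i)"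
    unfolding lessThan_Suc_eq_insert_0 using Cons cl by (subst finsum_insert) auto
  also have "(\<Oplus>i\<in>Suc ` {..<length Us}. (k # Ks) ! i \<otimes> (u # Us) ! i)
     = (\<Oplus>i\<in>{..<length Us}. Ks ! i \<otimes> Us ! i)"
    using cl by (subst finsum_reindex) (auto simp: Pi_def)
  finally show ?case using Cons by simp
qed simp

text \<open>The product of all denominators works. It turns a linear relation over the field
  generated by \<open>f\<close> into one whose coefficients are polynomials in
  \<open>f\<close>.\<close>

lemma common_denominator:
  assumes f: "f \<in> carrier K" and I: "finite I"
    and k: "\<And>i. i \<in> I \<Longrightarrow> k i \<in> generate_field K (insert f (range c))"
  obtains d p where "ev f d \<noteq> \<zero>" "\<And>i. i \<in> I \<Longrightarrow> ev f d \<otimes> k i = ev f (p i)"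
proof -
  have "\<exists>d p. ev f d \<noteq> \<zero> \<and> (\<forall>i\<in>I. ev f d \<otimes> k i = ev f (p i))"
    using I k
  proof (induction I rule: finite_induct)
    case empty
    show ?case using f one_not_zero ev_1[OF f] by (intro exI[of _ 1]) auto
  next
    case (insert j I)
    then obtain d p where d: "ev f d \<noteq> \<zero>" "\<And>i. i \<in> I \<Longrightarrow> ev f d \<otimes> k i = ev f (p i)" by auto
    obtain a b where ab: "k j = ev f a \<otimes> inv (ev f b)" "ev f b \<noteq> \<zero>"
      using insert.prems[of j] ev_quotients_subfield[OF f] by blast
    have kc: "k i \<in> carrier K" if "i \<in> insert j I" for i
      using generate_field_in_carrier[OF _ insert.prems[OF that]] f by auto
    have "ev f (d * b) \<noteq> \<zero>" using d ab f by (simp add: ev_mult integral_iff)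
    moreover have "ev f (d * b) \<otimes> k i = ev f (if i = j then d * a else b * p i)"
      if i: "i \<in> insert j I" for i
    proof (cases "i = j")
      case True
      have "ev f (d * b) \<otimes> k i = ev f d \<otimes> ev f a \<otimes> (ev f b \<otimes> inv (ev f b))"
        using True ab f by (simp only: ev_mult m_ac ev_closed inv_in_carrier m_closed not_False_eq_True)
      then show ?thesis using True ab f by (simp add: ev_mult)
    next
      case False
      have "ev f (d * b) \<otimes> k i = ev f b \<otimes> (ev f d \<otimes> k i)"
        using f kc[OF i] by (simp add: ev_mult m_ac)
      then show ?thesis using False i d f by (simp add: ev_mult)
    qed
    ultimately show ?case by (intro exI[of _ "d * b"] exI[of _ "\<lambda>i. if i = j then d * a else b * p i"]) auto
  qed
  then show ?thesis using that by blast
qed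

text \<open>Any \<open>n + 1\<close> elements are dependent over the field generated by
  \<open>f\<close>, and clearing denominators makes the coefficients polynomial. The successor
  reflects that \<open>dep\<close> bounds the degree strictly.\<close>

lemma dep_of_finite_dimension:
  assumes f: "f \<in> carrier K"
    and n: "dimension n (generate_field K (insert f (range c))) (carrier K)"
  shows "dep f (Suc n)"
  unfolding dep_def
proof
  let ?E = "generate_field K (insert f (range c))"
  have sub: "subfield ?E K" by (rule generate_field_is_subfield) (use f in auto)
  fix y assume y: "y \<in> {..<Suc n} \<rightarrow> carrier K"
  define Us where "Us = map y [0..<Suc n]"
  have Us: "set Us \<subseteq> carrier K" "length Us = Suc n" "\<And>i. i < Suc n \<Longrightarrow> Us ! i = y i"
    using y by (auto simp: Us_def simp del: upt_Suc)
  have "\<not> independent ?E Us"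
    using independent_length_le_dimension[OF sub n, of Us] Us by auto
  then obtain Ks where Ks: "length Ks = length Us" "combine Ks Us = \<zero>" "set Ks \<subseteq> ?E" "set Ks \<noteq> {\<zero>}"
    using dependent_imp_non_trivial_combine[OF sub Us(1)] by blast
  have KsK: "set Ks \<subseteq> carrier K" using Ks(3) generate_field_incl[of "insert f (range c)"] f by auto
  have len: "length Ks = Suc n" using Ks Us by simp
  obtain d p where d: "ev f d \<noteq> \<zero>" "\<And>i. i < Suc n \<Longrightarrow> ev f d \<otimes> Ks ! i = ev f (p i)"
    using common_denominator[OF f, of "{..<Suc n}" "\<lambda>i. Ks ! i"] Ks(3) len
    by (metis finite_lessThan lessThan_iff nth_mem subsetD)
  obtain j where j: "j < Suc n" "Ks ! j \<noteq> \<zero>"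
    using Ks(4) len by (metis (no_types, lifting) in_set_conv_nth insertI1 length_pos_if_in_set
      singleton_iff subsetI subset_antisym zero_less_Suc insert_iff nth_mem)
  have Kc: "Ks ! i \<in> carrier K" if "i < Suc n" for i using KsK len that by auto
  \<comment> \<open>The common denominator is nonzero, so its product with a nonzero coefficient is
    nonzero and cannot be the value of the zero polynomial.\<close>
  have "p j \<noteq> 0"
    using d(2)[OF j(1)] d(1) j(2) Kc[OF j(1)] f by (metis ev_0 ev_closed integral)
  moreover have "(\<Oplus>i\<in>{..<Suc n}. ev f (p i) \<otimes> y i) = \<zero>"
  proof -
    have "(\<Oplus>i\<in>{..<Suc n}. ev f (p i) \<otimes> y i) = (\<Oplus>i\<in>{..<Suc n}. ev f d \<otimes> (Ks ! i \<otimes> y i))"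
      by (rule finsum_cong') (use y d f Kc in \<open>auto simp: Pi_def m_assoc simp flip: d(2)\<close>)
    also have "\<dots> = ev f d \<otimes> (\<Oplus>i\<in>{..<Suc n}. Ks ! i \<otimes> y i)"
      by (rule finsum_lmult[symmetric]) (use y f Kc in auto)
    also have "(\<Oplus>i\<in>{..<Suc n}. Ks ! i \<otimes> y i) = (\<Oplus>i\<in>{..<length Us}. Ks ! i \<otimes> Us ! i)"
      by (rule finsum_cong') (use Us Kc y in \<open>auto simp: Pi_iff\<close>)
    also have "\<dots> = \<zero>" using combine_eq_finsum[OF Ks(1) KsK Us(1)] Ks(2) by simp
    finally show ?thesis using f by simp
  qed
  ultimately show "\<exists>p. (\<exists>i<Suc n. p i \<noteq> 0) \<and> (\<Oplus>i\<in>{..<Suc n}. ev f (p i) \<otimes> y i) = \<zero>"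
    using j by blast
qed

end

section \<open>Transcendence of nonconstant elements and finiteness of degrees\<close>

locale alg_closed_const_field = const_field K c
  for K :: "('b, 'm) ring_scheme" (structure) and c :: "'a::alg_closed_field \<Rightarrow> 'b"
begin

text \<open>As long as the degree is positive there is a root, so a factor \<open>f - a\<close>
  splits off; it is nonzero because \<open>f\<close> is not a constant. Hence every nonconstant
  element is transcendental.\<close>

lemma ev_nonzero:
  assumes f: "f \<in> carrier K" "f \<notin> range c" and p: "p \<noteq> 0"
  shows "ev f p \<noteq> \<zero>"
  using p
proof (induction "Polynomial.degree p" arbitrary: p rule: less_induct)
  case less
  show ?case
  proof (cases "Polynomial.degree p = 0")
    case True
    then obtain a where "p = [:a:]" by (metis degree_eq_zeroE)
    then show ?thesis using less f by simp
  next
    case False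
    then obtain a where "poly p a = 0" using alg_closed_imp_poly_has_root by blast
    then obtain q where q: "p = [:- a, 1:] * q" by (metis dvdE poly_eq_0_iff_dvd)
    then have "q \<noteq> 0" using less by auto
    moreover have "Polynomial.degree q < Polynomial.degree p"
      using q \<open>q \<noteq> 0\<close> by (simp add: degree_mult_eq del: mult_pCons_left)
    moreover have "ev f [:- a, 1:] \<noteq> \<zero>"
      using f by (simp add: c_uminus) (metis add.m_comm c_closed minus_eq r_right_minus_eq a_inv_closed rangeI)
    ultimately show ?thesis
      using less(1)[of q] f q by (simp add: ev_mult integral_iff del: ev_pCons mult_pCons_left)
  qed
qed

text \<open>Exchange in transcendence degree one: a relation of the powers of \<open>f\<close> over
  the polynomials in \<open>x\<close> is a polynomial relation between \<open>x\<close> and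
  \<open>f\<close>, which is then read as an equation for \<open>x\<close> with coefficients in the
  field generated by \<open>f\<close>.\<close>

lemma algebraic_exchange:
  assumes x: "x \<in> carrier K" and f: "f \<in> carrier K" "f \<notin> range c" and dep: "dep x N"
  shows "(algebraic over (generate_field K (insert f (range c)))) x"
proof -
  let ?E = "generate_field K (insert f (range c))"
  have sub: "subfield ?E K" by (rule generate_field_is_subfield) (use f in auto)
  obtain p where p: "\<exists>i\<in>{..<N}. p i \<noteq> 0" "(\<Oplus>i\<in>{..<N}. ev x (p i) \<otimes> f [^] i) = \<zero>"
    using depD[of x "{..<N}" "\<lambda>i. f [^] i"] dep x f by auto
  \<comment> \<open>\<open>D\<close> exceeds every degree in \<open>x\<close>, and
    \<open>q j\<close> gathers, as a polynomial in \<open>f\<close>, the coefficients that belong to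
    \<open>x ^ j\<close>.\<close>
  define D where "D = Suc (Max ((\<lambda>i. Polynomial.degree (p i)) ` {..<N}))"
  define q where "q j = (\<Sum>i<N. Polynomial.monom (Polynomial.coeff (p i) j) i)" for j
  have deg: "Polynomial.degree (p i) < D" if "i < N" for i
    using that unfolding D_def by (simp add: less_Suc_eq_le)
  have coeff_q: "Polynomial.coeff (q j) i = Polynomial.coeff (p i) j" if "i < N" for i j
    using that by (simp add: q_def coeff_sum sum.delta)
  have ev_p: "ev x (p i) = (\<Oplus>j\<in>{..<D}. c (Polynomial.coeff (p i) j) \<otimes> x [^] j)" if "i < N" for i
  proof -
    have "p i = (\<Sum>j<D. Polynomial.monom (Polynomial.coeff (p i) j) j)"
      by (rule poly_eqI) (use deg[OF that] in \<open>auto simp: coeff_sum sum.delta coeff_eq_0\<close>)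
    then have "ev x (p i) = ev x (\<Sum>j<D. Polynomial.monom (Polynomial.coeff (p i) j) j)" by simp
    then show ?thesis using x by (simp add: ev_sum ev_monom)
  qed
  define t where "t i j = c (Polynomial.coeff (p i) j) \<otimes> (x [^] j \<otimes> f [^] i)" for i j
  have tc: "t i j \<in> carrier K" for i j using x f by (simp add: t_def)
  have "\<zero> = (\<Oplus>i\<in>{..<N}. \<Oplus>j\<in>{..<D}. t i j)"
    unfolding p(2)[symmetric]
  proof (rule finsum_cong')
    show "ev x (p i) \<otimes> f [^] i = (\<Oplus>j\<in>{..<D}. t i j)" if "i \<in> {..<N}" for i
      using that x f by (simp add: ev_p t_def finsum_ldistr Pi_def m_assoc)
  qed (use tc in \<open>auto intro!: finsum_closed\<close>)
  also have "\<dots> = (\<Oplus>j\<in>{..<D}. \<Oplus>i\<in>{..<N}. t i j)"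
    by (rule finsum_swap) (use tc in auto)
  also have "\<dots> = (\<Oplus>j\<in>{..<D}. ev f (q j) \<otimes> x [^] j)"
  proof (rule finsum_cong')
    show "(\<Oplus>i\<in>{..<N}. t i j) = ev f (q j) \<otimes> x [^] j" if "j \<in> {..<D}" for j
    proof -
      have "(\<Oplus>i\<in>{..<N}. t i j) = (\<Oplus>i\<in>{..<N}. c (Polynomial.coeff (p i) j) \<otimes> f [^] i \<otimes> x [^] j)"
        by (rule finsum_cong') (use x f in \<open>auto simp: t_def m_ac\<close>)
      also have "\<dots> = (\<Oplus>i\<in>{..<N}. c (Polynomial.coeff (p i) j) \<otimes> f [^] i) \<otimes> x [^] j"
        by (rule finsum_ldistr[symmetric]) (use x f in auto)
      also have "\<dots> = ev f (q j) \<otimes> x [^] j"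
        unfolding q_def using f by (simp add: ev_sum ev_monom)
      finally show ?thesis .
    qed
  qed (use x f in auto)
  finally have zero: "(\<Oplus>j\<in>{..<D}. ev f (q j) \<otimes> x [^] j) = \<zero>" ..
  define L where "L = map (\<lambda>j. ev f (q j)) (rev [0..<D])"
  have LE: "set L \<subseteq> ?E"
  proof -
    have "ev f r \<in> ?E" for r
    proof (induction r)
      case 0
      show ?case using zero_in_generate by simp
    next
      case (pCons a r)
      then show ?case using f
        by (auto intro!: generate_field.eng_add generate_field.eng_mult intro: generate_field.incl)
    qed
    then show ?thesis by (auto simp: L_def)
  qed
  show ?thesis
  proof (rule algebraicI)
    show "normalize L \<in> carrier (?E[X])"
      using normalize_gives_polynomial[OF LE] by (simp add: univ_poly_carrier)
    \<comment> \<open>If all coefficients vanished, every \<open>q j\<close> with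
      \<open>j < D\<close> would be the zero polynomial, since \<open>f\<close> is transcendental.
      But the leading coefficient of a nonzero \<open>p i\<close> occurs in \<open>q j\<close> for
      \<open>j\<close> the degree of \<open>p i\<close>.\<close>
    show "normalize L \<noteq> []"
    proof
      assume "normalize L = []"
      then have "set L \<subseteq> {\<zero>}" using normalize_trick[of L] by (metis append_Nil2 set_replicate_conv_if subset_insertI2 subset_refl empty_subsetI)
      then have z: "ev f (q j) = \<zero>" if "j < D" for j using that by (force simp: L_def)
      obtain i where i: "i < N" "p i \<noteq> 0" using p by auto
      let ?j = "Polynomial.degree (p i)"
      have "q ?j \<noteq> 0" using coeff_q[OF i(1), of ?j] i by auto
      then show False using ev_nonzero[OF f] z[OF deg[OF i(1)]] by blast
    qed
    have "eval (normalize L) x = eval L x"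
      by (rule eval_normalize) (use LE generate_field_incl[of "insert f (range c)"] x f in auto)
    then show "eval (normalize L) x = \<zero>"
      unfolding L_def using x f zero by (simp add: eval_coefficient_list)
  qed
qed

text \<open>The whole field is finite over the field generated by \<open>x\<close>, being generated
  by the finitely many algebraic elements \<open>zs\<close>. Exchange makes \<open>x\<close>
  algebraic over the field generated by \<open>f\<close>, and the tower through the adjunction of
  \<open>x\<close> then has finite degree.\<close>

theorem dep_exists:
  assumes x: "x \<in> carrier K"
    and alg: "\<And>y. y \<in> carrier K \<Longrightarrow> (algebraic over (generate_field K (insert x (range c)))) y"
    and zs: "set zs \<subseteq> carrier K"
    and gen: "\<And>F. subfield F K \<Longrightarrow> range c \<subseteq> F \<Longrightarrow> set zs \<subseteq> F \<Longrightarrow> carrier K \<subseteq> F"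
    and f: "f \<in> carrier K" "f \<notin> range c"
  obtains N where "dep f N"
proof -
  let ?Ex = "generate_field K (insert x (range c))" and ?Ef = "generate_field K (insert f (range c))"
  have sub: "subfield ?Ex K" "subfield ?Ef K"
    by (rule generate_field_is_subfield; use x f in auto)+
  \<comment> \<open>The finite extension by \<open>zs\<close> is itself a subfield that contains the
    constants and \<open>zs\<close>, so the generation hypothesis makes it everything.\<close>
  have full: "finite_extension E zs = carrier K"
    if "subfield E K" "range c \<subseteq> E" "\<And>z. z \<in> set zs \<Longrightarrow> (algebraic over E) z" for E
  proof
    have E: "E \<subseteq> carrier K" using that(1) subfieldE(3) by blast
    show "finite_extension E zs \<subseteq> carrier K"
      by (rule finite_extension_in_carrier[OF E zs])
    show "carrier K \<subseteq> finite_extension E zs"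
    proof (rule gen)
      show "subfield (finite_extension E zs) K"
        by (rule finite_extension_is_subfield[OF that(1) zs that(3)])
      show "range c \<subseteq> finite_extension E zs"
        using finite_extension_incl[OF E zs] that(2) by blast
      show "set zs \<subseteq> finite_extension E zs"
        by (rule finite_extension_mem[OF subfieldE(1)[OF that(1)] zs])
    qed
  qed
  have incl: "range c \<subseteq> ?Ex" "range c \<subseteq> ?Ef" by (auto intro: generate_field.incl)
  have "finite_extension ?Ex zs = carrier K"
    using full[OF sub(1) incl(1)] alg zs by blast
  then have "finite_dimension ?Ex (carrier K)"
    using finite_extension_finite_dimension(1)[OF sub(1) zs] alg zs by auto
  then obtain n where "dimension n ?Ex (carrier K)" unfolding finite_dimension_def by blast
  then have "dep x (Suc n)" by (rule dep_of_finite_dimension[OF x])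
  then have xalg: "(algebraic over ?Ef) x" by (rule algebraic_exchange[OF x f])
  define F where "F = finite_extension ?Ef [x]"
  have F: "subfield F K" "finite_dimension ?Ef F"
    unfolding F_def
    using finite_extension_is_subfield[OF sub(2), of "[x]"]
      finite_extension_finite_dimension(1)[OF sub(2), of "[x]"] x xalg by auto
  have EfF: "?Ef \<subseteq> F" unfolding F_def
    by (rule finite_extension_incl) (use x subfieldE(3)[OF sub(2)] in auto)
  have "x \<in> F" unfolding F_def
    using finite_extension_mem[OF subfieldE(1)[OF sub(2)], of "[x]"] x by auto
  then have ExF: "?Ex \<subseteq> F"
  proof (intro generate_field_min_subfield1[OF _ F(1)])
    show "insert x (range c) \<subseteq> carrier K" using x by auto
    show "insert x (range c) \<subseteq> F" using \<open>x \<in> F\<close> EfF incl(2) by blast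
  qed
  have zalg: "(algebraic over F) z" if "z \<in> set zs" for z
    using algebraic_mono[OF ExF] alg that zs by blast
  have "finite_extension F zs = carrier K"
    using full[OF F(1) _ zalg] incl EfF by blast
  then have "finite_dimension F (carrier K)"
    using finite_extension_finite_dimension(1)[OF F(1) zs zalg] by simp
  then obtain m where m: "dimension m F (carrier K)" unfolding finite_dimension_def by blast
  obtain l where l: "dimension l ?Ef F" using F(2) unfolding finite_dimension_def by blast
  have "dimension (l * m) ?Ef (carrier K)" by (rule telescopic_base[OF sub(2) F(1) l m])
  then show ?thesis using dep_of_finite_dimension[OF f(1)] that by blast
qed

end

section \<open>The valuation of a residue local ring\<close>

context const_field
begin

text \<open>The laws of integer exponents are transferred from the group of nonzero elements along
  this identity.\<close>

lemma mult_of_zpow: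
  assumes "x \<in> carrier K" "x \<noteq> \<zero>"
  shows "x [^] (n::int) = x [^]\<^bsub>Multiplicative_Group.mult_of K\<^esub> n"
  using assms nat_pow_closed[OF assms(1)] nat_pow_nonzero[OF assms]
  by (simp del: pow_nat add: int_pow_def2 Multiplicative_Group.nat_pow_mult_of m_inv_mult_of)

lemma zpow_closed [simp, intro]: "x \<in> carrier K \<Longrightarrow> x \<noteq> \<zero> \<Longrightarrow> x [^] (n::int) \<in> carrier K"
  by (simp del: pow_nat add: int_pow_def2 nat_pow_nonzero)

lemma zpow_nonzero: "x \<in> carrier K \<Longrightarrow> x \<noteq> \<zero> \<Longrightarrow> x [^] (n::int) \<noteq> \<zero>"
  by (simp del: pow_nat add: int_pow_def2 nat_pow_nonzero inv_nonzero)

lemma zpow_add: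
  assumes "x \<in> carrier K" "x \<noteq> \<zero>"
  shows "x [^] (m + n :: int) = x [^] m \<otimes> x [^] n"
  using group.int_pow_mult[OF field_mult_group, of x m n] assms by (simp add: mult_of_zpow)

lemma zpow_minus:
  assumes "x \<in> carrier K" "x \<noteq> \<zero>"
  shows "x [^] (- n :: int) = inv (x [^] n)"
  using group.int_pow_neg[OF field_mult_group, of x n] assms zpow_closed[OF assms, of n] zpow_nonzero[OF assms, of n]
  by (simp add: mult_of_zpow m_inv_mult_of)

lemma zpow_mult_distrib:
  assumes "x \<in> carrier K" "x \<noteq> \<zero>" "y \<in> carrier K" "y \<noteq> \<zero>"
  shows "(x \<otimes> y) [^] (n :: int) = x [^] n \<otimes> y [^] n"
  using group.int_pow_mult_distrib[OF field_mult_group, of x y n] assms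
  by (simp add: mult_of_zpow m_comm integral_iff)

end

text \<open>The local ring at a point and its maximal ideal, as subsets of the function field.
  \<open>residue\<close> says that the residue field consists of the constants. \<open>M_dep\<close>
  takes the part of the Noetherian condition: it bounds how often an element can be divided by a
  generator of the ideal.\<close>

locale residue_local_ring = const_field K c
  for K :: "('b, 'm) ring_scheme" (structure) and c :: "'a::field \<Rightarrow> 'b" +
  fixes \<O> \<MM> :: "'b set"
  assumes O_carrier: "\<O> \<subseteq> carrier K"
    and c_O [simp, intro]: "c a \<in> \<O>"
    and O_add: "x \<in> \<O> \<Longrightarrow> y \<in> \<O> \<Longrightarrow> x \<oplus> y \<in> \<O>"
    and O_mult: "x \<in> \<O> \<Longrightarrow> y \<in> \<O> \<Longrightarrow> x \<otimes> y \<in> \<O>"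
    and M_O: "\<MM> \<subseteq> \<O>"
    and M_one: "\<one> \<notin> \<MM>"
    and inv_O: "x \<in> \<O> \<Longrightarrow> x \<notin> \<MM> \<Longrightarrow> inv x \<in> \<O>"
    and residue: "x \<in> \<O> \<Longrightarrow> \<exists>a. x \<ominus> c a \<in> \<MM>"
    and principal: "\<exists>t\<in>\<O>. \<MM> = {u \<otimes> t | u. u \<in> \<O>}"
    and fraction: "x \<in> carrier K \<Longrightarrow> \<exists>a\<in>\<O>. \<exists>b\<in>\<O>. b \<noteq> \<zero> \<and> x = a \<otimes> inv b"
    and M_nontrivial: "\<exists>x\<in>\<MM>. x \<noteq> \<zero>"
    and M_dep: "x \<in> \<MM> \<Longrightarrow> x \<noteq> \<zero> \<Longrightarrow> \<exists>N. dep x N"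
begin

definition uniformizer :: "'b \<Rightarrow> bool" where
  "uniformizer t \<longleftrightarrow> t \<in> \<O> \<and> \<MM> = {u \<otimes> t | u. u \<in> \<O>}"

definition \<U> :: "'b set" where
  "\<U> = {u \<in> \<O>. u \<noteq> \<zero> \<and> inv u \<in> \<O>}"

text \<open>The description ranges over all uniformizers, as in \<open>ord_at\<close>, so that the
  two coincide by unfolding. That the choice does not matter is settled by
  \<open>val_eq\<close>.\<close>

definition val :: "'b \<Rightarrow> int" where
  "val f = (THE n. \<exists>t u. uniformizer t \<and> u \<in> \<U> \<and> f = t [^] (n::int) \<otimes> u)"

lemma O_closed [simp, intro]: "x \<in> \<O> \<Longrightarrow> x \<in> carrier K"
  using O_carrier by blast

lemma zero_O [simp]: "\<zero> \<in> \<O>" and one_O [simp]: "\<one> \<in> \<O>"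
  using c_O[of 0] c_O[of 1] by auto

lemma M_closed [simp, intro]: "x \<in> \<MM> \<Longrightarrow> x \<in> carrier K"
  using M_O by blast

lemma exists_uniformizer: "\<exists>t. uniformizer t"
  using principal unfolding uniformizer_def by blast

lemma M_absorb: "x \<in> \<MM> \<Longrightarrow> y \<in> \<O> \<Longrightarrow> x \<otimes> y \<in> \<MM>"
proof -
  assume x: "x \<in> \<MM>" and y: "y \<in> \<O>"
  obtain t where t: "t \<in> \<O>" "\<MM> = {u \<otimes> t | u. u \<in> \<O>}" using principal by blast
  then obtain u where u: "u \<in> \<O>" "x = u \<otimes> t" using x by blast
  then have "x \<otimes> y = (u \<otimes> y) \<otimes> t" using t y by (simp add: m_ac)
  then show ?thesis using t u y O_mult by blast
qed

lemma M_add: "x \<in> \<MM> \<Longrightarrow> y \<in> \<MM> \<Longrightarrow> x \<oplus> y \<in> \<MM>"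
proof -
  assume x: "x \<in> \<MM>" and y: "y \<in> \<MM>"
  obtain t where t: "t \<in> \<O>" "\<MM> = {u \<otimes> t | u. u \<in> \<O>}" using principal by blast
  then obtain u v where u: "u \<in> \<O>" "x = u \<otimes> t" "v \<in> \<O>" "y = v \<otimes> t" using x y by blast
  then have "x \<oplus> y = (u \<oplus> v) \<otimes> t" using t by (simp add: l_distr)
  then show ?thesis using t u O_add by blast
qed

lemma M_uminus: "x \<in> \<MM> \<Longrightarrow> \<ominus> x \<in> \<MM>"
  using M_absorb[of x "c (-1)"] c_O[of "-1"] by (simp add: c_uminus[of 1] r_minus M_closed)

lemma zero_M [simp]: "\<zero> \<in> \<MM>"
  using M_nontrivial M_absorb[of _ \<zero>] by (metis M_closed r_null zero_O)

lemma U_O: "u \<in> \<U> \<Longrightarrow> u \<in> \<O>" and U_nonzero: "u \<in> \<U> \<Longrightarrow> u \<noteq> \<zero>"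
  and U_inv: "u \<in> \<U> \<Longrightarrow> inv u \<in> \<U>"
  by (auto simp: \<U>_def inv_nonzero)

lemma U_iff: "u \<in> \<U> \<longleftrightarrow> u \<in> \<O> \<and> u \<notin> \<MM>"
proof (intro iffI conjI)
  assume u: "u \<in> \<U>"
  then show "u \<in> \<O>" by (rule U_O)
  show "u \<notin> \<MM>"
  proof
    assume "u \<in> \<MM>"
    then have "u \<otimes> inv u \<in> \<MM>" using u by (intro M_absorb) (auto simp: \<U>_def)
    moreover have "u \<otimes> inv u = \<one>" using u by (auto simp: \<U>_def O_closed)
    ultimately show False using M_one by simp
  qed
next
  assume "u \<in> \<O> \<and> u \<notin> \<MM>"
  then show "u \<in> \<U>" using inv_O by (auto simp: \<U>_def)
qed

lemma U_mult: "u \<in> \<U> \<Longrightarrow> v \<in> \<U> \<Longrightarrow> u \<otimes> v \<in> \<U>"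
  by (auto simp: \<U>_def integral_iff inv_mult_nz O_mult)

lemma U_one [simp]: "\<one> \<in> \<U>"
  by (simp add: U_iff M_one)

lemma U_const: "a \<noteq> 0 \<Longrightarrow> c a \<in> \<U>"
  by (auto simp: \<U>_def c_inverse)

declare U_O [simp]

lemma U_closed [simp, intro]: "u \<in> \<U> \<Longrightarrow> u \<in> carrier K"
  by auto

lemma U_add_M: "u \<in> \<U> \<Longrightarrow> x \<in> \<MM> \<Longrightarrow> u \<oplus> x \<in> \<U>"
proof -
  assume u: "u \<in> \<U>" and x: "x \<in> \<MM>"
  have "u \<oplus> x \<notin> \<MM>"
  proof
    assume "u \<oplus> x \<in> \<MM>"
    then have "u \<oplus> x \<oplus> \<ominus> x \<in> \<MM>" using x M_add M_uminus by blast
    moreover have "u \<oplus> x \<oplus> \<ominus> x = u" using u x by (simp add: a_assoc r_neg)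
    ultimately show False using u by (simp add: U_iff)
  qed
  then show ?thesis using u x M_O O_add by (auto simp: U_iff)
qed

section \<open>Divisibility by powers of a fixed uniformizer\<close>

context
  fixes t assumes t: "uniformizer t"
begin

lemma t_O [simp]: "t \<in> \<O>" and M_eq: "\<MM> = {u \<otimes> t | u. u \<in> \<O>}"
  using t by (auto simp: uniformizer_def)

lemma t_closed [simp]: "t \<in> carrier K"
  by (simp add: O_closed)

lemma t_M [simp]: "t \<in> \<MM>"
proof -
  have "t = \<one> \<otimes> t" by simp
  then show ?thesis unfolding M_eq using one_O by blast
qed

lemma t_nonzero [simp]: "t \<noteq> \<zero>"
proof
  assume "t = \<zero>"
  then have "\<MM> \<subseteq> {\<zero>}" unfolding M_eq by auto
  then show False using M_nontrivial by blast
qed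

lemma t_pow_O [simp]: "t [^] (n::nat) \<in> \<O>"
  by (induction n) (auto simp: O_mult)

text \<open>\<open>j\<close> is the multiplicity of zero as a root of \<open>p\<close>. The
  remaining factor has a nonzero constant term, and a unit plus an element of the maximal ideal is a
  unit.\<close>

lemma ev_eq_power_unit: "p \<noteq> 0 \<Longrightarrow> \<exists>j\<le>Polynomial.degree p. \<exists>u\<in>\<U>. ev t p = t [^] j \<otimes> u"
proof (induction p)
  case (pCons a p)
  have evO: "ev t q \<in> \<O>" for q
    by (induction q) (auto simp: O_add O_mult)
  show ?case
  proof (cases "a = 0")
    case True
    then have "p \<noteq> 0" using pCons by auto
    then obtain j u where j: "j \<le> Polynomial.degree p" "u \<in> \<U>" "ev t p = t [^] j \<otimes> u"
      using pCons by blast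
    then have "ev t (pCons a p) = t [^] Suc j \<otimes> u" using True by (simp add: m_ac)
    then show ?thesis using j \<open>p \<noteq> 0\<close> by (intro exI[of _ "Suc j"]) auto
  next
    case False
    have "c a \<oplus> t \<otimes> ev t p \<in> \<U>"
      using U_const[OF False] M_absorb[OF t_M evO] by (rule U_add_M)
    then show ?thesis by (intro exI[of _ 0]) auto
  qed
qed auto

text \<open>If \<open>x\<close> were divisible by \<open>t ^ N\<close>, then \<open>1, t, \<dots>, t ^ (N - 1)\<close> would be linearly independent
  over the polynomials in \<open>x\<close>.\<close>

lemma bounded_divisibility:
  assumes x: "x \<in> \<MM>" "x \<noteq> \<zero>" and N: "dep x N" and y: "y \<in> \<O>"
  shows "x \<noteq> t [^] N \<otimes> y"
proof
  assume xy: "x = t [^] N \<otimes> y"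
  have evO: "ev x q \<in> \<O>" for q
    using x M_O by (induction q) (auto simp: O_add O_mult)
  obtain p where p: "\<exists>i\<in>{..<N}. Polynomial.coeff (p i) 0 \<noteq> 0"
      "(\<Oplus>i\<in>{..<N}. ev x (p i) \<otimes> t [^] i) = \<zero>"
    using dep_reduced[of x "{..<N}" "\<lambda>i. t [^] i"] N x by auto
  define a where "a i = Polynomial.coeff (p i) 0" for i
  have "\<exists>q. p i = pCons (a i) q" for i unfolding a_def by (cases "p i") auto
  then obtain q where q: "\<And>i. p i = pCons (a i) (q i)" by metis
  \<comment> \<open>\<open>r\<close> collects the constant terms of the coefficients. The rest of
    the relation is divisible by \<open>x\<close>, hence by \<open>t ^ N\<close>, whereas
    \<open>r\<close> has degree below \<open>N\<close>.\<close>
  define r where "r = (\<Sum>i<N. Polynomial.monom (a i) i)"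
  have coeff_r: "Polynomial.coeff r i = (if i < N then a i else 0)" for i
    by (simp add: r_def coeff_sum)
  have r: "r \<noteq> 0" using p(1) coeff_r by (metis a_def lessThan_iff Polynomial.coeff_0)
  have "Polynomial.degree r < N"
    using r coeff_r by (metis leading_coeff_0_iff)
  then obtain j u where j: "j < N" "u \<in> \<U>" "ev t r = t [^] j \<otimes> u"
    using ev_eq_power_unit[OF r] le_less_trans by blast
  define s where "s = (\<Oplus>i\<in>{..<N}. ev x (q i) \<otimes> t [^] i)"
  have s: "s \<in> \<O>" unfolding s_def
    by (rule finsum_member) (use evO O_mult O_add O_carrier in auto)
  have "\<zero> = (\<Oplus>i\<in>{..<N}. c (a i) \<otimes> t [^] i \<oplus> x \<otimes> (ev x (q i) \<otimes> t [^] i))"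
    unfolding p(2)[symmetric] using x
    by (intro finsum_cong') (auto simp: q l_distr m_assoc)
  also have "\<dots> = ev t r \<oplus> x \<otimes> s"
    unfolding s_def r_def using x
    by (simp add: finsum_addf ev_sum ev_monom finsum_lmult Pi_def)
  finally have eq: "t [^] j \<otimes> u \<oplus> t [^] N \<otimes> (y \<otimes> s) = \<zero>"
    using j s y by (simp add: xy m_assoc O_closed)
  have N_eq: "t [^] N = t [^] j \<otimes> (t [^] (N - j - 1) \<otimes> t)"
  proof -
    have "t [^] j \<otimes> t [^] Suc (N - j - 1) = t [^] N"
      using j nat_pow_mult[OF t_closed, of j "Suc (N - j - 1)"] by (simp del: nat_pow_Suc)
    then show ?thesis by simp
  qed
  \<comment> \<open>After division by \<open>t ^ j\<close> there remains a unit plus a multiple of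
    \<open>t\<close>, because \<open>j < N\<close>. Such a sum is a unit and cannot be zero.\<close>
  have "t [^] j \<otimes> (u \<oplus> t \<otimes> (t [^] (N - j - 1) \<otimes> (y \<otimes> s))) = \<zero>"
    using eq j s y unfolding N_eq by (simp add: r_distr m_ac O_closed)
  then have "u \<oplus> t \<otimes> (t [^] (N - j - 1) \<otimes> (y \<otimes> s)) = \<zero>"
    using j s y nat_pow_nonzero[OF t_closed t_nonzero, of j]
    by (subst (asm) integral_iff) auto
  moreover have "u \<oplus> t \<otimes> (t [^] (N - j - 1) \<otimes> (y \<otimes> s)) \<in> \<U>"
    using j s y by (intro U_add_M M_absorb t_M O_mult) auto
  ultimately show False using U_nonzero by blast
qed

text \<open>Divide by \<open>t\<close> as long as possible. The bound on divisibility gives a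
  largest exponent, and the cofactor that belongs to it lies outside the maximal ideal.\<close>

lemma O_eq_power_unit:
  assumes x: "x \<in> \<O>" "x \<noteq> \<zero>"
  obtains n u where "u \<in> \<U>" "x = t [^] (n::nat) \<otimes> u"
proof (cases "x \<in> \<MM>")
  case False
  then have "x \<in> \<U>" using x by (simp add: U_iff)
  then show ?thesis using that[of x 0] x by simp
next
  case True
  then obtain N where N: "dep x N" using M_dep x by blast
  define S where "S = {n::nat. \<exists>y\<in>\<O>. x = t [^] n \<otimes> y}"
  have "n < N" if n: "n \<in> S" for n
  proof (rule ccontr)
    assume "\<not> n < N"
    obtain y where y: "y \<in> \<O>" "x = t [^] n \<otimes> y" using n unfolding S_def by blast
    have "t [^] n = t [^] N \<otimes> t [^] (n - N)"
      using \<open>\<not> n < N\<close> nat_pow_mult[OF t_closed, of N "n - N"] by simp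
    then have "x = t [^] N \<otimes> (t [^] (n - N) \<otimes> y)" using y by (simp add: m_assoc O_closed)
    then show False using bounded_divisibility[OF True x(2) N, of "t [^] (n - N) \<otimes> y"] y O_mult by auto
  qed
  then have fin: "finite S" by (meson finite_lessThan lessThan_iff rev_finite_subset subsetI)
  have "0 \<in> S" using x by (auto simp: S_def)
  define n where "n = Max S"
  have "n \<in> S" using fin \<open>0 \<in> S\<close> unfolding n_def by (intro Max_in) auto
  then obtain y where y: "y \<in> \<O>" "x = t [^] n \<otimes> y" unfolding S_def by auto
  have "y \<notin> \<MM>"
  proof
    assume "y \<in> \<MM>"
    then obtain z where z: "z \<in> \<O>" "y = z \<otimes> t" unfolding M_eq by blast
    have "t [^] n \<otimes> (z \<otimes> t) = t [^] Suc n \<otimes> z" using z(1) by (simp add: m_ac O_closed)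
    then have "x = t [^] Suc n \<otimes> z" using y(2) z(2) by simp
    then have "Suc n \<in> S" using z(1) unfolding S_def by blast
    then have "Suc n \<le> n" unfolding n_def by (rule Max_ge[OF fin])
    then show False by simp
  qed
  then show ?thesis using that[of y n] y by (simp add: U_iff)
qed

end

section \<open>Integer exponents and the valuation\<close>

lemma exists_power_unit:
  assumes t: "uniformizer t" and x: "x \<in> carrier K" "x \<noteq> \<zero>"
  obtains n u where "u \<in> \<U>" "x = t [^] (n::int) \<otimes> u"
proof -
  note [simp] = t_closed[OF t] t_nonzero[OF t]
  obtain a b where ab: "a \<in> \<O>" "b \<in> \<O>" "b \<noteq> \<zero>" "x = a \<otimes> inv b"
    using fraction x by blast
  have "a \<noteq> \<zero>" using ab x by auto
  obtain m u where u: "u \<in> \<U>" "a = t [^] (m::nat) \<otimes> u"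
    using O_eq_power_unit[OF t ab(1) \<open>a \<noteq> \<zero>\<close>] by blast
  obtain n v where v: "v \<in> \<U>" "b = t [^] (n::nat) \<otimes> v"
    using O_eq_power_unit[OF t ab(2,3)] by blast
  have "inv b = t [^] (- int n) \<otimes> inv v"
    using v U_nonzero[OF v(1)] by (simp add: inv_mult_nz nat_pow_nonzero zpow_minus int_pow_int)
  then have "x = t [^] (int m) \<otimes> u \<otimes> (t [^] (- int n) \<otimes> inv v)"
    using ab u by (simp add: int_pow_int)
  also have "\<dots> = (t [^] (int m) \<otimes> t [^] (- int n)) \<otimes> (u \<otimes> inv v)"
    using u v U_nonzero[OF v(1)] by (simp only: m_ac zpow_closed m_closed t_closed[OF t] t_nonzero[OF t] U_closed inv_in_carrier not_False_eq_True)
  also have "\<dots> = t [^] (int m + - int n) \<otimes> (u \<otimes> inv v)"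
    by (subst zpow_add) auto
  finally show ?thesis using that u v U_mult U_inv by blast
qed

lemma U_pow: "w \<in> \<U> \<Longrightarrow> w [^] (n::nat) \<in> \<U>"
  by (induction n) (auto simp: U_mult)

lemma U_zpow: "w \<in> \<U> \<Longrightarrow> w [^] (n::int) \<in> \<U>"
  by (simp del: pow_nat add: int_pow_def2 U_pow U_inv)

text \<open>A positive exponent puts the product into the maximal ideal. For a negative one the same
  happens to the inverse, which is a unit as well.\<close>

lemma power_unit_in_U:
  assumes t: "uniformizer t" and u: "u \<in> \<U>" and U: "t [^] (n::int) \<otimes> u \<in> \<U>"
  shows "n = 0"
proof -
  note [simp] = t_closed[OF t] t_nonzero[OF t]
  have not_U: "t [^] (Suc k) \<otimes> v \<notin> \<U>" if "v \<in> \<U>" for k v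
  proof -
    have "t [^] (Suc k) \<otimes> v = t \<otimes> (t [^] k \<otimes> v)" using that by (simp add: m_ac)
    moreover have "t \<otimes> (t [^] k \<otimes> v) \<in> \<MM>"
      using that by (intro M_absorb t_M[OF t] O_mult t_pow_O[OF t]) auto
    ultimately show ?thesis by (simp add: U_iff)
  qed
  consider "n = 0" | k where "n = int (Suc k)" | k where "n = - int (Suc k)"
    by (metis int_cases3 not0_implies_Suc of_nat_0 less_irrefl zero_less_iff_neq_zero)
  then show ?thesis
  proof cases
    case 2
    then have "t [^] (Suc k) \<otimes> u \<in> \<U>" using U by (simp only: int_pow_int)
    then show ?thesis using not_U u by blast
  next
    case 3
    have "inv (t [^] n \<otimes> u) = t [^] (Suc k) \<otimes> inv u"
      using u U_nonzero[OF u] unfolding 3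
      by (simp only: inv_mult_nz zpow_closed zpow_nonzero zpow_minus U_closed t_closed[OF t] t_nonzero[OF t]
          not_False_eq_True int_pow_int inv_inv_nz nat_pow_closed nat_pow_nonzero inv_nonzero inv_in_carrier)
    then show ?thesis using not_U[OF U_inv[OF u], of k] U_inv[OF U] by simp
  qed
qed

text \<open>Two generators of one principal ideal divide each other, and in a domain the two
  cofactors are inverse to each other.\<close>

lemma uniformizer_unique:
  assumes "uniformizer t" "uniformizer t'"
  obtains w where "w \<in> \<U>" "t' = t \<otimes> w"
proof -
  note [simp] = t_closed[OF assms(1)] t_nonzero[OF assms(1)] t_closed[OF assms(2)] t_nonzero[OF assms(2)]
  have "t' \<in> {u \<otimes> t | u. u \<in> \<O>}" "t \<in> {u \<otimes> t' | u. u \<in> \<O>}"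
    using t_M assms M_eq by blast+
  then obtain w v where w: "w \<in> \<O>" "t' = w \<otimes> t" and v: "v \<in> \<O>" "t = v \<otimes> t'" by blast
  have "(w \<otimes> v) \<otimes> t' = \<one> \<otimes> t'"
    by (metis w(1) v(1) w(2) v(2) O_closed l_one m_assoc t_closed[OF assms(2)])
  then have "w \<otimes> v = \<one>"
    by (subst (asm) m_rcancel) (use w(1) v(1) in \<open>auto simp: O_closed\<close>)
  then have "inv w = v" using w(1) v(1) by (simp add: comm_inv_char O_closed)
  moreover have "w \<noteq> \<zero>" using \<open>w \<otimes> v = \<one>\<close> v(1) by auto
  ultimately have "w \<in> \<U>" using w(1) v(1) by (simp add: \<U>_def del: U_O)
  moreover have "w \<otimes> t = t \<otimes> w" by (rule m_comm) (use w(1) in auto)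
  ultimately show ?thesis using that[of w] w(2) by metis
qed

text \<open>Any other uniformizer is \<open>t\<close> times a unit. Comparing two expressions of the
  same element, \<open>t\<close> to the difference of the exponents, times a unit, is a unit, and
  \<open>power_unit_in_U\<close> makes the difference zero.\<close>

lemma val_eq:
  assumes t: "uniformizer t" and u: "u \<in> \<U>"
  shows "val (t [^] n \<otimes> u) = n"
  unfolding val_def
proof (rule the_equality)
  show "\<exists>t' u'. uniformizer t' \<and> u' \<in> \<U> \<and> t [^] n \<otimes> u = t' [^] n \<otimes> u'" using t u by blast
  fix m :: int assume "\<exists>t' u'. uniformizer t' \<and> u' \<in> \<U> \<and> t [^] n \<otimes> u = t' [^] m \<otimes> u'"
  then obtain t' v where v: "uniformizer t'" "v \<in> \<U>" "t [^] n \<otimes> u = t' [^] m \<otimes> v" by blast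
  obtain w where w: "w \<in> \<U>" "t' = t \<otimes> w" using uniformizer_unique[OF t v(1)] by blast
  note [simp] = t_closed[OF t] t_nonzero[OF t] U_nonzero[OF u] U_nonzero[OF v(2)] U_nonzero[OF w(1)]
  have "t [^] n \<otimes> u = t [^] m \<otimes> (w [^] m \<otimes> v)"
    using v w by (simp add: zpow_mult_distrib m_assoc)
  note E = this
  have "t [^] (- m + n) \<otimes> u = t [^] (- m) \<otimes> (t [^] n \<otimes> u)"
    using u by (subst zpow_add) (auto simp: m_assoc)
  also have "\<dots> = t [^] (- m) \<otimes> (t [^] m \<otimes> (w [^] m \<otimes> v))" by (simp only: E)
  also have "\<dots> = t [^] (- m + m) \<otimes> (w [^] m \<otimes> v)"
    using v(2) w(1) by (subst zpow_add) (auto simp: m_assoc)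
  finally have "t [^] (- m + n) \<otimes> u = w [^] m \<otimes> v" using v(2) w(1) by simp
  then have "t [^] (- m + n) \<otimes> u \<in> \<U>" using v w by (simp add: U_mult U_zpow)
  then show "m = n" using power_unit_in_U[OF t u] by fastforce
qed

lemma val_mult:
  assumes "x \<in> carrier K" "y \<in> carrier K" "x \<noteq> \<zero>" "y \<noteq> \<zero>"
  shows "val (x \<otimes> y) = val x + val y"
proof -
  obtain t where t: "uniformizer t" using exists_uniformizer by blast
  note [simp] = t_closed[OF t] t_nonzero[OF t]
  obtain m u where u: "u \<in> \<U>" "x = t [^] (m::int) \<otimes> u" using exists_power_unit[OF t] assms by metis
  obtain n v where v: "v \<in> \<U>" "y = t [^] (n::int) \<otimes> v" using exists_power_unit[OF t] assms by metis
  have "x \<otimes> y = t [^] (m + n) \<otimes> (u \<otimes> v)"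
    using u v by (simp add: zpow_add m_ac)
  then show ?thesis using u v val_eq[OF t] U_mult by simp
qed

lemma val_U: "u \<in> \<U> \<Longrightarrow> val u = 0"
  using exists_uniformizer val_eq[of _ u 0] by (metis U_closed int_pow_0 l_one)

lemma val_const: "a \<noteq> 0 \<Longrightarrow> val (c a) = 0"
  by (rule val_U[OF U_const])

lemma val_uniformizer: "uniformizer t \<Longrightarrow> val t = 1"
  using val_eq[of t \<one> 1] by (simp add: t_closed int_pow_def2)

lemma O_iff:
  assumes "x \<in> carrier K" "x \<noteq> \<zero>"
  shows "x \<in> \<O> \<longleftrightarrow> 0 \<le> val x"
proof -
  obtain t where t: "uniformizer t" using exists_uniformizer by blast
  note [simp] = t_closed[OF t] t_nonzero[OF t]
  obtain m u where u: "u \<in> \<U>" "x = t [^] (m::int) \<otimes> u" using exists_power_unit[OF t] assms by metis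
  have m: "val x = m" using val_eq[OF t] u by simp
  show ?thesis
  proof
    assume "x \<in> \<O>"
    then obtain n v where v: "v \<in> \<U>" "x = t [^] (n::nat) \<otimes> v"
      using O_eq_power_unit[OF t] assms by metis
    then have "val x = int n" using val_eq[OF t, of v "int n"] by (simp add: int_pow_int)
    then show "0 \<le> val x" by simp
  next
    assume "0 \<le> val x"
    then obtain k where "m = int k" using m nonneg_int_cases by auto
    then show "x \<in> \<O>" using u t_pow_O[OF t] by (auto simp: int_pow_int intro!: O_mult)
  qed
qed

lemma M_iff:
  assumes "x \<in> carrier K" "x \<noteq> \<zero>"
  shows "x \<in> \<MM> \<longleftrightarrow> 0 < val x"
proof
  assume x: "x \<in> \<MM>"
  obtain t where t: "uniformizer t" using exists_uniformizer by blast
  then obtain u where u: "u \<in> \<O>" "x = u \<otimes> t" using x M_eq by blast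
  then have "u \<noteq> \<zero>" using assms t_closed[OF t] by auto
  then have "val x = val u + 1"
    using u t t_closed[OF t] t_nonzero[OF t] by (simp add: val_mult O_closed val_uniformizer)
  then show "0 < val x" using O_iff[of u] u \<open>u \<noteq> \<zero>\<close> by (auto simp: O_closed)
next
  assume x: "0 < val x"
  then have "x \<in> \<O>" using O_iff assms by auto
  then show "x \<in> \<MM>" using val_U[of x] x by (auto simp: U_iff)
qed

lemma val_add:
  assumes "x \<in> carrier K" "y \<in> carrier K" "x \<noteq> \<zero>" "y \<noteq> \<zero>" "x \<oplus> y \<noteq> \<zero>"
  shows "min (val x) (val y) \<le> val (x \<oplus> y)"
proof -
  \<comment> \<open>With \<open>x\<close> of smaller value, \<open>x \<oplus> y\<close> is
    \<open>x\<close> times \<open>\<one> \<oplus> y \<otimes> inv x\<close>, and the second factor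
    lies in the ring because the quotient has nonnegative value. The general case follows by
    symmetry.\<close>
  have *: "val x \<le> val (x \<oplus> y)"
    if "x \<in> carrier K" "y \<in> carrier K" "x \<noteq> \<zero>" "y \<noteq> \<zero>" "x \<oplus> y \<noteq> \<zero>" "val x \<le> val y" for x y
  proof -
    have i: "inv x \<in> carrier K" "inv x \<noteq> \<zero>" using that inv_nonzero by auto
    have "val y = val (y \<otimes> inv x) + val x"
      using val_mult[of "y \<otimes> inv x" x] that i by (simp add: m_assoc integral_iff)
    then have "y \<otimes> inv x \<in> \<O>" using that O_iff[of "y \<otimes> inv x"] i by (simp add: integral_iff)
    then have O: "\<one> \<oplus> y \<otimes> inv x \<in> \<O>" by (simp add: O_add)
    have eq: "x \<oplus> y = (\<one> \<oplus> y \<otimes> inv x) \<otimes> x"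
      using that i by (simp add: l_distr m_assoc)
    then have nz: "\<one> \<oplus> y \<otimes> inv x \<noteq> \<zero>" using that by auto
    have "val (x \<oplus> y) = val (\<one> \<oplus> y \<otimes> inv x) + val x"
      unfolding eq using that nz O by (simp add: val_mult O_closed)
    then show ?thesis using O nz O_iff by (auto simp: O_closed)
  qed
  show ?thesis
  proof (cases "val x \<le> val y")
    case True
    then show ?thesis using *[of x y] assms by simp
  next
    case False
    then show ?thesis using *[of y x] assms by (simp add: a_comm)
  qed
qed

end

section \<open>The degree of a principal divisor\<close>

context const_field
begin

lemma dep_mono:
  assumes N: "dep f N" "N \<le> M" and f: "f \<in> carrier K"
  shows "dep f M"
  unfolding dep_def
proof
  fix y assume y: "y \<in> {..<M} \<rightarrow> carrier K"
  then have "y \<in> {..<N} \<rightarrow> carrier K" using N(2) by auto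
  then obtain p where p: "\<exists>i<N. p i \<noteq> 0" "(\<Oplus>i\<in>{..<N}. ev f (p i) \<otimes> y i) = \<zero>"
    using N(1) unfolding dep_def by blast
  define q where "q i = (if i < N then p i else 0)" for i
  have split: "{..<M} = {..<N} \<union> {N..<M}" using N(2) by auto
  have "(\<Oplus>i\<in>{..<M}. ev f (q i) \<otimes> y i)
     = (\<Oplus>i\<in>{..<N}. ev f (q i) \<otimes> y i) \<oplus> (\<Oplus>i\<in>{N..<M}. ev f (q i) \<otimes> y i)"
    unfolding split by (rule finsum_Un_disjoint) (use y N(2) f in \<open>auto simp: Pi_iff\<close>)
  also have "(\<Oplus>i\<in>{..<N}. ev f (q i) \<otimes> y i) = (\<Oplus>i\<in>{..<N}. ev f (p i) \<otimes> y i)"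
    by (rule finsum_cong') (use y N(2) f in \<open>auto simp: q_def Pi_iff\<close>)
  also have "(\<Oplus>i\<in>{N..<M}. ev f (q i) \<otimes> y i) = (\<Oplus>i\<in>{N..<M}. \<zero>)"
    by (rule finsum_cong') (use y N(2) f in \<open>auto simp: q_def Pi_iff\<close>)
  finally have "(\<Oplus>i\<in>{..<M}. ev f (q i) \<otimes> y i) = \<zero>" using p by simp
  moreover have "\<exists>i<M. q i \<noteq> 0" using p(1) N(2) by (auto simp: q_def)
  ultimately show "\<exists>p. (\<exists>i<M. p i \<noteq> 0) \<and> (\<Oplus>i\<in>{..<M}. ev f (p i) \<otimes> y i) = \<zero>" by blast
qed

lemma finsum_Times:
  assumes "finite I" "finite J" "\<And>i j. i \<in> I \<Longrightarrow> j \<in> J \<Longrightarrow> g (i, j) \<in> carrier K"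
  shows "(\<Oplus>p\<in>I \<times> J. g p) = (\<Oplus>i\<in>I. \<Oplus>j\<in>J. g (i, j))"
  using assms(1,3)
proof (induction I rule: finite_induct)
  case (insert i I)
  have "(\<Oplus>p\<in>insert i I \<times> J. g p) = (\<Oplus>p\<in>Pair i ` J \<union> I \<times> J. g p)"
    by (rule arg_cong[where f = "finsum K g"]) auto
  also have "\<dots> = (\<Oplus>p\<in>Pair i ` J. g p) \<oplus> (\<Oplus>p\<in>I \<times> J. g p)"
    by (rule finsum_Un_disjoint) (use insert assms(2) in auto)
  also have "(\<Oplus>p\<in>Pair i ` J. g p) = (\<Oplus>j\<in>J. g (i, j))"
    by (rule finsum_reindex) (use insert in \<open>auto simp: inj_on_def\<close>)
  finally show ?case using insert by (subst finsum_insert) (auto intro!: finsum_closed)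
qed simp

lemma minus_minus_cancel:
  assumes "x \<in> carrier K" "y \<in> carrier K" "z \<in> carrier K"
  shows "(x \<ominus> z) \<ominus> (y \<ominus> z) = x \<ominus> y"
  using assms by (simp add: a_minus_def minus_add a_assoc a_lcomm[of "\<ominus> z"] l_neg)

lemma c_sum: "finite I \<Longrightarrow> c (sum a I) = (\<Oplus>i\<in>I. c (a i))"
  by (induction I rule: finite_induct) (auto simp: c_add Pi_def)

lemma finsum_remove:
  assumes "finite I" "i \<in> I" "g \<in> I \<rightarrow> carrier K"
  shows "(\<Oplus>j\<in>I. g j) = g i \<oplus> (\<Oplus>j\<in>I - {i}. g j)"
  using finsum_insert[of "I - {i}" i g] assms by (auto simp: insert_absorb)

end

text \<open>What the degree argument uses of the geometry: a family of discrete valuations, trivial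
  on the constants and with the constants as residue field, any two of which are separated by a
  function that is regular at a prescribed finite set. The value at zero is left open.\<close>

locale valued_curve = const_field K c
  for K :: "('b, 'm) ring_scheme" (structure) and c :: "'a::field \<Rightarrow> 'b" +
  fixes Pts :: "'p set" and v :: "'p \<Rightarrow> 'b \<Rightarrow> int"
  assumes v_mult: "P \<in> Pts \<Longrightarrow> x \<in> carrier K \<Longrightarrow> y \<in> carrier K \<Longrightarrow> x \<noteq> \<zero> \<Longrightarrow> y \<noteq> \<zero> \<Longrightarrow>
      v P (x \<otimes> y) = v P x + v P y"
    and v_add: "P \<in> Pts \<Longrightarrow> x \<in> carrier K \<Longrightarrow> y \<in> carrier K \<Longrightarrow> x \<noteq> \<zero> \<Longrightarrow> y \<noteq> \<zero> \<Longrightarrow> x \<oplus> y \<noteq> \<zero> \<Longrightarrow>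
      min (v P x) (v P y) \<le> v P (x \<oplus> y)"
    and v_const: "P \<in> Pts \<Longrightarrow> a \<noteq> 0 \<Longrightarrow> v P (c a) = 0"
    and v_residue: "P \<in> Pts \<Longrightarrow> x \<in> carrier K \<Longrightarrow> x \<noteq> \<zero> \<Longrightarrow> 0 \<le> v P x \<Longrightarrow>
      \<exists>a. x \<ominus> c a = \<zero> \<or> 0 < v P (x \<ominus> c a)"
    and v_uniformizer: "P \<in> Pts \<Longrightarrow> \<exists>t\<in>carrier K. t \<noteq> \<zero> \<and> v P t = 1"
    and separation: "finite S \<Longrightarrow> S \<subseteq> Pts \<Longrightarrow> P \<in> S \<Longrightarrow> Q \<in> S \<Longrightarrow> P \<noteq> Q \<Longrightarrow>
      \<exists>h\<in>carrier K. h \<noteq> \<zero> \<and> (\<forall>R\<in>S. 0 \<le> v R h) \<and> 0 < v Q h \<and> v P h = 0"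
    and exists_dep: "f \<in> carrier K \<Longrightarrow> f \<notin> range c \<Longrightarrow> \<exists>N. dep f N"
begin

text \<open>Zero counts as having every order, as with value infinity. Sums and differences can then
  be estimated without side conditions on vanishing.\<close>

definition ge :: "'p \<Rightarrow> int \<Rightarrow> 'b \<Rightarrow> bool" where
  "ge P n x \<longleftrightarrow> x \<in> carrier K \<and> (x \<noteq> \<zero> \<longrightarrow> n \<le> v P x)"

lemma ge_closed: "ge P n x \<Longrightarrow> x \<in> carrier K"
  by (simp add: ge_def)

lemma ge_zero [simp]: "ge P n \<zero>"
  by (simp add: ge_def)

lemma ge_mono: "ge P n x \<Longrightarrow> m \<le> n \<Longrightarrow> ge P m x"
  by (auto simp: ge_def)

lemma v_one: "P \<in> Pts \<Longrightarrow> v P \<one> = 0"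
  using v_const[of P 1] by simp

lemma ge_const [simp]: "P \<in> Pts \<Longrightarrow> ge P 0 (c a)"
  by (cases "a = 0") (auto simp: ge_def v_const)

lemma ge_add:
  assumes P: "P \<in> Pts" and "ge P n x" "ge P n y"
  shows "ge P n (x \<oplus> y)"
proof (cases "x = \<zero> \<or> y = \<zero> \<or> x \<oplus> y = \<zero>")
  case True
  then show ?thesis using assms by (auto simp: ge_def)
next
  case False
  then show ?thesis using assms v_add[of P x y] by (auto simp: ge_def)
qed

lemma ge_mult:
  assumes P: "P \<in> Pts" and "ge P m x" "ge P n y"
  shows "ge P (m + n) (x \<otimes> y)"
  using assms v_mult[of P x y] by (auto simp: ge_def integral_iff)

lemma ge_const_mult: "P \<in> Pts \<Longrightarrow> ge P n x \<Longrightarrow> ge P n (c a \<otimes> x)"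
  using ge_mult[of P 0 "c a" n x] by simp

lemma ge_uminus: "P \<in> Pts \<Longrightarrow> ge P n x \<Longrightarrow> ge P n (\<ominus> x)"
  using ge_const_mult[of P n x "- 1"] by (simp add: c_uminus[of 1] l_minus ge_closed)

lemma ge_minus: "P \<in> Pts \<Longrightarrow> ge P n x \<Longrightarrow> ge P n y \<Longrightarrow> ge P n (x \<ominus> y)"
  unfolding a_minus_def by (intro ge_add ge_uminus)

lemma ge_pow: "P \<in> Pts \<Longrightarrow> ge P n x \<Longrightarrow> ge P (int k * n) (x [^] k)"
proof (induction k)
  case 0
  then show ?case using ge_const[of P 1] by simp
next
  case (Suc k)
  then show ?case using ge_mult[of P "int k * n" "x [^] k" n x] by (simp add: algebra_simps)
qed

lemma ge_ev: "P \<in> Pts \<Longrightarrow> ge P 0 f \<Longrightarrow> ge P 0 (ev f p)"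
proof (induction p)
  case (pCons a p)
  then show ?case
    using ge_add[of P 0 "c a"] ge_mult[of P 0 f 0 "ev f p"] by (simp add: ge_closed)
qed simp

lemma ge_finsum:
  assumes P: "P \<in> Pts" and I: "finite I" "\<And>i. i \<in> I \<Longrightarrow> ge P n (g i)"
  shows "ge P n (\<Oplus>i\<in>I. g i)"
proof -
  have "(\<Oplus>i\<in>I. g i) \<in> {x. ge P n x}"
    by (rule finsum_member) (use I P ge_add ge_closed in auto)
  then show ?thesis by simp
qed

lemma v_pow:
  assumes "P \<in> Pts" "x \<in> carrier K" "x \<noteq> \<zero>"
  shows "v P (x [^] (k::nat)) = int k * v P x"
  by (induction k) (use assms in \<open>auto simp: v_one v_mult nat_pow_nonzero algebra_simps\<close>)

lemma v_inv:
  assumes "P \<in> Pts" "x \<in> carrier K" "x \<noteq> \<zero>"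
  shows "v P (inv x) = - v P x"
  using v_mult[of P x "inv x"] assms inv_nonzero v_one by simp

text \<open>Otherwise \<open>x\<close> would be the negative of \<open>y\<close> and so have an
  order greater than its own.\<close>

lemma v_dominant:
  assumes P: "P \<in> Pts" and x: "x \<in> carrier K" "x \<noteq> \<zero>" and y: "ge P (v P x + 1) y"
  shows "x \<oplus> y \<noteq> \<zero>"
proof
  assume "x \<oplus> y = \<zero>"
  then have "x = \<ominus> y" using x y by (simp add: minus_equality[symmetric] ge_closed)
  then have "ge P (v P x + 1) x" using ge_uminus[OF P y] by simp
  then show False using x by (simp add: ge_def)
qed

lemma residue_ge:
  assumes P: "P \<in> Pts" and x: "ge P 0 x"
  obtains a where "ge P 1 (x \<ominus> c a)"
proof (cases "x = \<zero>")
  case True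
  then show ?thesis using that[of 0] by (simp add: a_minus_def)
next
  case False
  then obtain a where "x \<ominus> c a = \<zero> \<or> 0 < v P (x \<ominus> c a)"
    using v_residue[OF P, of x] x by (auto simp: ge_def)
  then have "ge P 1 (x \<ominus> c a)" using x by (auto simp: ge_def)
  then show ?thesis using that by blast
qed

text \<open>For each other point \<open>Q\<close> of the set, multiply by the \<open>M\<close>-th
  power of a function that is a unit at \<open>P\<close>, vanishes at \<open>Q\<close> and is
  regular on the whole set. Regularity preserves the zeros already obtained.\<close>

lemma approximate_one_point:
  assumes S: "finite S" "S \<subseteq> Pts" and P: "P \<in> S"
  obtains s where "s \<in> carrier K" "s \<noteq> \<zero>" "v P s = 0" "\<And>Q. Q \<in> S - {P} \<Longrightarrow> int M \<le> v Q s"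
proof -
  have "\<exists>s\<in>carrier K. s \<noteq> \<zero> \<and> v P s = 0 \<and> (\<forall>R\<in>S. 0 \<le> v R s) \<and> (\<forall>Q\<in>T. int M \<le> v Q s)"
    if "finite T" "T \<subseteq> S - {P}" for T
    using that
  proof (induction T rule: finite_induct)
    case empty
    show ?case using v_one S P by (intro bexI[of _ \<one>]) auto
  next
    case (insert Q T)
    then obtain s where s: "s \<in> carrier K" "s \<noteq> \<zero>" "v P s = 0" "\<And>R. R \<in> S \<Longrightarrow> 0 \<le> v R s"
      "\<And>Q. Q \<in> T \<Longrightarrow> int M \<le> v Q s" by auto
    obtain h where h: "h \<in> carrier K" "h \<noteq> \<zero>" "\<And>R. R \<in> S \<Longrightarrow> 0 \<le> v R h" "0 < v Q h" "v P h = 0"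
      using separation[OF S P, of Q] insert by auto
    have vs: "v R (s \<otimes> h [^] M) = v R s + int M * v R h" if "R \<in> S" for R
      using that s h S by (subst v_mult) (auto simp: v_pow nat_pow_nonzero)
    have "int M \<le> v R (s \<otimes> h [^] M)" if "R \<in> insert Q T" for R
    proof -
      have R: "R \<in> S" using that insert by auto
      show ?thesis
      proof (cases "R = Q")
        case True
        have "int M * 1 \<le> int M * v Q h" using h by (intro mult_left_mono) auto
        then show ?thesis using True s(4)[OF R] vs[OF R] by simp
      next
        case False
        then have "int M \<le> v R s" using s(5) that by auto
        moreover have "0 \<le> int M * v R h" using h(3)[OF R] by simp
        ultimately show ?thesis using vs[OF R] by linarith
      qed
    qed
    moreover have "0 \<le> v R (s \<otimes> h [^] M)" if "R \<in> S" for R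
      using vs[OF that] s(4)[OF that] h(3)[OF that] by simp
    ultimately show ?case
      using s h vs[OF P] by (intro bexI[of _ "s \<otimes> h [^] M"]) (auto simp: integral_iff nat_pow_nonzero)
  qed
  from this[of "S - {P}"] S show ?thesis using that by auto
qed

text \<open>The products \<open>t ^ j * s\<close>, where \<open>t\<close> is a uniformizer at a zero \<open>P\<close> of \<open>f\<close>, \<open>j < e P\<close> and \<open>s\<close> is
  a unit at \<open>P\<close> that vanishes to high order at the other zeros, are linearly independent over the
  polynomials in \<open>f\<close>.\<close>

lemma zeros_bound:
  assumes f: "f \<in> carrier K" "f \<noteq> \<zero>" and N: "dep f N"
    and S: "finite S" "S \<subseteq> Pts" and e: "\<And>P. P \<in> S \<Longrightarrow> int (e P) \<le> v P f"
  shows "(\<Sum>P\<in>S. e P) < N"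
proof (rule ccontr)
  assume large: "\<not> (\<Sum>P\<in>S. e P) < N"
  have "\<exists>w. \<forall>j. w j \<in> carrier K \<and> w j \<noteq> \<zero> \<and> v P (w j) = int j \<and>
      (\<forall>Q\<in>S - {P}. j < e P \<longrightarrow> int (e Q) \<le> v Q (w j))" if P: "P \<in> S" for P
  proof -
    obtain t where t: "t \<in> carrier K" "t \<noteq> \<zero>" "v P t = 1" using v_uniformizer P S by blast
    \<comment> \<open>\<open>t\<close> may have poles at the other points. A power
      \<open>t ^ j\<close> with \<open>j < e P\<close> costs at most
      \<open>e P * \<bar>v Q t\<bar>\<close> at \<open>Q\<close>, and \<open>M\<close> covers this
      together with the required order \<open>e Q\<close>, for all \<open>Q\<close> at once.\<close>
    define M where "M = (\<Sum>Q\<in>S. e Q + e P * nat \<bar>v Q t\<bar>)"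
    obtain s where s: "s \<in> carrier K" "s \<noteq> \<zero>" "v P s = 0" "\<And>Q. Q \<in> S - {P} \<Longrightarrow> int M \<le> v Q s"
      using approximate_one_point[OF S P, of M] by blast
    have vw: "v Q (t [^] j \<otimes> s) = int j * v Q t + v Q s" if "Q \<in> S" for Q j
      using that S t s by (subst v_mult) (auto simp: v_pow nat_pow_nonzero)
    have "int (e Q) \<le> v Q (t [^] j \<otimes> s)" if Q: "Q \<in> S - {P}" and j: "j < e P" for Q j
    proof -
      have "e Q + e P * nat \<bar>v Q t\<bar> \<le> M" unfolding M_def using Q S by (intro member_le_sum) auto
      then have "int (e Q) + int (e P) * \<bar>v Q t\<bar> \<le> v Q s"
        using s(4)[OF Q] of_nat_mono[where ?'a = int, of "e Q + e P * nat \<bar>v Q t\<bar>" M] by simp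
      moreover have "int j * \<bar>v Q t\<bar> \<le> int (e P) * \<bar>v Q t\<bar>" using j by (intro mult_right_mono) auto
      moreover have "- (int j * \<bar>v Q t\<bar>) \<le> int j * v Q t"
        using mult_left_mono[of "- \<bar>v Q t\<bar>" "v Q t" "int j"] by simp
      ultimately show ?thesis using vw[of Q j] Q by simp
    qed
    then show ?thesis using t s vw[OF P]
      by (intro exI[of _ "\<lambda>j. t [^] j \<otimes> s"]) (auto simp: integral_iff nat_pow_nonzero)
  qed
  then obtain w where w: "\<And>P j. P \<in> S \<Longrightarrow> w P j \<in> carrier K \<and> w P j \<noteq> \<zero> \<and> v P (w P j) = int j \<and>
      (\<forall>Q\<in>S - {P}. j < e P \<longrightarrow> int (e Q) \<le> v Q (w P j))" by metis
  define I where "I = (SIGMA P:S. {..<e P})"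
  define y where "y = (\<lambda>(P, j). w P j)"
  have I: "finite I" "card I = (\<Sum>P\<in>S. e P)" unfolding I_def using S by (auto simp: card_SigmaI)
  have yc: "y \<in> I \<rightarrow> carrier K" using w by (auto simp: I_def y_def)
  have "dep f (card I)" using dep_mono[OF N _ f(1)] large I by simp
  then obtain p where p: "\<exists>i\<in>I. Polynomial.coeff (p i) 0 \<noteq> 0" "(\<Oplus>i\<in>I. ev f (p i) \<otimes> y i) = \<zero>"
    using dep_reduced[OF _ I(1) yc f] by blast
  \<comment> \<open>The reduced relation has some coefficient with a nonzero constant term, at a
    point \<open>P\<close>. The least exponent \<open>j\<close> of this kind at \<open>P\<close>
    gives a contribution of order exactly \<open>j\<close>, and everything else will have order at
    least \<open>j + 1\<close> there.\<close>
  define A where "A P = {j. j < e P \<and> Polynomial.coeff (p (P, j)) 0 \<noteq> 0}" for P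
  obtain P j1 where "P \<in> S" "j1 \<in> A P" using p(1) by (auto simp: I_def A_def)
  note P = \<open>P \<in> S\<close>
  define j where "j = (LEAST i. i \<in> A P)"
  have j: "j \<in> A P" "\<And>i. i \<in> A P \<Longrightarrow> j \<le> i"
    unfolding j_def by (rule LeastI[of "\<lambda>i. i \<in> A P", OF \<open>j1 \<in> A P\<close>], rule Least_le)
  have PX: "P \<in> Pts" using P S by blast
  have iI: "(P, j) \<in> I" using P j by (auto simp: I_def A_def)
  define q where "q i = (THE r. p i = pCons (Polynomial.coeff (p i) 0) r)" for i
  have pq: "p i = pCons (Polynomial.coeff (p i) 0) (q i)" for i
    unfolding q_def by (rule theI2[of _ "THE r. p i = pCons (Polynomial.coeff (p i) 0) r"]) (cases "p i"; auto)+
  have f_ge: "ge P (int (e P)) f" using e[OF P] f by (simp add: ge_def)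
  have f0: "ge P 0 f" using ge_mono[OF f_ge] by simp
  have y0: "ge P 0 (y i)" if i_mem: "i \<in> I" for i
  proof -
    obtain Q k where i: "i = (Q, k)" "Q \<in> S" "k < e Q" using i_mem by (auto simp: I_def)
    show ?thesis
    proof (cases "Q = P")
      case True
      then show ?thesis using w[OF P, of k] by (simp add: y_def i ge_def)
    next
      case False
      then have "int (e P) \<le> v P (w Q k)" using w[OF i(2), of k] P i(3) by auto
      then show ?thesis using w[OF i(2), of k] by (simp add: y_def i ge_def)
    qed
  qed
  have jP: "j < e P" using j by (auto simp: A_def)
  \<comment> \<open>Multiples of \<open>f\<close> have order at least \<open>e P\<close> at
    \<open>P\<close>, and so do the functions attached to the other points. For exponents below
    \<open>j\<close> at \<open>P\<close> the constant term is zero by minimality, and exponents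
    above \<open>j\<close> give sufficient order.\<close>
  have rest: "ge P (int j + 1) (ev f (p i) \<otimes> y i)" if i: "i \<in> I - {(P, j)}" for i
  proof -
    obtain Q k where Qk: "i = (Q, k)" by (cases i)
    have Q: "Q \<in> S" "k < e Q" using i by (auto simp: I_def Qk)
    have yi: "y i \<in> carrier K" using y0 i ge_closed by blast
    have 1: "ge P (int j + 1) (f \<otimes> (ev f (q i) \<otimes> y i))"
    proof -
      have "ge P 0 (ev f (q i) \<otimes> y i)" using ge_mult[OF PX ge_ev[OF PX f0] y0] i by auto
      then show ?thesis using ge_mono[OF ge_mult[OF PX f_ge]] jP by fastforce
    qed
    have 2: "ge P (int j + 1) (c (Polynomial.coeff (p i) 0) \<otimes> y i)"
    proof (cases "Q = P")
      case True
      then have "k \<noteq> j" using i Qk by auto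
      show ?thesis
      proof (cases "Polynomial.coeff (p i) 0 = 0")
        case False
        then have "j \<le> k" using j(2)[of k] True Q by (auto simp: A_def Qk)
        then have "ge P (int j + 1) (y i)" using w[OF Q(1), of k] True \<open>k \<noteq> j\<close>
          by (auto simp: ge_def y_def Qk)
        then show ?thesis by (rule ge_const_mult[OF PX])
      qed (use yi in simp)
    next
      case False
      then have "int (e P) \<le> v P (w Q k)" using w[OF Q(1), of k] P Q(2) by auto
      then have "ge P (int j + 1) (y i)" using jP yi by (auto simp: ge_def y_def Qk)
      then show ?thesis by (rule ge_const_mult[OF PX])
    qed
    have "ev f (p i) = c (Polynomial.coeff (p i) 0) \<oplus> f \<otimes> ev f (q i)"
      by (subst pq) (use f in simp)
    then have "ev f (p i) \<otimes> y i = c (Polynomial.coeff (p i) 0) \<otimes> y i \<oplus> f \<otimes> (ev f (q i) \<otimes> y i)"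
      using f yi by (simp add: l_distr m_assoc)
    then show ?thesis using ge_add[OF PX 2 1] by simp
  qed
  let ?a = "Polynomial.coeff (p (P, j)) 0"
  have yPj: "y (P, j) \<in> carrier K" "y (P, j) \<noteq> \<zero>" "v P (y (P, j)) = int j"
    using w[OF P, of j] by (auto simp: y_def)
  have a: "?a \<noteq> 0" using j by (auto simp: A_def)
  let ?z = "f \<otimes> (ev f (q (P, j)) \<otimes> y (P, j))"
  let ?r = "\<Oplus>i\<in>I - {(P, j)}. ev f (p i) \<otimes> y i"
  have z: "ge P (int j + 1) ?z"
  proof -
    have "ge P 0 (ev f (q (P, j)) \<otimes> y (P, j))" using ge_mult[OF PX ge_ev[OF PX f0] y0[OF iI]] by auto
    then show ?thesis using ge_mono[OF ge_mult[OF PX f_ge]] jP by fastforce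
  qed
  have r: "ge P (int j + 1) ?r" by (rule ge_finsum[OF PX]) (use I rest in auto)
  have "\<zero> = ev f (p (P, j)) \<otimes> y (P, j) \<oplus> ?r"
    unfolding p(2)[symmetric] by (rule finsum_remove[OF I(1) iI]) (use f yc in auto)
  also have "ev f (p (P, j)) = c ?a \<oplus> f \<otimes> ev f (q (P, j))"
    by (subst pq) (use f in simp)
  also have "(c ?a \<oplus> f \<otimes> ev f (q (P, j))) \<otimes> y (P, j) \<oplus> ?r = c ?a \<otimes> y (P, j) \<oplus> (?z \<oplus> ?r)"
    using f yPj r by (simp add: l_distr m_assoc a_assoc ge_closed)
  finally have "c ?a \<otimes> y (P, j) \<oplus> (?z \<oplus> ?r) = \<zero>" ..
  moreover have "v P (c ?a \<otimes> y (P, j)) = int j" using a yPj PX by (simp add: v_mult v_const)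
  ultimately show False
    using v_dominant[OF PX, of "c ?a \<otimes> y (P, j)" "?z \<oplus> ?r"] ge_add[OF PX z r] a yPj
    by (simp add: integral_iff)
qed

text \<open>Counting each zero once, \<open>N\<close> distinct zeros would already contradict the
  strict bound.\<close>

lemma finite_zeros:
  assumes f: "f \<in> carrier K" "f \<notin> range c"
  shows "finite {P \<in> Pts. 0 < v P f}"
proof (rule ccontr)
  assume inf: "infinite {P \<in> Pts. 0 < v P f}"
  obtain N where N: "dep f N" using exists_dep[OF f] by blast
  obtain S where S: "finite S" "card S = N" "S \<subseteq> {P \<in> Pts. 0 < v P f}"
    using infinite_arbitrarily_large[OF inf] by blast
  have "f \<noteq> \<zero>" using f c_zero by (metis rangeI)
  then have "(\<Sum>P\<in>S. 1::nat) < N"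
    by (intro zeros_bound[OF f(1) _ N S(1)]) (use S in auto)
  then show False using S by simp
qed

lemma inv_nonconst:
  assumes f: "f \<in> carrier K" "f \<notin> range c"
  shows "inv f \<in> carrier K" "inv f \<notin> range c" "f \<noteq> \<zero>"
proof -
  show nz: "f \<noteq> \<zero>" using f c_zero by (metis rangeI)
  show "inv f \<in> carrier K" using f nz by simp
  show "inv f \<notin> range c"
  proof
    assume "inv f \<in> range c"
    then obtain a where a: "inv f = c a" by auto
    then have "a \<noteq> 0" using inv_nonzero[OF f(1) nz] by auto
    then have "f = c (inverse a)" using a c_inverse f nz by (metis inv_inv_nz)
    then show False using f by simp
  qed
qed

lemma finite_poles:
  assumes f: "f \<in> carrier K" "f \<notin> range c"
  shows "finite {P \<in> Pts. v P f < 0}"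
  using finite_zeros[OF inv_nonconst(1,2)[OF f]] inv_nonconst(3)[OF f] f
  by (simp add: v_inv cong: conj_cong)

lemma finite_support:
  assumes f: "f \<in> carrier K" "f \<noteq> \<zero>"
  shows "finite {P \<in> Pts. v P f \<noteq> 0}"
proof (cases "f \<in> range c")
  case True
  then obtain a where "f = c a" by auto
  then have "{P \<in> Pts. v P f \<noteq> 0} = {}" using f v_const by auto
  then show ?thesis by (simp only: finite.emptyI)
next
  case False
  have "{P \<in> Pts. v P f \<noteq> 0} = {P \<in> Pts. 0 < v P f} \<union> {P \<in> Pts. v P f < 0}" by auto
  then show ?thesis using finite_zeros[OF f(1) False] finite_poles[OF f(1) False] by simp
qed

text \<open>At a pole \<open>Q\<close> of \<open>y\<close> where \<open>f\<close> is regular with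
  value \<open>a\<close>, the function \<open>f - a\<close> vanishes, so its power with the pole
  order as exponent removes the pole. A polynomial in \<open>f\<close> adds no pole where
  \<open>f\<close> is regular, and only finitely many poles have to be treated.\<close>

lemma clear_poles:
  assumes f: "f \<in> carrier K" "f \<notin> range c" and y: "y \<in> carrier K"
  obtains b where "b \<noteq> 0" "\<And>P. P \<in> Pts \<Longrightarrow> ge P 0 f \<Longrightarrow> ge P 0 (ev f b \<otimes> y)"
proof -
  have step: "\<exists>b. b \<noteq> 0 \<and> (\<forall>Q\<in>T. ge Q (int (M Q)) (ev f b))"
    if "finite T" "T \<subseteq> {P \<in> Pts. ge P 0 f}" for T and M :: "'p \<Rightarrow> nat"
    using that
  proof (induction T rule: finite_induct)
    case empty
    show ?case by (intro exI[of _ 1]) auto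
  next
    case (insert Q T)
    then obtain b where b: "b \<noteq> 0" "\<And>R. R \<in> T \<Longrightarrow> ge R (int (M R)) (ev f b)" by auto
    have Q: "Q \<in> Pts" "ge Q 0 f" using insert by auto
    obtain a where a: "ge Q 1 (f \<ominus> c a)" using residue_ge[OF Q] by blast
    let ?l = "[:- a, 1:] ^ M Q"
    have ev_l: "ev f [:- a, 1:] = f \<ominus> c a"
      using f by (simp add: c_uminus a_minus_def a_comm)
    have "ge R (int (M R)) (ev f (b * ?l))" if R: "R \<in> insert Q T" for R
    proof -
      have RP: "R \<in> Pts" "ge R 0 f" using R insert by auto
      show ?thesis
      proof (cases "R = Q")
        case True
        have "ge Q (int (M Q) * 1) (ev f ?l)"
          unfolding ev_power[OF f(1)] ev_l by (rule ge_pow[OF Q(1) a])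
        then show ?thesis
          using ge_mult[OF Q(1) ge_ev[OF Q, of b]] True f by (fastforce simp: ev_mult)
      next
        case False
        then have "ge R (int (M R)) (ev f b)" using b R by auto
        from ge_mult[OF RP(1) this ge_ev[OF RP]] show ?thesis using f by (simp add: ev_mult)
      qed
    qed
    moreover have "b * ?l \<noteq> 0" using b by (simp del: mult_pCons_left mult_pCons_right)
    ultimately show ?case by blast
  qed
  show ?thesis
  proof (cases "y \<in> range c")
    case True
    then show ?thesis using that[of 1] f by auto
  next
    case False
    then have "finite {P \<in> Pts. v P y < 0 \<and> ge P 0 f}"
      using finite_poles[OF y False] by (rule_tac finite_subset) auto
    then obtain b where b: "b \<noteq> 0"
        "\<And>Q. Q \<in> Pts \<Longrightarrow> v Q y < 0 \<Longrightarrow> ge Q 0 f \<Longrightarrow> ge Q (int (nat (- v Q y))) (ev f b)"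
      using step[of "{P \<in> Pts. v P y < 0 \<and> ge P 0 f}" "\<lambda>Q. nat (- v Q y)"] by auto
    have "ge P 0 (ev f b \<otimes> y)" if P: "P \<in> Pts" "ge P 0 f" for P
    proof (cases "v P y < 0")
      case True
      have "ge P (v P y) y" using y by (simp add: ge_def)
      then show ?thesis using ge_mult[OF P(1) b(2)[OF P(1) True P(2)]] True by fastforce
    next
      case False
      then have "ge P 0 y" using y by (simp add: ge_def)
      then show ?thesis using ge_mult[OF P(1) ge_ev[OF P]] by fastforce
    qed
    then show ?thesis using that b by blast
  qed
qed

text \<open>The inequality \<open>l(D) \<le> deg D + 1\<close> for an effective divisor \<open>D\<close> supported on \<open>Z\<close>.\<close>

lemma riemann_roch_space_dependent:
  fixes I :: "'i set"
  assumes const: "\<And>x. x \<in> carrier K \<Longrightarrow> (\<And>P. P \<in> Pts \<Longrightarrow> ge P 0 x) \<Longrightarrow> x \<in> range c"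
    and Z: "finite Z" "Z \<subseteq> Pts" and I: "finite I" "(\<Sum>Q\<in>Z. D Q) + 2 \<le> card I"
    and x: "\<And>i P. i \<in> I \<Longrightarrow> P \<in> Z \<Longrightarrow> ge P (- int (D P)) (x i)"
      "\<And>i P. i \<in> I \<Longrightarrow> P \<in> Pts - Z \<Longrightarrow> ge P 0 (x i)" "\<And>i. i \<in> I \<Longrightarrow> x i \<in> carrier K"
  shows "\<exists>a. (\<exists>i\<in>I. a i \<noteq> 0) \<and> (\<Oplus>i\<in>I. c (a i) \<otimes> x i) = \<zero>"
  using I x
proof (induction "\<Sum>Q\<in>Z. D Q" arbitrary: D I x)
  case 0
  have "D P = 0" if "P \<in> Z" for P using 0(1) Z that by simp
  then have D0: "ge P 0 (x i)" if "i \<in> I" "P \<in> Pts" for i P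
    using 0(4)[OF that(1), of P] 0(5)[OF that(1), of P] that(2) by (cases "P \<in> Z") auto
  have "x i \<in> range c" if "i \<in> I" for i
    by (rule const[OF 0(6)[OF that] D0[OF that]])
  then have "\<forall>i. \<exists>b. i \<in> I \<longrightarrow> x i = c b" by blast
  from choice[OF this] obtain b where b: "\<And>i. i \<in> I \<Longrightarrow> x i = c (b i)" by blast
  obtain i where i: "i \<in> I" using 0 by fastforce
  have "I \<noteq> {i}" using 0(3) by auto
  then obtain j where j: "j \<in> I - {i}" using i by blast
  \<comment> \<open>Any two constants are dependent: if the one at \<open>i\<close> is zero it gives
    a relation by itself, otherwise cross multiplication of the two does.\<close>
  define a where "a k = (if b i = 0 then (if k = i then 1 else 0)
     else if k = i then b j else if k = j then - b i else 0)" for k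
  have "(\<Oplus>k\<in>I. c (a k) \<otimes> x k) = c (\<Sum>k\<in>I. a k * b k)"
    unfolding c_sum[OF 0(2)] by (rule finsum_cong') (auto simp: b c_mult)
  also have "(\<Sum>k\<in>I. a k * b k) = 0"
  proof -
    have "(\<Sum>k\<in>I. a k * b k) = (\<Sum>k\<in>{i, j}. a k * b k)"
      by (rule sum.mono_neutral_right) (use 0(2) i j in \<open>auto simp: a_def\<close>)
    then show ?thesis using i j by (auto simp: a_def)
  qed
  finally have "(\<Oplus>k\<in>I. c (a k) \<otimes> x k) = \<zero>" by simp
  moreover have "\<exists>k\<in>I. a k \<noteq> 0"
    using i j by (cases "b i = 0") (auto simp: a_def intro: bexI[of _ i] bexI[of _ j])
  ultimately show ?case by blast
next
  case (Suc n)
  obtain P where P: "P \<in> Z" "D P \<noteq> 0" using Suc(2) by (metis sum.neutral Zero_not_Suc)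
  have PX: "P \<in> Pts" using P Z by blast
  \<comment> \<open>The induction lowers the permitted pole order at one point \<open>P\<close>.
    Multiplication by \<open>s\<close> makes the functions regular at \<open>P\<close>, and the
    residue \<open>r i\<close> is then the coefficient of the pole of order
    \<open>D P\<close>.\<close>
  define D' where "D' = D(P := D P - 1)"
  have D'_sum: "n = (\<Sum>Q\<in>Z. D' Q)"
  proof -
    have "(\<Sum>Q\<in>Z. D' Q) = D' P + (\<Sum>Q\<in>Z - {P}. D' Q)" by (rule sum.remove) (use Z P in auto)
    also have "(\<Sum>Q\<in>Z - {P}. D' Q) = (\<Sum>Q\<in>Z - {P}. D Q)" by (rule sum.cong) (auto simp: D'_def)
    finally show ?thesis using sum.remove[OF Z(1) P(1), of D] Suc(2) P by (simp add: D'_def)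
  qed
  obtain t where t: "t \<in> carrier K" "t \<noteq> \<zero>" "v P t = 1" using v_uniformizer PX by blast
  define s where "s = t [^] D P"
  have s: "s \<in> carrier K" "s \<noteq> \<zero>" "v P s = int (D P)"
    using t PX by (auto simp: s_def v_pow nat_pow_nonzero)
  have s_ge: "ge P (int (D P)) s" using s by (simp add: ge_def)
  have "\<exists>r. ge P 1 (s \<otimes> x i \<ominus> c r)" if i: "i \<in> I" for i
  proof -
    have "ge P 0 (s \<otimes> x i)" using ge_mult[OF PX s_ge Suc(5)[OF i P(1)]] by simp
    then show ?thesis using residue_ge[OF PX] by blast
  qed
  then obtain r where r: "\<And>i. i \<in> I \<Longrightarrow> ge P 1 (s \<otimes> x i \<ominus> c (r i))" by metis
  have improve: "ge P (- int (D' P)) z" if z: "ge P 1 (s \<otimes> z)" "z \<in> carrier K" for z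
  proof (cases "z = \<zero>")
    case False
    then have "1 \<le> int (D P) + v P z" using z s PX by (simp add: ge_def v_mult integral_iff)
    then show ?thesis using z P by (simp add: ge_def D'_def)
  qed simp
  show ?case
  proof (cases "\<forall>i\<in>I. r i = 0")
    \<comment> \<open>No function has a pole of the full order, so the same family satisfies the
      smaller bound.\<close>
    case True
    show ?thesis
    proof (rule Suc(1)[OF D'_sum])
      show "ge Q (- int (D' Q)) (x i)" if "i \<in> I" "Q \<in> Z" for i Q
      proof (cases "Q = P")
        case True
        then show ?thesis using improve[of "x i"] r[OF that(1)] Suc(7)[OF that(1)] \<open>\<forall>i\<in>I. r i = 0\<close> that s
          by (simp add: a_minus_def)
      qed (use Suc(5) that in \<open>auto simp: D'_def\<close>)
      show "(\<Sum>Q\<in>Z. D' Q) + 2 \<le> card I" using Suc(4) Suc(2) D'_sum by linarith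
    qed (use Suc in auto)
  next
    case False
    then obtain l where l: "l \<in> I" "r l \<noteq> 0" by blast
    \<comment> \<open>Subtracting multiples of \<open>x l\<close> removes the pole of full order
      from all the others. One function is lost and the degree drops by one, so the surplus of two
      over the degree persists.\<close>
    define q where "q i = r i / r l" for i
    define x' where "x' i = x i \<ominus> c (q i) \<otimes> x l" for i
    have xc: "x i \<in> carrier K" if "i \<in> I" for i using Suc(7) that .
    have "\<exists>b. (\<exists>i\<in>I - {l}. b i \<noteq> 0) \<and> (\<Oplus>i\<in>I - {l}. c (b i) \<otimes> x' i) = \<zero>"
    proof (rule Suc(1)[OF D'_sum])
      show "(\<Sum>Q\<in>Z. D' Q) + 2 \<le> card (I - {l})" using Suc(2,3,4) D'_sum l by simp
      show "x' i \<in> carrier K" if "i \<in> I - {l}" for i using that l xc by (auto simp: x'_def)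
      show "ge Q 0 (x' i)" if "i \<in> I - {l}" "Q \<in> Pts - Z" for i Q
        unfolding x'_def using that Suc(6) l by (intro ge_minus ge_const_mult) auto
      show "ge Q (- int (D' Q)) (x' i)" if "i \<in> I - {l}" "Q \<in> Z" for i Q
      proof (cases "Q = P")
        case True
        have i: "i \<in> I" using that by auto
        have "c (q i) \<otimes> c (r l) = c (r i)" using l by (simp add: q_def flip: c_mult)
        then have "c (q i) \<otimes> (s \<otimes> x l \<ominus> c (r l)) = c (q i) \<otimes> (s \<otimes> x l) \<ominus> c (r i)"
          using xc[OF l(1)] s by (simp add: a_minus_def r_distr r_minus)
        moreover have "s \<otimes> x' i = s \<otimes> x i \<ominus> c (q i) \<otimes> (s \<otimes> x l)"
          using xc[OF i] xc[OF l(1)] s by (simp add: x'_def a_minus_def r_distr r_minus m_lcomm)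
        ultimately have "s \<otimes> x' i = (s \<otimes> x i \<ominus> c (r i)) \<ominus> c (q i) \<otimes> (s \<otimes> x l \<ominus> c (r l))"
          using xc[OF i] xc[OF l(1)] s by (simp add: minus_minus_cancel)
        also have "ge P 1 \<dots>" by (intro ge_minus ge_const_mult r PX i l)
        finally show ?thesis using improve[of "x' i"] True xc i l by (auto simp: x'_def)
      next
        case False
        then show ?thesis unfolding x'_def using that Suc(5) l Z
          by (intro ge_minus ge_const_mult) (auto simp: D'_def)
      qed
    qed (use Suc in auto)
    then obtain b where b: "\<exists>i\<in>I - {l}. b i \<noteq> 0" "(\<Oplus>i\<in>I - {l}. c (b i) \<otimes> x' i) = \<zero>" by blast
    \<comment> \<open>Expanding the relation among the modified functions moves all subtracted
      multiples into the coefficient of \<open>x l\<close>.\<close>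
    define a where "a i = (if i = l then - (\<Sum>i\<in>I - {l}. b i * q i) else b i)" for i
    have fin: "finite (I - {l})" using Suc by simp
    have xc': "x i \<in> carrier K" if "i \<in> I - {l}" for i using that xc by auto
    have "(\<Oplus>i\<in>I - {l}. c (b i) \<otimes> x' i)
        = (\<Oplus>i\<in>I - {l}. c (b i) \<otimes> x i \<oplus> c (- (b i * q i)) \<otimes> x l)"
      by (rule finsum_cong') (use xc' xc[OF l(1)] in
        \<open>auto simp: x'_def a_minus_def r_distr c_uminus c_mult r_minus l_minus m_assoc\<close>)
    also have "\<dots> = (\<Oplus>i\<in>I - {l}. c (b i) \<otimes> x i) \<oplus> (\<Oplus>i\<in>I - {l}. c (- (b i * q i)) \<otimes> x l)"
      by (rule finsum_addf) (use xc' xc[OF l(1)] in auto)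
    also have "(\<Oplus>i\<in>I - {l}. c (- (b i * q i)) \<otimes> x l) = (\<Oplus>i\<in>I - {l}. c (- (b i * q i))) \<otimes> x l"
      by (rule finsum_ldistr[symmetric]) (use fin xc[OF l(1)] in auto)
    also have "(\<Oplus>i\<in>I - {l}. c (- (b i * q i))) = c (a l)"
      by (simp add: a_def sum_negf flip: c_sum[OF fin])
    also have "(\<Oplus>i\<in>I - {l}. c (b i) \<otimes> x i) = (\<Oplus>i\<in>I - {l}. c (a i) \<otimes> x i)"
      by (rule finsum_cong') (use xc' in \<open>auto simp: a_def\<close>)
    finally have "(\<Oplus>i\<in>I - {l}. c (a i) \<otimes> x i) \<oplus> c (a l) \<otimes> x l = \<zero>" using b by simp
    moreover have "(\<Oplus>i\<in>I. c (a i) \<otimes> x i) = c (a l) \<otimes> x l \<oplus> (\<Oplus>i\<in>I - {l}. c (a i) \<otimes> x i)"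
      by (rule finsum_remove) (use Suc l xc in auto)
    moreover have "(\<Oplus>i\<in>I - {l}. c (a i) \<otimes> x i) \<in> carrier K"
      by (rule finsum_closed) (use xc' in auto)
    ultimately have "(\<Oplus>i\<in>I. c (a i) \<otimes> x i) = \<zero>"
      using xc[OF l(1)] by (simp add: a_comm)
    moreover have "\<exists>i\<in>I. a i \<noteq> 0" using b(1) by (auto simp: a_def)
    ultimately show ?thesis by blast
  qed
qed

text \<open>If \<open>y 0, \<dots>, y (n - 1)\<close> is a maximal family independent over the polynomials in \<open>f\<close>,
  with poles only at poles of \<open>f\<close>, then the functions \<open>f ^ j * y i\<close> with \<open>j \<le> m\<close> are
  independent over the constants and lie in a space of dimension at most \<open>m * d + const\<close>, where
  \<open>d\<close> is the number of poles of \<open>f\<close>. Letting \<open>m\<close> grow gives \<open>n \<le> d\<close>.\<close>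

lemma zeros_le_poles:
  assumes const: "\<And>x. x \<in> carrier K \<Longrightarrow> (\<And>P. P \<in> Pts \<Longrightarrow> ge P 0 x) \<Longrightarrow> x \<in> range c"
    and f: "f \<in> carrier K" "f \<notin> range c"
  shows "(\<Sum>P | P \<in> Pts \<and> 0 < v P f. nat (v P f)) \<le> (\<Sum>P | P \<in> Pts \<and> v P f < 0. nat (- v P f))"
proof -
  have f0: "f \<noteq> \<zero>" using inv_nonconst[OF f] by blast
  \<comment> \<open>Minimality of \<open>N\<close> provides \<open>N - 1\<close> elements
    independent over the polynomials in \<open>f\<close>, while the strict bound limits the number
    of zeros to \<open>N - 1\<close>.\<close>
  define N where "N = (LEAST N. dep f N)"
  have N: "dep f N" unfolding N_def using exists_dep[OF f] by (metis LeastI)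
  have "\<not> dep f 0" by (auto simp: dep_def)
  then have "N \<noteq> 0" using N by metis
  then obtain n where n: "N = Suc n" by (cases N) auto
  have "\<not> dep f n" using not_less_Least[of n "dep f"] n N_def by simp
  then obtain y where y: "y \<in> {..<n} \<rightarrow> carrier K"
      "\<And>p. (\<Oplus>i\<in>{..<n}. ev f (p i) \<otimes> y i) = \<zero> \<Longrightarrow> \<forall>i<n. p i = 0"
    unfolding dep_def by blast
  have "\<forall>i. \<exists>b. i < n \<longrightarrow> b \<noteq> 0 \<and> (\<forall>P\<in>Pts. ge P 0 f \<longrightarrow> ge P 0 (ev f b \<otimes> y i))"
    using clear_poles[OF f] y(1) by (metis PiE lessThan_iff)
  from choice[OF this] obtain b where b: "\<And>i. i < n \<Longrightarrow> b i \<noteq> 0"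
      "\<And>i P. i < n \<Longrightarrow> P \<in> Pts \<Longrightarrow> ge P 0 f \<Longrightarrow> ge P 0 (ev f (b i) \<otimes> y i)" by blast
  define z where "z i = ev f (b i) \<otimes> y i" for i
  have zc: "z i \<in> carrier K" if "i < n" for i using that y f by (auto simp: z_def Pi_iff)
  have z_indep: "\<forall>i<n. p i = 0" if "(\<Oplus>i\<in>{..<n}. ev f (p i) \<otimes> z i) = \<zero>" for p
  proof -
    have "(\<Oplus>i\<in>{..<n}. ev f (p i * b i) \<otimes> y i) = (\<Oplus>i\<in>{..<n}. ev f (p i) \<otimes> z i)"
      by (rule finsum_cong') (use y f in \<open>auto simp: z_def ev_mult m_assoc Pi_iff\<close>)
    then have "\<forall>i<n. p i * b i = 0" using y(2)[of "\<lambda>i. p i * b i"] that by simp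
    then show ?thesis using b(1) by auto
  qed
  define Z where "Z = {P \<in> Pts. v P f < 0}"
  have Z: "finite Z" "Z \<subseteq> Pts" using finite_poles[OF f] by (auto simp: Z_def)
  define d where "d P = nat (- v P f)" for P
  define E where "E P = (\<Sum>i<n. nat (- v P (z i)))" for P
  have zE: "ge P (- int (E P)) (z i)" if "i < n" for i P
  proof -
    have "nat (- v P (z i)) \<le> E P" unfolding E_def using that by (intro member_le_sum) auto
    then show ?thesis using zc[OF that] by (auto simp: ge_def)
  qed
  \<comment> \<open>There are \<open>n * Suc m\<close> functions \<open>f ^ j * z i\<close>. Were
    their number to exceed the degree of the bounding divisor by two or more, they would satisfy a
    constant relation, which regroups into a polynomial relation among the independent
    \<open>z i\<close>.\<close>
  have key: "n * Suc m \<le> m * (\<Sum>P\<in>Z. d P) + (\<Sum>P\<in>Z. E P) + 1" for m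
  proof (rule ccontr)
    assume contra: "\<not> ?thesis"
    define I where "I = {..<n} \<times> {..m}"
    define D where "D P = m * d P + E P" for P
    define x where "x = (\<lambda>(i, j). f [^] (j::nat) \<otimes> z i)"
    have "\<exists>a. (\<exists>i\<in>I. a i \<noteq> 0) \<and> (\<Oplus>i\<in>I. c (a i) \<otimes> x i) = \<zero>"
    proof (rule riemann_roch_space_dependent[OF const Z])
      show "finite I" by (simp add: I_def)
      have "(\<Sum>P\<in>Z. D P) = m * (\<Sum>P\<in>Z. d P) + (\<Sum>P\<in>Z. E P)"
        by (simp add: D_def sum.distrib sum_distrib_left)
      then show "(\<Sum>Q\<in>Z. D Q) + 2 \<le> card I" using contra by (simp add: I_def)
      show "x i \<in> carrier K" if "i \<in> I" for i using that zc f by (auto simp: I_def x_def)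
      show "ge P 0 (x i)" if iP: "i \<in> I" "P \<in> Pts - Z" for i P
      proof -
        obtain k j where i: "i = (k, j)" "k < n" "j \<le> m" using iP by (auto simp: I_def)
        have "ge P 0 f" using that f by (auto simp: ge_def Z_def)
        moreover have "ge P 0 (z k)" unfolding z_def by (rule b(2)) (use i that calculation in auto)
        ultimately show ?thesis
          using ge_mult[of P "int j * 0" "f [^] j" 0 "z k"] ge_pow[of P 0 f j] that by (simp add: x_def i)
      qed
      show "ge P (- int (D P)) (x i)" if iP: "i \<in> I" "P \<in> Z" for i P
      proof -
        obtain k j where i: "i = (k, j)" "k < n" "j \<le> m" using iP by (auto simp: I_def)
        have P: "P \<in> Pts" "v P f < 0" using that by (auto simp: Z_def)
        have "ge P (v P f) f" using f by (simp add: ge_def)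
        then have "ge P (int j * v P f + - int (E P)) (x i)"
          unfolding x_def i prod.case by (intro ge_mult ge_pow P zE i)
        moreover have "int m * v P f \<le> int j * v P f"
          using P i by (intro mult_right_mono_neg) auto
        ultimately show ?thesis using P by (elim ge_mono) (simp add: D_def d_def)
      qed
    qed
    then obtain a where a: "\<exists>i\<in>I. a i \<noteq> 0" "(\<Oplus>i\<in>I. c (a i) \<otimes> x i) = \<zero>" by blast
    define p where "p i = (\<Sum>j\<le>m. Polynomial.monom (a (i, j)) j)" for i
    have "(\<Oplus>i\<in>{..<n}. ev f (p i) \<otimes> z i) = (\<Oplus>i\<in>{..<n}. \<Oplus>j\<in>{..m}. c (a (i, j)) \<otimes> x (i, j))"
    proof (rule finsum_cong')
      show "ev f (p i) \<otimes> z i = (\<Oplus>j\<in>{..m}. c (a (i, j)) \<otimes> x (i, j))" if "i \<in> {..<n}" for i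
      proof -
        have "ev f (p i) \<otimes> z i = (\<Oplus>j\<in>{..m}. c (a (i, j)) \<otimes> f [^] j) \<otimes> z i"
          using f by (simp add: p_def ev_sum ev_monom)
        also have "\<dots> = (\<Oplus>j\<in>{..m}. c (a (i, j)) \<otimes> f [^] j \<otimes> z i)"
          by (rule finsum_ldistr) (use f zc that in auto)
        also have "\<dots> = (\<Oplus>j\<in>{..m}. c (a (i, j)) \<otimes> x (i, j))"
          by (rule finsum_cong') (use f zc that in \<open>auto simp: x_def m_assoc\<close>)
        finally show ?thesis .
      qed
    qed (use f zc in \<open>auto simp: x_def intro!: finsum_closed\<close>)
    also have "\<dots> = (\<Oplus>i\<in>I. c (a i) \<otimes> x i)"
      unfolding I_def by (rule finsum_Times[symmetric]) (use f zc in \<open>auto simp: x_def\<close>)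
    finally have "\<forall>i<n. p i = 0" using a(2) z_indep by simp
    moreover have "Polynomial.coeff (p i) j = a (i, j)" if "j \<le> m" for i j
      using that by (simp add: p_def coeff_sum)
    moreover obtain i j where "i < n" "j \<le> m" "a (i, j) \<noteq> 0" using a(1) unfolding I_def by auto
    ultimately show False by (metis Polynomial.coeff_0)
  qed
  have "n \<le> (\<Sum>P\<in>Z. d P)"
  proof (rule ccontr)
    assume "\<not> n \<le> (\<Sum>P\<in>Z. d P)"
    then have "Suc (\<Sum>P\<in>Z. d P) \<le> n" by simp
    \<comment> \<open>Write \<open>d\<close> for the sum of the pole orders of \<open>f\<close> and
      \<open>e\<close> for the sum of the \<open>E P\<close>. If \<open>n\<close> exceeded
      \<open>d\<close>, the inequality would give \<open>d + m \<le> e\<close>, which fails for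
      \<open>m = e + 1\<close>.\<close>
    define m where "m = (\<Sum>P\<in>Z. E P) + 1"
    have "Suc (\<Sum>P\<in>Z. d P) * Suc m \<le> n * Suc m"
      using \<open>Suc (\<Sum>P\<in>Z. d P) \<le> n\<close> by (rule mult_le_mono1)
    also have "\<dots> \<le> m * (\<Sum>P\<in>Z. d P) + (\<Sum>P\<in>Z. E P) + 1" by (rule key)
    finally show False by (simp add: m_def algebra_simps)
  qed
  moreover have "(\<Sum>P | P \<in> Pts \<and> 0 < v P f. nat (v P f)) < N"
    by (rule zeros_bound[OF f(1) f0 N]) (use finite_zeros[OF f] in auto)
  ultimately show ?thesis using n by (simp add: Z_def d_def)
qed

theorem degree_zero:
  assumes const: "\<And>x. x \<in> carrier K \<Longrightarrow> (\<And>P. P \<in> Pts \<Longrightarrow> ge P 0 x) \<Longrightarrow> x \<in> range c"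
    and f: "f \<in> carrier K" "f \<noteq> \<zero>"
  shows "(\<Sum>P | P \<in> Pts \<and> v P f \<noteq> 0. v P f) = 0"
proof (cases "f \<in> range c")
  case True
  then obtain a where "f = c a" by auto
  then have "{P \<in> Pts. v P f \<noteq> 0} = {}" using f v_const by auto
  then show ?thesis by (simp only: sum.empty)
next
  case False
  let ?Z = "{P \<in> Pts. 0 < v P f}" and ?W = "{P \<in> Pts. v P f < 0}"
  note i = inv_nonconst[OF f(1) False]
  have "(\<Sum>P\<in>?W. nat (- v P f)) \<le> (\<Sum>P\<in>?Z. nat (v P f))"
  proof -
    have vi: "v P (inv f) = - v P f" if "P \<in> Pts" for P using that f by (rule v_inv)
    have "(\<Sum>P | P \<in> Pts \<and> 0 < v P (inv f). nat (v P (inv f))) = (\<Sum>P\<in>?W. nat (- v P f))"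
      by (rule sum.cong) (auto simp: vi)
    moreover have "(\<Sum>P | P \<in> Pts \<and> v P (inv f) < 0. nat (- v P (inv f))) = (\<Sum>P\<in>?Z. nat (v P f))"
      by (rule sum.cong) (auto simp: vi)
    ultimately show ?thesis using zeros_le_poles[OF const i(1,2)] by simp
  qed
  moreover have "(\<Sum>P\<in>?Z. nat (v P f)) \<le> (\<Sum>P\<in>?W. nat (- v P f))"
    using zeros_le_poles[OF const f(1) False] by simp
  ultimately have "int (\<Sum>P\<in>?W. nat (- v P f)) = int (\<Sum>P\<in>?Z. nat (v P f))" by simp
  then have eq: "(\<Sum>P\<in>?W. - v P f) = (\<Sum>P\<in>?Z. v P f)" by simp
  have "{P \<in> Pts. v P f \<noteq> 0} = ?Z \<union> ?W" by auto
  then have "(\<Sum>P | P \<in> Pts \<and> v P f \<noteq> 0. v P f) = (\<Sum>P\<in>?Z \<union> ?W. v P f)" by simp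
  also have "\<dots> = (\<Sum>P\<in>?Z. v P f) + (\<Sum>P\<in>?W. v P f)"
    by (rule sum.union_disjoint[OF finite_zeros[OF f(1) False] finite_poles[OF f(1) False]]) auto
  also have "\<dots> = 0" using eq by (simp add: sum_negf)
  finally show ?thesis .
qed

end

section \<open>The function field of a projective variety\<close>

definition monomial_at :: "('n::finite \<Rightarrow>\<^sub>0 nat) \<Rightarrow> ('n \<Rightarrow> 'a::comm_ring_1) \<Rightarrow> 'a" where
  "monomial_at m x = (\<Prod>i\<in>UNIV. x i ^ Poly_Mapping.lookup m i)"

lemma monomial_at_add: "monomial_at (m + m') x = monomial_at m x * monomial_at m' x"
  by (simp add: monomial_at_def lookup_add power_add prod.distrib)

lemma monomial_at_0 [simp]: "monomial_at 0 x = 1"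
  by (simp add: monomial_at_def)

lemma monomial_at_scale:
  "monomial_at m (\<lambda>i. t * x i) = t ^ (\<Sum>i\<in>UNIV. Poly_Mapping.lookup m i) * monomial_at m x"
  by (simp add: monomial_at_def power_mult_distrib prod.distrib power_sum)

lemma poly_at_superset:
  assumes "finite A" "Poly_Mapping.keys F \<subseteq> A"
  shows "poly_at F x = (\<Sum>m\<in>A. Poly_Mapping.lookup F m * monomial_at m x)"
  unfolding poly_at_def monomial_at_def
  by (rule sum.mono_neutral_left) (use assms in \<open>auto simp: in_keys_iff\<close>)

lemma poly_at_add: "poly_at (F + G) x = poly_at F x + poly_at G x"
proof -
  let ?A = "Poly_Mapping.keys F \<union> Poly_Mapping.keys G"
  have "poly_at H x = (\<Sum>m\<in>?A. Poly_Mapping.lookup H m * monomial_at m x)"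
    if "H \<in> {F, G, F + G}" for H
    by (rule poly_at_superset) (use that keys_add[of F G] in auto)
  then show ?thesis by (simp add: lookup_add algebra_simps sum.distrib)
qed

lemma poly_at_0 [simp]: "poly_at 0 x = 0"
  by (simp add: poly_at_def)

lemma poly_at_single [simp]: "poly_at (Poly_Mapping.single m a) x = a * monomial_at m x"
  by (simp add: poly_at_def monomial_at_def)

lemma poly_at_1 [simp]: "poly_at 1 x = 1"
  using poly_at_single[of 0 1 x] by simp

lemma poly_at_uminus: "poly_at (- F) x = - poly_at F x"
  using poly_at_add[of "- F" F x] by (simp add: eq_neg_iff_add_eq_0)

lemma poly_at_minus: "poly_at (F - G) x = poly_at F x - poly_at G x"
  using poly_at_add[of F "- G" x] by (simp add: poly_at_uminus)

lemma update_eq_add: "a \<notin> Poly_Mapping.keys F \<Longrightarrow> Poly_Mapping.update a b F = F + Poly_Mapping.single a b"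
  by (rule poly_mapping_eqI) (auto simp: lookup_update lookup_add lookup_single in_keys_iff when_def)

lemma mpoly_induct [case_names zero single add]:
  assumes "P 0" "\<And>m a. P (Poly_Mapping.single m a)" "\<And>F G. P F \<Longrightarrow> P G \<Longrightarrow> P (F + G)"
  shows "P F"
  by (induction F rule: update_induct) (auto simp: update_eq_add assms)

lemma poly_at_mult: "poly_at (F * G) x = poly_at F x * poly_at G x"
proof (induction F rule: mpoly_induct)
  case (single m a)
  show ?case
    by (induction G rule: mpoly_induct)
      (simp_all add: mult_single monomial_at_add distrib_left poly_at_add algebra_simps)
qed (simp_all add: distrib_right poly_at_add)

lemma poly_at_power: "poly_at (F ^ n) x = poly_at F x ^ n"
  by (induction n) (simp_all add: poly_at_mult)

lemma homogeneous_0 [simp]: "homogeneous d 0"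
  by (simp add: homogeneous_def)

lemma homogeneous_single:
  "homogeneous d (Poly_Mapping.single m a) \<longleftrightarrow> a = 0 \<or> (\<Sum>i\<in>UNIV. Poly_Mapping.lookup m i) = d"
  by (auto simp: homogeneous_def)

lemma homogeneous_1 [simp]: "homogeneous 0 1"
  by (simp add: homogeneous_def)

lemma homogeneous_const [simp]: "homogeneous 0 (Poly_Mapping.single 0 a)"
  by (simp add: homogeneous_single)

lemma homogeneous_add: "homogeneous d F \<Longrightarrow> homogeneous d G \<Longrightarrow> homogeneous d (F + G)"
  using keys_add[of F G] by (auto simp: homogeneous_def)

lemma homogeneous_uminus: "homogeneous d F \<Longrightarrow> homogeneous d (- F)"
  by (simp add: homogeneous_def in_keys_iff)

lemma homogeneous_minus:
  fixes F G :: "('n::finite, 'a::comm_ring_1) mpoly"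
  shows "homogeneous d F \<Longrightarrow> homogeneous d G \<Longrightarrow> homogeneous d (F - G)"
  using homogeneous_add[of d F "- G"] homogeneous_uminus[of d G] by simp

lemma homogeneous_mult: "homogeneous d F \<Longrightarrow> homogeneous e G \<Longrightarrow> homogeneous (d + e) (F * G)"
  using keys_mult[of F G] by (fastforce simp: homogeneous_def lookup_add sum.distrib)

lemma homogeneous_power: "homogeneous d F \<Longrightarrow> homogeneous (n * d) (F ^ n)"
  by (induction n) (simp_all add: homogeneous_mult)

lemma homogeneous_poly_at_scale:
  "homogeneous d F \<Longrightarrow> poly_at F (\<lambda>i. t * x i) = t ^ d * poly_at F x"
  by (simp add: poly_at_superset[OF finite_keys subset_refl] monomial_at_scale homogeneous_def
      sum_distrib_left algebra_simps)

section \<open>Coordinate forms and representatives of points\<close>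

definition coordinate :: "'n::finite \<Rightarrow> ('n, 'a::comm_ring_1) mpoly" where
  "coordinate i = Poly_Mapping.single (Poly_Mapping.single i 1) 1"

lemma poly_at_coordinate [simp]: "poly_at (coordinate i) x = x i"
proof -
  have "monomial_at (Poly_Mapping.single i 1) x = (\<Prod>j\<in>UNIV. if j = i then x i else 1)"
    unfolding monomial_at_def by (rule prod.cong) (auto simp: lookup_single)
  then show ?thesis by (simp add: coordinate_def)
qed

lemma homogeneous_coordinate [simp]: "homogeneous 1 (coordinate i)"
proof -
  have "(\<Sum>j\<in>UNIV. Poly_Mapping.lookup (Poly_Mapping.single i (1::nat)) j) = 1"
    by (simp add: lookup_single when_def)
  then show ?thesis by (simp add: coordinate_def homogeneous_single)
qed

text \<open>A form vanishes at all coordinate vectors of a point or at none, so one chosen vector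
  turns vanishing into a single equation.\<close>

definition rep :: "('n, 'a) point \<Rightarrow> 'n \<Rightarrow> 'a" where
  "rep P = (SOME x. x \<in> P)"

lemma projective_space_member:
  fixes P :: "('n, 'a::field) point"
  assumes "P \<in> projective_space" "x \<in> P"
  shows "P = {\<lambda>i. c * x i | c. c \<noteq> 0}" "\<exists>i. x i \<noteq> 0"
proof -
  obtain y where y: "P = {\<lambda>i. c * y i | c. c \<noteq> 0}" "\<exists>i. y i \<noteq> 0"
    using assms(1) by (auto simp: projective_space_def)
  then obtain a where a: "x = (\<lambda>i. a * y i)" "a \<noteq> 0" using assms(2) by auto
  show "\<exists>i. x i \<noteq> 0" using a y by auto
  show "P = {\<lambda>i. c * x i | c. c \<noteq> 0}"
  proof safe
    fix z assume "z \<in> P"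
    then obtain b where "z = (\<lambda>i. b * y i)" "b \<noteq> 0" using y by auto
    then have "z = (\<lambda>i. b / a * x i) \<and> b / a \<noteq> 0" using a by auto
    then show "\<exists>c. z = (\<lambda>i. c * x i) \<and> c \<noteq> 0" by blast
  next
    fix b :: 'a assume "b \<noteq> 0"
    then have "(\<lambda>i. b * x i) = (\<lambda>i. (b * a) * y i) \<and> b * a \<noteq> 0" using a by (simp add: algebra_simps)
    then show "(\<lambda>i. b * x i) \<in> P" using y by blast
  qed
qed

lemma rep_mem:
  fixes P :: "('n, 'a::field) point"
  shows "P \<in> projective_space \<Longrightarrow> rep P \<in> P"
proof -
  assume "P \<in> projective_space"
  then obtain y where y: "P = {\<lambda>i. c * y i | c. c \<noteq> 0}" by (auto simp: projective_space_def)
  have "y \<in> P" unfolding y by (rule CollectI, rule exI[of _ 1]) simp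
  then show "rep P \<in> P" unfolding rep_def by (rule someI[of "\<lambda>x. x \<in> P"])
qed

lemma vanishes_at_iff:
  assumes "P \<in> projective_space" "x \<in> P" "homogeneous d F"
  shows "vanishes_at F P \<longleftrightarrow> poly_at F x = 0"
proof
  assume "poly_at F x = 0"
  then show "vanishes_at F P"
    unfolding vanishes_at_def projective_space_member(1)[OF assms(1,2)]
    using homogeneous_poly_at_scale[OF assms(3)] by auto
qed (use assms in \<open>auto simp: vanishes_at_def\<close>)

lemma vanishes_at_rep:
  "P \<in> projective_space \<Longrightarrow> homogeneous d F \<Longrightarrow> vanishes_at F P \<longleftrightarrow> poly_at F (rep P) = 0"
  by (rule vanishes_at_iff[OF _ rep_mem])

section \<open>Forms modulo vanishing on an irreducible set, and their fractions\<close>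

locale projective_variety =
  fixes C :: "('n::finite, 'a::field) point set"
  assumes irreducible: "irreducible_set C"
begin

abbreviation K :: "('n, 'a) ratfun ring" where "K \<equiv> function_field C"

definition frac :: "('n, 'a) mpoly \<Rightarrow> ('n, 'a) mpoly \<Rightarrow> ('n, 'a) ratfun" where
  "frac F G = fraction_rel C `` {(F, G)}"

lemma C_projective: "P \<in> C \<Longrightarrow> P \<in> projective_space"
  using irreducible by (auto simp: irreducible_set_def algebraic_set_def zero_locus_def)

lemma vanishes_on_iff: "homogeneous d F \<Longrightarrow> vanishes_on F C \<longleftrightarrow> (\<forall>P\<in>C. poly_at F (rep P) = 0)"
  using vanishes_at_rep[OF C_projective] unfolding vanishes_on_def by blast

text \<open>The zero sets of the two factors are closed and cover \<open>C\<close>, so by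
  irreducibility one of them is all of \<open>C\<close>. This is the primality of the homogeneous
  ideal, on which cancellation of denominators rests.\<close>

lemma vanishes_on_mult:
  assumes F: "homogeneous d F" and G: "homogeneous e G" and FG: "vanishes_on (F * G) C"
  shows "vanishes_on F C \<or> vanishes_on G C"
proof -
  obtain S where S: "\<forall>F\<in>S. \<exists>d. homogeneous d F" "C = zero_locus S"
    using irreducible by (auto simp: irreducible_set_def algebraic_set_def)
  define Z where "Z H = zero_locus (insert H S)" for H
  have Z: "Z H = {P \<in> C. vanishes_at H P}" for H
    using S by (auto simp: Z_def zero_locus_def)
  have "algebraic_set (Z F)" "algebraic_set (Z G)"
    using F G S unfolding algebraic_set_def Z_def by (metis insert_iff)+
  moreover have "C = Z F \<union> Z G"
  proof -
    have "vanishes_at F P \<or> vanishes_at G P" if P: "P \<in> C" for P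
    proof -
      have "poly_at F (rep P) * poly_at G (rep P) = 0"
        using FG P rep_mem[OF C_projective[OF P]]
        by (auto simp: vanishes_on_def vanishes_at_def poly_at_mult)
      then show ?thesis using vanishes_at_rep C_projective[OF P] F G by auto
    qed
    then show ?thesis by (auto simp: Z)
  qed
  ultimately have "C = Z F \<or> C = Z G" using irreducible unfolding irreducible_set_def by blast
  then show ?thesis unfolding Z vanishes_on_def by blast
qed

lemma nonempty: "C \<noteq> {}"
  using irreducible by (simp add: irreducible_set_def)

lemma not_vanishes_on_1 [simp]: "\<not> vanishes_on 1 C"
  using nonempty vanishes_on_iff[OF homogeneous_1] by auto

lemma vanishes_on_0 [simp]: "vanishes_on 0 C"
  by (simp add: vanishes_on_def vanishes_at_def)

lemma not_vanishes_on_mult: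
  "homogeneous d F \<Longrightarrow> homogeneous e G \<Longrightarrow> \<not> vanishes_on F C \<Longrightarrow> \<not> vanishes_on G C \<Longrightarrow>
    \<not> vanishes_on (F * G) C"
  using vanishes_on_mult by blast

lemma fractionsI: "homogeneous d F \<Longrightarrow> homogeneous d G \<Longrightarrow> \<not> vanishes_on G C \<Longrightarrow> (F, G) \<in> fractions C"
  by (auto simp: fractions_def)

lemma fractionsE:
  assumes "(F, G) \<in> fractions C"
  obtains d where "homogeneous d F" "homogeneous d G" "\<not> vanishes_on G C"
  using assms by (auto simp: fractions_def)

lemma vanishes_on_add: "vanishes_on F C \<Longrightarrow> vanishes_on G C \<Longrightarrow> vanishes_on (F + G) C"
  by (auto simp: vanishes_on_def vanishes_at_def poly_at_add)

lemma vanishes_on_minus: "vanishes_on F C \<Longrightarrow> vanishes_on G C \<Longrightarrow> vanishes_on (F - G) C"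
  by (auto simp: vanishes_on_def vanishes_at_def poly_at_minus)

lemma vanishes_on_times: "vanishes_on F C \<Longrightarrow> vanishes_on (F * G) C"
  by (auto simp: vanishes_on_def vanishes_at_def poly_at_mult)

lemma equiv_fraction_rel: "equiv (fractions C) (fraction_rel C)"
proof (rule equivI)
  show "refl_on (fractions C) (fraction_rel C)"
    by (auto simp: refl_on_def fraction_rel_def)
  show "fraction_rel C \<subseteq> fractions C \<times> fractions C" by (auto simp: fraction_rel_def)
  show "sym (fraction_rel C)"
  proof (rule symI, clarsimp simp: fraction_rel_def)
    fix F G F' G' assume "vanishes_on (F * G' - F' * G) C"
    from vanishes_on_minus[OF vanishes_on_0 this] show "vanishes_on (F' * G - F * G') C" by simp
  qed
  show "trans (fraction_rel C)"
  proof (rule transI, clarsimp simp: fraction_rel_def)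
    fix F G F' G' F'' G''
    assume f: "(F, G) \<in> fractions C" "(F', G') \<in> fractions C" "(F'', G'') \<in> fractions C"
      and v: "vanishes_on (F * G' - F' * G) C" "vanishes_on (F' * G'' - F'' * G') C"
    obtain d where d: "homogeneous d F" "homogeneous d G" using f(1) by (rule fractionsE)
    obtain d' where d': "homogeneous d' F'" "homogeneous d' G'" "\<not> vanishes_on G' C" using f(2) by (rule fractionsE)
    obtain d'' where d'': "homogeneous d'' F''" "homogeneous d'' G''" using f(3) by (rule fractionsE)
    \<comment> \<open>The combination equals the wanted cross difference times \<open>G'\<close>,
      and \<open>G'\<close> cancels because it does not vanish on \<open>C\<close>. Equal degrees
      make the difference a form.\<close>
    have "vanishes_on ((F * G' - F' * G) * G'' + (F' * G'' - F'' * G') * G) C"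
      using v by (intro vanishes_on_add vanishes_on_times)
    also have "(F * G' - F' * G) * G'' + (F' * G'' - F'' * G') * G = (F * G'' - F'' * G) * G'"
      by (simp add: algebra_simps)
    finally have v': "vanishes_on ((F * G'' - F'' * G) * G') C" .
    have "homogeneous (d + d'') (F * G'')" "homogeneous (d + d'') (F'' * G)"
      using d d'' homogeneous_mult[of d F d'' G''] homogeneous_mult[of d'' F'' d G] by (simp_all add: add.commute)
    from vanishes_on_mult[OF homogeneous_minus[OF this] d'(2) v'] d'(3)
    show "vanishes_on (F * G'' - F'' * G) C" by blast
  qed
qed

lemma frac_eq_iff:
  assumes "(F, G) \<in> fractions C" "(F', G') \<in> fractions C"
  shows "frac F G = frac F' G' \<longleftrightarrow> vanishes_on (F * G' - F' * G) C"
  unfolding frac_def using eq_equiv_class_iff[OF equiv_fraction_rel assms] assms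
  by (simp add: fraction_rel_def)

lemma frac_eqI:
  "(F, G) \<in> fractions C \<Longrightarrow> (F', G') \<in> fractions C \<Longrightarrow> F * G' = F' * G \<Longrightarrow> frac F G = frac F' G'"
  by (simp add: frac_eq_iff)

lemma frac_carrier: "(F, G) \<in> fractions C \<Longrightarrow> frac F G \<in> carrier K"
  by (simp add: function_field_def frac_def quotientI)

lemma mem_frac: "(F, G) \<in> fractions C \<Longrightarrow> (F, G) \<in> frac F G"
  unfolding frac_def using equiv_class_self[OF equiv_fraction_rel] by blast

lemma carrier_frac:
  assumes "f \<in> carrier K" "(F, G) \<in> f"
  shows "(F, G) \<in> fractions C" "f = frac F G"
proof -
  have f: "f \<in> fractions C // fraction_rel C" using assms by (simp add: function_field_def)
  show "(F, G) \<in> fractions C" using in_quotient_imp_subset[OF equiv_fraction_rel f] assms by auto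
  obtain p where p: "f = fraction_rel C `` {p}" using f by (rule quotientE)
  then have "(p, (F, G)) \<in> fraction_rel C" using assms(2) by simp
  then show "f = frac F G" unfolding frac_def p by (rule equiv_class_eq[OF equiv_fraction_rel])
qed

lemma carrierE:
  assumes "f \<in> carrier K"
  obtains F G where "(F, G) \<in> fractions C" "f = frac F G"
proof -
  have "f \<in> fractions C // fraction_rel C" using assms by (simp add: function_field_def)
  then show ?thesis using that unfolding frac_def quotient_def by auto
qed

text \<open>The operations on classes are unions over all representatives. Once the resulting class
  is independent of the representatives, a union over nonempty sets collapses to it.\<close>

lemma UN_UN_const:
  assumes "s \<in> S" "t \<in> T" "\<And>a b a' b'. (a, b) \<in> S \<Longrightarrow> (a', b') \<in> T \<Longrightarrow> h a b a' b' = Y"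
  shows "(\<Union>(a, b)\<in>S. \<Union>(a', b')\<in>T. h a b a' b') = Y"
proof -
  have "(\<Union>(a', b')\<in>T. h a b a' b') = Y" if "(a, b) \<in> S" for a b
    using assms(2,3) that by (force simp: split_beta)
  then show ?thesis using assms(1) by (force simp: split_beta)
qed

lemma fractions_mult:
  assumes "(F, G) \<in> fractions C" "(F', G') \<in> fractions C"
  shows "(F * F', G * G') \<in> fractions C" "(F * G' + F' * G, G * G') \<in> fractions C"
proof -
  obtain d where d: "homogeneous d F" "homogeneous d G" "\<not> vanishes_on G C" using assms(1) by (rule fractionsE)
  obtain e where e: "homogeneous e F'" "homogeneous e G'" "\<not> vanishes_on G' C" using assms(2) by (rule fractionsE)
  note h = homogeneous_mult[OF d(1) e(1)] homogeneous_mult[OF d(2) e(2)] homogeneous_mult[OF d(1) e(2)]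
    homogeneous_mult[OF e(1) d(2)] not_vanishes_on_mult[OF d(2) e(2) d(3) e(3)]
  show "(F * F', G * G') \<in> fractions C" using h by (intro fractionsI)
  show "(F * G' + F' * G, G * G') \<in> fractions C"
    using h by (intro fractionsI[of "d + e"] homogeneous_add) (auto simp: add.commute)
qed

lemma frac_mult:
  assumes "(F, G) \<in> fractions C" "(F', G') \<in> fractions C"
  shows "frac F G \<otimes>\<^bsub>K\<^esub> frac F' G' = frac (F * F') (G * G')"
proof -
  have "frac F G \<otimes>\<^bsub>K\<^esub> frac F' G' = (\<Union>(A, B)\<in>frac F G. \<Union>(A', B')\<in>frac F' G'. frac (A * A') (B * B'))"
    by (simp add: function_field_def frac_def)
  also have "\<dots> = frac (F * F') (G * G')"
  proof -
    have "frac (A * A') (B * B') = frac (F * F') (G * G')" if "(A, B) \<in> frac F G" "(A', B') \<in> frac F' G'" for A B A' B'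
    proof -
      note a = carrier_frac[OF frac_carrier[OF assms(1)] that(1)] carrier_frac[OF frac_carrier[OF assms(2)] that(2)]
      have v: "vanishes_on (A * G - F * B) C" "vanishes_on (A' * G' - F' * B') C"
        using a assms by (metis frac_eq_iff)+
      have "vanishes_on ((A * G - F * B) * (A' * G') + (A' * G' - F' * B') * (F * B)) C"
        using v by (intro vanishes_on_add vanishes_on_times)
      also have "(A * G - F * B) * (A' * G') + (A' * G' - F' * B') * (F * B)
          = (A * A') * (G * G') - (F * F') * (B * B')" by (simp add: algebra_simps)
      finally show ?thesis using a assms by (subst frac_eq_iff) (auto intro: fractions_mult)
    qed
    then show ?thesis by (rule UN_UN_const[OF mem_frac[OF assms(1)] mem_frac[OF assms(2)]])
  qed
  finally show ?thesis .
qed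

lemma frac_add:
  assumes "(F, G) \<in> fractions C" "(F', G') \<in> fractions C"
  shows "frac F G \<oplus>\<^bsub>K\<^esub> frac F' G' = frac (F * G' + F' * G) (G * G')"
proof -
  have "frac F G \<oplus>\<^bsub>K\<^esub> frac F' G' = (\<Union>(A, B)\<in>frac F G. \<Union>(A', B')\<in>frac F' G'. frac (A * B' + A' * B) (B * B'))"
    by (simp add: function_field_def frac_def)
  also have "\<dots> = frac (F * G' + F' * G) (G * G')"
  proof -
    have "frac (A * B' + A' * B) (B * B') = frac (F * G' + F' * G) (G * G')"
      if "(A, B) \<in> frac F G" "(A', B') \<in> frac F' G'" for A B A' B'
    proof -
      note a = carrier_frac[OF frac_carrier[OF assms(1)] that(1)] carrier_frac[OF frac_carrier[OF assms(2)] that(2)]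
      have v: "vanishes_on (A * G - F * B) C" "vanishes_on (A' * G' - F' * B') C"
        using a assms by (metis frac_eq_iff)+
      have "vanishes_on ((A * G - F * B) * (B' * G') + (A' * G' - F' * B') * (B * G)) C"
        using v by (intro vanishes_on_add vanishes_on_times)
      also have "(A * G - F * B) * (B' * G') + (A' * G' - F' * B') * (B * G)
          = (A * B' + A' * B) * (G * G') - (F * G' + F' * G) * (B * B')" by (simp add: algebra_simps)
      finally show ?thesis using a assms by (subst frac_eq_iff) (auto intro: fractions_mult)
    qed
    then show ?thesis by (rule UN_UN_const[OF mem_frac[OF assms(1)] mem_frac[OF assms(2)]])
  qed
  finally show ?thesis .
qed

lemma const_fraction: "(Poly_Mapping.single 0 a, 1) \<in> fractions C"
  by (rule fractionsI[of 0]) auto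

lemma const_fun_eq: "const_fun C a = frac (Poly_Mapping.single 0 a) 1"
  by (simp add: const_fun_def frac_def)

lemma zero_eq: "\<zero>\<^bsub>K\<^esub> = frac 0 1" and one_eq: "\<one>\<^bsub>K\<^esub> = frac 1 1"
  by (simp_all add: function_field_def frac_def)

lemma frac_eq_zero_iff:
  assumes "(F, G) \<in> fractions C"
  shows "frac F G = \<zero>\<^bsub>K\<^esub> \<longleftrightarrow> vanishes_on F C"
  unfolding zero_eq using assms const_fraction[of 0] by (subst frac_eq_iff) auto

lemma fractions_inverse: "(F, G) \<in> fractions C \<Longrightarrow> \<not> vanishes_on F C \<Longrightarrow> (G, F) \<in> fractions C"
  by (auto simp: fractions_def)

lemma field_function_field: "field K"
proof -
  have one: "(1, 1) \<in> fractions C" and zero: "(0, 1) \<in> fractions C"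
    using const_fraction[of 1] const_fraction[of 0] by auto
  note [simp] = one zero frac_carrier frac_mult frac_add fractions_mult
  have fe: "frac F G = frac F' G'" if "(F, G) \<in> fractions C" "(F', G') \<in> fractions C" "F * G' = F' * G" for F G F' G'
    using frac_eqI that by blast
  have "cring K"
  proof (rule cringI)
    show "abelian_group K"
    proof (rule abelian_groupI)
      show "x \<oplus>\<^bsub>K\<^esub> y \<in> carrier K" if "x \<in> carrier K" "y \<in> carrier K" for x y
        using that by (elim carrierE) simp
      show "\<zero>\<^bsub>K\<^esub> \<in> carrier K" by (simp add: zero_eq)
      show "x \<oplus>\<^bsub>K\<^esub> y \<oplus>\<^bsub>K\<^esub> z = x \<oplus>\<^bsub>K\<^esub> (y \<oplus>\<^bsub>K\<^esub> z)"
        if "x \<in> carrier K" "y \<in> carrier K" "z \<in> carrier K" for x y z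
        using that
        by (elim carrierE, simp, intro fe) ((simp; fail | simp add: algebra_simps)+)
      show "x \<oplus>\<^bsub>K\<^esub> y = y \<oplus>\<^bsub>K\<^esub> x" if "x \<in> carrier K" "y \<in> carrier K" for x y
        using that
        by (elim carrierE, simp, intro fe) ((simp; fail | simp add: algebra_simps)+)
      show "\<zero>\<^bsub>K\<^esub> \<oplus>\<^bsub>K\<^esub> x = x" if "x \<in> carrier K" for x
        using that by (elim carrierE) (simp add: zero_eq)
      show "\<exists>y\<in>carrier K. y \<oplus>\<^bsub>K\<^esub> x = \<zero>\<^bsub>K\<^esub>" if x: "x \<in> carrier K" for x
      proof -
        obtain F G where FG: "(F, G) \<in> fractions C" "x = frac F G" using carrierE[OF x] by blast
        then have n: "(- F, G) \<in> fractions C" by (auto simp: fractions_def intro: homogeneous_uminus)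
        then have "frac (- F) G \<oplus>\<^bsub>K\<^esub> x = frac (- F * G + F * G) (G * G)" using FG by simp
        also have "\<dots> = \<zero>\<^bsub>K\<^esub>" unfolding zero_eq by (rule fe) (use fractions_mult(2)[OF n FG(1)] in auto)
        finally show ?thesis using n frac_carrier by blast
      qed
    qed
    show "comm_monoid K"
    proof (rule comm_monoidI)
      show "x \<otimes>\<^bsub>K\<^esub> y \<in> carrier K" if "x \<in> carrier K" "y \<in> carrier K" for x y
        using that by (elim carrierE) simp
      show "\<one>\<^bsub>K\<^esub> \<in> carrier K" by (simp add: one_eq)
      show "x \<otimes>\<^bsub>K\<^esub> y \<otimes>\<^bsub>K\<^esub> z = x \<otimes>\<^bsub>K\<^esub> (y \<otimes>\<^bsub>K\<^esub> z)"
        if "x \<in> carrier K" "y \<in> carrier K" "z \<in> carrier K" for x y z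
        using that
        by (elim carrierE, simp, intro fe) ((simp; fail | simp add: algebra_simps)+)
      show "x \<otimes>\<^bsub>K\<^esub> y = y \<otimes>\<^bsub>K\<^esub> x" if "x \<in> carrier K" "y \<in> carrier K" for x y
        using that
        by (elim carrierE, simp, intro fe) ((simp; fail | simp add: algebra_simps)+)
      show "\<one>\<^bsub>K\<^esub> \<otimes>\<^bsub>K\<^esub> x = x" if "x \<in> carrier K" for x
        using that by (elim carrierE) (simp add: one_eq)
    qed
    show "(x \<oplus>\<^bsub>K\<^esub> y) \<otimes>\<^bsub>K\<^esub> z = x \<otimes>\<^bsub>K\<^esub> z \<oplus>\<^bsub>K\<^esub> y \<otimes>\<^bsub>K\<^esub> z"
      if "x \<in> carrier K" "y \<in> carrier K" "z \<in> carrier K" for x y z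
      using that
        by (elim carrierE, simp, intro fe) ((simp; fail | simp add: algebra_simps)+)
  qed
  then interpret cring K .
  show ?thesis
  proof (rule cring_fieldI)
    show "Units K = carrier K - {\<zero>\<^bsub>K\<^esub>}"
    proof (intro equalityI subsetI)
      fix x assume x: "x \<in> Units K"
      have "\<one>\<^bsub>K\<^esub> \<noteq> \<zero>\<^bsub>K\<^esub>" unfolding one_eq using frac_eq_zero_iff[OF one] by simp
      then show "x \<in> carrier K - {\<zero>\<^bsub>K\<^esub>}" using x by (metis DiffI Units_closed Units_r_inv_ex l_null singletonD)
    next
      fix x assume x: "x \<in> carrier K - {\<zero>\<^bsub>K\<^esub>}"
      then obtain F G where FG: "(F, G) \<in> fractions C" "x = frac F G" using carrierE[of x] by blast
      then have GF: "(G, F) \<in> fractions C" using x frac_eq_zero_iff[OF FG(1)] fractions_inverse by auto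
      have "frac (F * G) (G * F) = frac 1 1"
        by (rule fe[OF fractions_mult(1)[OF FG(1) GF] one]) (simp add: mult.commute)
      then have "x \<otimes>\<^bsub>K\<^esub> frac G F = \<one>\<^bsub>K\<^esub>" unfolding FG(2) one_eq frac_mult[OF FG(1) GF] .
      moreover have "frac G F \<in> carrier K" by (rule frac_carrier[OF GF])
      moreover have "frac G F \<otimes>\<^bsub>K\<^esub> x = x \<otimes>\<^bsub>K\<^esub> frac G F" using x calculation(2) by (intro m_comm) auto
      ultimately show "x \<in> Units K" using x unfolding Units_def by (intro CollectI conjI bexI[of _ "frac G F"]) simp_all
    qed
  qed
qed

end

section \<open>Points of a nonsingular curve\<close>

declare homogeneous_coordinate [unfolded One_nat_def, simp]

text \<open>Over a finite field, the product of all \<open>X - a\<close> plus one is a nonconstant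
  polynomial without a root.\<close>

lemma infinite_alg_closed: "infinite (UNIV :: 'a::alg_closed_field set)"
proof
  assume fin: "finite (UNIV :: 'a set)"
  define p :: "'a poly" where "p = (\<Prod>a\<in>UNIV. [:- a, 1:]) + 1"
  have deg: "Polynomial.degree (\<Prod>a\<in>(UNIV :: 'a set). [:- a, 1:]) = card (UNIV :: 'a set)"
    by (subst degree_prod_eq_sum_degree) auto
  have "Polynomial.degree p = card (UNIV :: 'a set)"
    unfolding p_def using deg fin by (subst degree_add_eq_left) (auto simp: finite_UNIV_card_ge_0)
  then obtain x where "poly p x = 0"
    using alg_closed_imp_poly_has_root[of p] finite_UNIV_card_ge_0[OF fin] by auto
  moreover have "poly p x = 1"
    using fin by (simp add: p_def poly_prod prod_zero_iff)
  ultimately show False by simp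
qed

text \<open>The form takes the powers \<open>s ^ e i\<close> as coefficients. A point excludes only
  the roots \<open>s\<close> of one polynomial, which is nonzero because distinct coordinates carry
  distinct exponents; finitely many points leave some \<open>s\<close>.\<close>

lemma finite_set_avoided_by_linear_form:
  fixes S :: "('n::finite, 'a::alg_closed_field) point set"
  assumes S: "finite S" "S \<subseteq> projective_space"
  obtains L where "homogeneous 1 L" "\<And>P. P \<in> S \<Longrightarrow> \<not> vanishes_at L P"
proof -
  obtain e :: "'n \<Rightarrow> nat" where e: "inj e"
    using finite_imp_inj_to_nat_seg[OF finite_class.finite_UNIV] by blast
  define q :: "('n, 'a) point \<Rightarrow> 'a poly" where "q P = (\<Sum>i\<in>UNIV. Polynomial.monom (rep P i) (e i))" for P
  have q: "q P \<noteq> 0" if PS: "P \<in> S" for P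
  proof -
    obtain j where j: "rep P j \<noteq> 0"
      using projective_space_member(2)[OF _ rep_mem, of P] S PS by blast
    have "Polynomial.coeff (q P) (e j) = (\<Sum>i\<in>UNIV. if i = j then rep P i else 0)"
      unfolding q_def coeff_sum using e by (intro sum.cong) (auto simp: inj_eq)
    then show ?thesis using j by auto
  qed
  have "finite (\<Union>P\<in>S. {s. poly (q P) s = 0})" using S q by (auto intro: poly_roots_finite)
  then obtain s where s: "s \<notin> (\<Union>P\<in>S. {s. poly (q P) s = 0})"
    using ex_new_if_finite[OF infinite_alg_closed] by blast
  define L where "L = (\<Sum>i\<in>UNIV. Poly_Mapping.single 0 (s ^ e i) * coordinate i :: ('n, 'a) mpoly)"
  have hom: "homogeneous 1 (\<Sum>i\<in>A. Poly_Mapping.single 0 (s ^ e i) * coordinate i :: ('n, 'a) mpoly)" for A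
    by (induction A rule: infinite_finite_induct)
      (use homogeneous_mult[OF homogeneous_const homogeneous_coordinate] in \<open>auto intro: homogeneous_add\<close>)
  have at: "poly_at (\<Sum>i\<in>A. Poly_Mapping.single 0 (s ^ e i) * coordinate i :: ('n, 'a) mpoly) x
      = (\<Sum>i\<in>A. s ^ e i * x i)" for A x
    by (induction A rule: infinite_finite_induct) (auto simp: poly_at_add poly_at_mult)
  show ?thesis
  proof (rule that)
    show "homogeneous 1 L" unfolding L_def by (rule hom)
    show "\<not> vanishes_at L P" if "P \<in> S" for P
    proof -
      have "poly_at L (rep P) = poly (q P) s"
        unfolding L_def at q_def by (simp add: poly_sum poly_monom mult.commute)
      then have "poly_at L (rep P) \<noteq> 0" using s that by auto
      then show ?thesis using that S vanishes_at_rep[OF _ hom[of UNIV]] unfolding L_def by blast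
    qed
  qed
qed

text \<open>Coordinate vectors that are not proportional have a nonzero minor of size two. The form
  is this minor with the coordinates of \<open>P\<close> replaced by variables.\<close>

lemma linear_form_separating_points:
  fixes P Q :: "('n::finite, 'a::field) point"
  assumes P: "P \<in> projective_space" and Q: "Q \<in> projective_space" and ne: "P \<noteq> Q"
  obtains L where "homogeneous 1 L" "vanishes_at L Q" "\<not> vanishes_at L P"
proof -
  define x y where "x = rep P" and "y = rep Q"
  have x: "P = {\<lambda>i. c * x i | c. c \<noteq> 0}" "\<exists>i. x i \<noteq> 0"
    using projective_space_member[OF P rep_mem[OF P]] by (auto simp: x_def)
  have y: "Q = {\<lambda>i. c * y i | c. c \<noteq> 0}" "\<exists>i. y i \<noteq> 0"
    using projective_space_member[OF Q rep_mem[OF Q]] by (auto simp: y_def)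
  have "\<exists>i j. x i * y j \<noteq> x j * y i"
  proof (rule ccontr)
    assume "\<not> ?thesis"
    then have eq: "x i * y j = x j * y i" for i j by blast
    obtain j where j: "y j \<noteq> 0" using y(2) by blast
    have xy: "x i = (x j / y j) * y i" for i using eq[of i j] j by (simp add: field_simps)
    then have "x j \<noteq> 0" using x(2) by force
    then have a1: "x j / y j \<noteq> 0" using j by simp
    have a2: "x = (\<lambda>i. (x j / y j) * y i)" by (rule ext) (rule xy)
    have "x \<in> Q"
      unfolding y(1) by (rule CollectI, rule exI[of _ "x j / y j"], rule conjI, rule a2, rule a1)
    then have "Q = P" using projective_space_member(1)[OF Q, of x] x(1) by simp
    then show False using ne by simp
  qed
  then obtain i j where ij: "x i * y j \<noteq> x j * y i" by blast
  define L :: "('n, 'a) mpoly" where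
    "L = Poly_Mapping.single 0 (y j) * coordinate i - Poly_Mapping.single 0 (y i) * coordinate j"
  have L: "homogeneous 1 L" unfolding L_def
    using homogeneous_mult[OF homogeneous_const homogeneous_coordinate]
    by (intro homogeneous_minus) auto
  have at: "poly_at L z = y j * z i - y i * z j" for z
    by (simp add: L_def poly_at_minus poly_at_mult)
  show ?thesis
  proof (rule that[OF L])
    show "vanishes_at L Q" using vanishes_at_rep[OF Q L] by (simp add: at flip: y_def)
    show "\<not> vanishes_at L P" using vanishes_at_rep[OF P L] ij by (simp add: at flip: x_def) (simp add: mult.commute)
  qed
qed

section \<open>Constants and generators of the function field\<close>

context projective_variety
begin

lemma one_fraction: "(1, 1) \<in> fractions C"
  using const_fraction[of 1] by auto

sublocale const_field K "const_fun C"
proof -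
  interpret field K by (rule field_function_field)
  show "const_field K (const_fun C)"
  proof
    show "const_fun C a \<in> carrier K" for a
      unfolding const_fun_eq by (rule frac_carrier[OF const_fraction])
    show "const_fun C (a + b) = const_fun C a \<oplus>\<^bsub>K\<^esub> const_fun C b" for a b
      by (simp add: const_fun_eq frac_add const_fraction single_add)
    show "const_fun C (a * b) = const_fun C a \<otimes>\<^bsub>K\<^esub> const_fun C b" for a b
      by (simp add: const_fun_eq frac_mult const_fraction mult_single)
    show "const_fun C 1 = \<one>\<^bsub>K\<^esub>"
      by (simp add: const_fun_eq one_eq)
  qed
qed

lemma frac_inverse:
  assumes "(F, G) \<in> fractions C" "\<not> vanishes_on F C"
  shows "inv\<^bsub>K\<^esub> (frac F G) = frac G F"
proof (rule comm_inv_char)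
  note GF = fractions_inverse[OF assms]
  show "frac F G \<otimes>\<^bsub>K\<^esub> frac G F = \<one>\<^bsub>K\<^esub>"
    unfolding frac_mult[OF assms(1) GF] one_eq
    by (rule frac_eqI[OF fractions_mult(1)[OF assms(1) GF] one_fraction]) (simp add: mult.commute)
qed (use assms fractions_inverse frac_carrier in auto)

lemma exists_nonvanishing_coordinate:
  assumes "P \<in> projective_space"
  obtains i where "\<not> vanishes_at (coordinate i) P"
proof -
  obtain i where "rep P i \<noteq> 0" using projective_space_member(2)[OF assms rep_mem[OF assms]] by blast
  then show ?thesis using that vanishes_at_rep[OF assms homogeneous_coordinate[of i]] by simp
qed

lemma not_vanishes_onI: "P \<in> C \<Longrightarrow> \<not> vanishes_at F P \<Longrightarrow> \<not> vanishes_on F C"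
  by (auto simp: vanishes_on_def)

lemma not_vanishes_on_power:
  "homogeneous d F \<Longrightarrow> \<not> vanishes_on F C \<Longrightarrow> \<not> vanishes_on (F ^ n) C"
  by (induction n) (auto dest: vanishes_on_mult[OF _ homogeneous_power])

text \<open>Dividing numerator and denominator by the same power of a coordinate writes a function
  as a quotient of polynomials in the coordinate ratios; these are treated monomial by
  monomial.\<close>

lemma generated_by_coordinates:
  assumes k: "\<not> vanishes_on (coordinate k) C" and S: "subfield S K" "range (const_fun C) \<subseteq> S"
    and coords: "\<And>i. frac (coordinate i) (coordinate k) \<in> S"
  shows "carrier K \<subseteq> S"
proof
  let ?L = "coordinate k :: ('n, 'a) mpoly"
  note sub = subringE[OF subfieldE(1)[OF S(1)]]
  have fr: "(F, ?L ^ d) \<in> fractions C" if "homogeneous d F" for F d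
    using that homogeneous_power[OF homogeneous_coordinate[of k], of d] not_vanishes_on_power[OF _ k, of 1 d]
    by (intro fractionsI[of d]) auto
  have single: "frac (Poly_Mapping.single m a) (?L ^ d) \<in> S"
    if "(\<Sum>i\<in>UNIV. Poly_Mapping.lookup m i) = d" for m a d
    using that
  proof (induction d arbitrary: m)
    case 0
    then have "m = 0" by (intro poly_mapping_eqI) simp
    then show ?case using S(2) by (auto simp flip: const_fun_eq)
  next
    case (Suc d)
    then obtain i where i: "Poly_Mapping.lookup m i > 0"
      by (metis bot_nat_0.not_eq_extremum sum.neutral nat.distinct(1))
    define m' where "m' = m - Poly_Mapping.single i 1"
    have m: "m = m' + Poly_Mapping.single i 1"
      unfolding m'_def using i by (intro poly_mapping_eqI) (auto simp: lookup_add lookup_minus lookup_single when_def)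
    have deg: "(\<Sum>j\<in>UNIV. Poly_Mapping.lookup m' j) = d"
      using Suc(2) by (simp add: m lookup_add sum.distrib lookup_single when_def)
    have 1: "(Poly_Mapping.single m' a, ?L ^ d) \<in> fractions C" using deg by (intro fr) (simp add: homogeneous_single)
    have 2: "(coordinate i, ?L) \<in> fractions C" using fr[OF homogeneous_coordinate] by simp
    have "Poly_Mapping.single m' a * coordinate i = Poly_Mapping.single m a"
      by (simp add: m coordinate_def mult_single)
    then have "frac (Poly_Mapping.single m a) (?L ^ Suc d)
        = frac (Poly_Mapping.single m' a) (?L ^ d) \<otimes>\<^bsub>K\<^esub> frac (coordinate i) ?L"
      by (simp add: frac_mult[OF 1 2] mult.commute)
    then show ?case using sub(6)[OF Suc(1)[OF deg] coords] by simp
  qed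
  have form: "frac F (?L ^ d) \<in> S" if "homogeneous d F" for F d
    using that
  proof (induction F rule: update_induct)
    case const
    have "frac 0 (?L ^ d) = \<zero>\<^bsub>K\<^esub>" using frac_eq_zero_iff[OF fr[OF homogeneous_0]] by simp
    then show ?case using sub(2) by simp
  next
    case (update F m a)
    have "Poly_Mapping.keys (Poly_Mapping.update m a F) = insert m (Poly_Mapping.keys F)"
      using update by (simp add: keys_update)
    then have h: "homogeneous d F" "(\<Sum>i\<in>UNIV. Poly_Mapping.lookup m i) = d"
      using update(4) by (auto simp: homogeneous_def)
    have 1: "(F, ?L ^ d) \<in> fractions C" "(Poly_Mapping.single m a, ?L ^ d) \<in> fractions C"
      using h by (auto intro!: fr simp: homogeneous_single)
    have 2: "(F + Poly_Mapping.single m a, ?L ^ d) \<in> fractions C"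
      using h by (auto intro!: fr homogeneous_add simp: homogeneous_single)
    have "frac F (?L ^ d) \<oplus>\<^bsub>K\<^esub> frac (Poly_Mapping.single m a) (?L ^ d) = frac (F + Poly_Mapping.single m a) (?L ^ d)"
      unfolding frac_add[OF 1] by (rule frac_eqI[OF fractions_mult(2)[OF 1] 2]) (simp add: algebra_simps)
    then show ?case
      using sub(7)[OF update(3)[OF h(1)] single[OF h(2), of a]] update(1) by (simp add: update_eq_add)
  qed
  fix f assume "f \<in> carrier K"
  then obtain F G where FG: "(F, G) \<in> fractions C" "f = frac F G" by (rule carrierE)
  obtain d where d: "homogeneous d F" "homogeneous d G" "\<not> vanishes_on G C" using FG(1) by (rule fractionsE)
  note 1 = fr[OF d(1)] and 2 = fr[OF d(2)]
  have 3: "(?L ^ d, G) \<in> fractions C" by (rule fractions_inverse[OF 2 d(3)])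
  have "f = frac F (?L ^ d) \<otimes>\<^bsub>K\<^esub> inv\<^bsub>K\<^esub> (frac G (?L ^ d))"
    unfolding FG(2) frac_inverse[OF 2 d(3)] frac_mult[OF 1 3]
    by (rule frac_eqI[OF FG(1) fractions_mult(1)[OF 1 3]]) (simp add: algebra_simps)
  moreover have "frac G (?L ^ d) \<noteq> \<zero>\<^bsub>K\<^esub>" using frac_eq_zero_iff[OF 2] d(3) by simp
  ultimately show "f \<in> S" using sub(6)[OF form[OF d(1)]] subfield_m_inv(1)[OF S(1)] form[OF d(2)] by auto
qed

end

section \<open>Nonsingular curves over an algebraically closed field\<close>

locale smooth_curve =
  fixes C :: "('n::finite, 'a::alg_closed_field) point set"
  assumes nonsingular: "nonsingular_curve C"

sublocale smooth_curve \<subseteq> projective_variety C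
  using nonsingular by unfold_locales (simp add: nonsingular_curve_def projective_curve_def)

sublocale smooth_curve \<subseteq> alg_closed_const_field K "const_fun C" ..

context smooth_curve
begin

text \<open>Dimension one supplies the element \<open>x\<close>, and the ratios of coordinates
  supply finitely many generators.\<close>

lemma exists_dep_function_field:
  assumes f: "f \<in> carrier K" "f \<notin> range (const_fun C)"
  obtains N where "dep f N"
proof -
  obtain x where x: "x \<in> carrier K"
      "\<And>y. y \<in> carrier K \<Longrightarrow> (algebraic over generate_field K (insert x (range (const_fun C)))) y"
    using nonsingular unfolding nonsingular_curve_def projective_curve_def constants_def by blast
  obtain P where P: "P \<in> C" using nonempty by blast
  obtain k where "\<not> vanishes_at (coordinate k) P"
    using exists_nonvanishing_coordinate[OF C_projective[OF P]] by blast
  then have k: "\<not> vanishes_on (coordinate k) C" by (rule not_vanishes_onI[OF P])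
  obtain js :: "'n list" where js: "set js = UNIV" using finite_list[OF finite_class.finite_UNIV] by blast
  define zs where "zs = map (\<lambda>i. frac (coordinate i) (coordinate k)) js"
  show ?thesis
  proof (rule dep_exists[OF x _ _ f])
    show "set zs \<subseteq> carrier K" unfolding zs_def
      using k by (auto intro!: frac_carrier fractionsI[of 1])
    show "carrier K \<subseteq> F" if "subfield F K" "range (const_fun C) \<subseteq> F" "set zs \<subseteq> F" for F
      by (rule generated_by_coordinates[OF k that(1,2)]) (use that(3) js in \<open>auto simp: zs_def\<close>)
  qed (use that in auto)
qed

lemma exists_nonconstant: "\<exists>x\<in>carrier K. x \<notin> range (const_fun C)"
proof -
  obtain x where x: "x \<in> carrier K" "(transcendental over range (const_fun C)) x"
    using nonsingular unfolding nonsingular_curve_def projective_curve_def constants_def by blast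
  then show ?thesis
    using algebraic_self[OF subfieldE(1)[OF subfield_constants]] by (auto simp: over_def)
qed

end

section \<open>The local ring at one point\<close>

locale curve_point = smooth_curve +
  fixes P assumes P: "P \<in> C"
begin

abbreviation \<O> :: "('a, 'b) ratfun set" where "\<O> \<equiv> carrier (local_ring C P)"
abbreviation \<MM> :: "('a, 'b) ratfun set" where "\<MM> \<equiv> local_maximal_ideal C P"

lemma O_def: "\<O> = {f \<in> carrier K. \<exists>F G. (F, G) \<in> f \<and> \<not> vanishes_at G P}"
  by (auto simp: local_ring_def)

lemma M_def: "\<MM> = {f \<in> carrier K. \<exists>F G. (F, G) \<in> f \<and> \<not> vanishes_at G P \<and> vanishes_at F P}"
  by (auto simp: local_maximal_ideal_def)

lemma OE:
  assumes "f \<in> \<O>"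
  obtains F G d where "(F, G) \<in> fractions C" "f = frac F G" "\<not> vanishes_at G P" "homogeneous d F" "homogeneous d G"
  using assms carrier_frac[of f] that unfolding O_def by (blast elim: fractionsE)

lemma OI: "homogeneous d F \<Longrightarrow> homogeneous d G \<Longrightarrow> \<not> vanishes_at G P \<Longrightarrow> frac F G \<in> \<O>"
  using fractionsI[of d F G] not_vanishes_onI[OF P] frac_carrier mem_frac unfolding O_def by blast

lemma MI: "homogeneous d F \<Longrightarrow> homogeneous d G \<Longrightarrow> \<not> vanishes_at G P \<Longrightarrow> vanishes_at F P \<Longrightarrow> frac F G \<in> \<MM>"
  using fractionsI[of d F G] not_vanishes_onI[OF P] frac_carrier mem_frac unfolding M_def by blast

lemma at_P: "homogeneous d F \<Longrightarrow> vanishes_at F P \<longleftrightarrow> poly_at F (rep P) = 0"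
  by (rule vanishes_at_rep[OF C_projective[OF P]])

text \<open>Membership in the ideal asks only for some fraction with vanishing numerator. The cross
  difference, evaluated at \<open>P\<close>, shows that every other fraction whose denominator is
  nonzero at \<open>P\<close> has a nonzero numerator there too.\<close>

lemma not_M:
  assumes F: "homogeneous d F" "homogeneous d G" "\<not> vanishes_at G P" "\<not> vanishes_at F P"
  shows "frac F G \<notin> \<MM>"
proof
  assume "frac F G \<in> \<MM>"
  then obtain F' G' where F': "(F', G') \<in> frac F G" "\<not> vanishes_at G' P" "vanishes_at F' P"
    unfolding M_def by blast
  have FG: "(F, G) \<in> fractions C" using F not_vanishes_onI[OF P] by (blast intro: fractionsI)
  note 1 = carrier_frac[OF frac_carrier[OF FG] F'(1)]
  obtain e where e: "homogeneous e F'" "homogeneous e G'" using 1(1) by (rule fractionsE)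
  have "vanishes_on (F * G' - F' * G) C" using 1 FG frac_eq_iff by metis
  then have "poly_at (F * G' - F' * G) (rep P) = 0"
    using P rep_mem[OF C_projective[OF P]] unfolding vanishes_on_def vanishes_at_def by blast
  then show False using F F' e at_P by (simp add: poly_at_minus poly_at_mult)
qed

lemma local_ring_mult: "monoid.mult (local_ring C P) = monoid.mult K"
  and local_ring_one: "\<one>\<^bsub>local_ring C P\<^esub> = \<one>\<^bsub>K\<^esub>"
  by (simp_all add: local_ring_def)

lemma cgen: "PIdl\<^bsub>local_ring C P\<^esub> t = {u \<otimes>\<^bsub>K\<^esub> t | u. u \<in> \<O>}"
  unfolding cgenideal_def local_ring_mult ..

sublocale residue_local_ring K "const_fun C" \<O> \<MM>
proof
  show O_carrier: "\<O> \<subseteq> carrier K" unfolding O_def by blast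
  show const: "const_fun C a \<in> \<O>" for a
    unfolding const_fun_eq by (rule OI[of 0]) (auto simp: at_P[OF homogeneous_1])
  show add: "x \<oplus>\<^bsub>K\<^esub> y \<in> \<O>" if x: "x \<in> \<O>" and y: "y \<in> \<O>" for x y
  proof -
    obtain F G d where 1: "(F, G) \<in> fractions C" "x = frac F G" "\<not> vanishes_at G P" "homogeneous d F" "homogeneous d G"
      using x by (rule OE)
    obtain F' G' e where 2: "(F', G') \<in> fractions C" "y = frac F' G'" "\<not> vanishes_at G' P" "homogeneous e F'" "homogeneous e G'"
      using y by (rule OE)
    have "homogeneous (d + e) (F * G')" "homogeneous (d + e) (F' * G)" "homogeneous (d + e) (G * G')"
      using homogeneous_mult[OF 1(4) 2(5)] homogeneous_mult[OF 2(4) 1(5)] homogeneous_mult[OF 1(5) 2(5)]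
      by (auto simp: add.commute)
    moreover from this have "\<not> vanishes_at (G * G') P" using 1 2 at_P by (simp add: poly_at_mult)
    ultimately show ?thesis unfolding 1(2) 2(2) frac_add[OF 1(1) 2(1)] by (intro OI homogeneous_add)
  qed
  show mult: "x \<otimes>\<^bsub>K\<^esub> y \<in> \<O>" if x: "x \<in> \<O>" and y: "y \<in> \<O>" for x y
  proof -
    obtain F G d where 1: "(F, G) \<in> fractions C" "x = frac F G" "\<not> vanishes_at G P" "homogeneous d F" "homogeneous d G"
      using x by (rule OE)
    obtain F' G' e where 2: "(F', G') \<in> fractions C" "y = frac F' G'" "\<not> vanishes_at G' P" "homogeneous e F'" "homogeneous e G'"
      using y by (rule OE)
    have h: "homogeneous (d + e) (F * F')" "homogeneous (d + e) (G * G')"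
      using homogeneous_mult[OF 1(4) 2(4)] homogeneous_mult[OF 1(5) 2(5)] by auto
    then have "\<not> vanishes_at (G * G') P" using 1 2 at_P by (simp add: poly_at_mult)
    then show ?thesis unfolding 1(2) 2(2) frac_mult[OF 1(1) 2(1)] by (rule OI[OF h])
  qed
  show M_O: "\<MM> \<subseteq> \<O>" unfolding M_def O_def by blast
  show M_one: "\<one>\<^bsub>K\<^esub> \<notin> \<MM>"
    unfolding one_eq by (rule not_M[of 0]) (auto simp: at_P[OF homogeneous_1])
  show "inv\<^bsub>K\<^esub> x \<in> \<O>" if x: "x \<in> \<O>" "x \<notin> \<MM>" for x
  proof -
    obtain F G d where 1: "(F, G) \<in> fractions C" "x = frac F G" "\<not> vanishes_at G P" "homogeneous d F" "homogeneous d G"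
      using x(1) by (rule OE)
    then have F: "\<not> vanishes_at F P" using x(2) MI by blast
    show ?thesis unfolding 1(2) frac_inverse[OF 1(1) not_vanishes_onI[OF P F]] by (rule OI[OF 1(5,4) F])
  qed
  show residue: "\<exists>a. x \<ominus>\<^bsub>K\<^esub> const_fun C a \<in> \<MM>" if x: "x \<in> \<O>" for x
  proof -
    obtain F G d where 1: "(F, G) \<in> fractions C" "x = frac F G" "\<not> vanishes_at G P" "homogeneous d F" "homogeneous d G"
      using x by (rule OE)
    \<comment> \<open>The residue is the value of the function at \<open>P\<close>.\<close>
    define a where "a = poly_at F (rep P) / poly_at G (rep P)"
    have G: "poly_at G (rep P) \<noteq> 0" using 1 at_P by blast
    let ?H = "F * 1 + Poly_Mapping.single 0 (- a) * G"
    have H: "homogeneous d ?H"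
      using homogeneous_add[OF 1(4), of "Poly_Mapping.single 0 (- a) * G"]
        homogeneous_mult[OF homogeneous_const 1(5), of "- a"] by simp
    have "x \<ominus>\<^bsub>K\<^esub> const_fun C a = frac ?H (G * 1)"
      unfolding a_minus_def c_uminus[symmetric] unfolding const_fun_eq 1(2) by (rule frac_add[OF 1(1) const_fraction])
    moreover have "vanishes_at ?H P"
      unfolding at_P[OF H] using G by (simp add: poly_at_add poly_at_mult a_def)
    ultimately show ?thesis using MI[OF H 1(5)] 1(3) by (intro exI[of _ a]) simp
  qed
  have cring_O: "cring (local_ring C P)"
  proof -
    have "subcring \<O> K"
    proof (rule subcringI')
      show "subring \<O> K"
      proof (rule subringI)
        show "\<one>\<^bsub>K\<^esub> \<in> \<O>" using const[of 1] by simp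
        show "\<ominus>\<^bsub>K\<^esub> x \<in> \<O>" if "x \<in> \<O>" for x
          using mult[OF const[of "-1"] that] that O_carrier by (auto simp: c_uminus[of 1] l_minus)
      qed (use O_carrier mult add in auto)
    qed
    then have "cring (K\<lparr>carrier := \<O>\<rparr>)" using subcring_iff[OF O_carrier] by blast
    moreover have "K\<lparr>carrier := \<O>\<rparr> = local_ring C P" by (simp add: local_ring_def)
    ultimately show ?thesis by simp
  qed
  show "\<exists>t\<in>\<O>. \<MM> = {u \<otimes>\<^bsub>K\<^esub> t | u. u \<in> \<O>}"
  proof -
    have "principalideal \<MM> (local_ring C P)" using nonsingular P by (simp add: nonsingular_curve_def)
    then obtain t where t: "t \<in> \<O>" "\<MM> = Idl\<^bsub>local_ring C P\<^esub> {t}" by (blast dest: principalideal.generate)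
    then show ?thesis using cring.cgenideal_eq_genideal[OF cring_O t(1)] cgen by auto
  qed
  show fraction: "\<exists>a\<in>\<O>. \<exists>b\<in>\<O>. b \<noteq> \<zero>\<^bsub>K\<^esub> \<and> x = a \<otimes>\<^bsub>K\<^esub> inv\<^bsub>K\<^esub> b" if x: "x \<in> carrier K" for x
  proof -
    obtain F G where FG: "(F, G) \<in> fractions C" "x = frac F G" using x by (rule carrierE)
    obtain d where d: "homogeneous d F" "homogeneous d G" "\<not> vanishes_on G C" using FG(1) by (rule fractionsE)
    obtain k where k: "\<not> vanishes_at (coordinate k) P"
      using exists_nonvanishing_coordinate[OF C_projective[OF P]] by blast
    \<comment> \<open>A coordinate that is nonzero at \<open>P\<close>, raised to the common degree,
      serves as denominator for numerator and denominator alike and makes both regular at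
      \<open>P\<close>.\<close>
    let ?L = "coordinate k ^ d :: ('a, 'b) mpoly"
    have L: "homogeneous d ?L" using homogeneous_power[OF homogeneous_coordinate[of k], of d] by simp
    have LP: "\<not> vanishes_at ?L P" using k at_P[OF L] at_P[OF homogeneous_coordinate] by (simp add: poly_at_power)
    note LC = not_vanishes_onI[OF P LP]
    have fr: "(F, ?L) \<in> fractions C" "(G, ?L) \<in> fractions C" "(?L, G) \<in> fractions C"
      using d L LC by (auto intro: fractionsI)
    have "x = frac F ?L \<otimes>\<^bsub>K\<^esub> inv\<^bsub>K\<^esub> frac G ?L"
      unfolding FG(2) frac_inverse[OF fr(2) d(3)] frac_mult[OF fr(1,3)]
      by (rule frac_eqI[OF FG(1) fractions_mult(1)[OF fr(1,3)]]) (simp add: algebra_simps)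
    moreover have "frac G ?L \<noteq> \<zero>\<^bsub>K\<^esub>" using frac_eq_zero_iff[OF fr(2)] d(3) by simp
    ultimately show ?thesis using OI[OF d(1) L LP] OI[OF d(2) L LP] by blast
  qed
  \<comment> \<open>If the ideal were zero, every function regular at \<open>P\<close> would equal
    its residue, and so every quotient would be constant; but the curve carries a nonconstant
    function.\<close>
  show "\<exists>x\<in>\<MM>. x \<noteq> \<zero>\<^bsub>K\<^esub>"
  proof (rule ccontr)
    assume "\<not> ?thesis"
    then have triv: "x = \<zero>\<^bsub>K\<^esub>" if "x \<in> \<MM>" for x using that by blast
    have Oc: "x \<in> range (const_fun C)" if x: "x \<in> \<O>" for x
    proof -
      obtain a where "x \<ominus>\<^bsub>K\<^esub> const_fun C a = \<zero>\<^bsub>K\<^esub>" using residue[OF x] triv by blast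
      then have "x = const_fun C a" using x O_carrier by (subst (asm) r_right_minus_eq) auto
      then show ?thesis by simp
    qed
    have "x \<in> range (const_fun C)" if x: "x \<in> carrier K" for x
    proof -
      obtain a b where ab: "a \<in> \<O>" "b \<in> \<O>" "b \<noteq> \<zero>\<^bsub>K\<^esub>" "x = a \<otimes>\<^bsub>K\<^esub> inv\<^bsub>K\<^esub> b" using fraction[OF x] by blast
      then show ?thesis
        using subringE(6)[OF subfieldE(1)[OF subfield_constants] Oc[OF ab(1)]]
          subfield_m_inv(1)[OF subfield_constants] Oc[OF ab(2)] by auto
    qed
    then show False using exists_nonconstant by blast
  qed
  \<comment> \<open>A nonzero constant does not vanish at \<open>P\<close>, so a nonzero element of
    the ideal is nonconstant and the algebraic bound applies to it.\<close>
  show "\<exists>N. dep x N" if x: "x \<in> \<MM>" "x \<noteq> \<zero>\<^bsub>K\<^esub>" for x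
  proof -
    have xc: "x \<in> carrier K" using x M_O O_carrier by blast
    have "x \<notin> range (const_fun C)"
    proof
      assume "x \<in> range (const_fun C)"
      then obtain a where a: "x = const_fun C a" by auto
      then have "a \<noteq> 0" using x by auto
      have "const_fun C a \<notin> \<MM>" unfolding const_fun_eq
        by (rule not_M[of 0]) (use \<open>a \<noteq> 0\<close> in \<open>auto simp: at_P[OF homogeneous_1] at_P[OF homogeneous_const]\<close>)
      then show False using a x by simp
    qed
    then show ?thesis using exists_dep_function_field[OF xc] by blast
  qed
qed

lemma local_parameter_iff: "local_parameter C P t \<longleftrightarrow> uniformizer t"
  unfolding local_parameter_def uniformizer_def cgen by blast

lemma Units_local_ring: "Units (local_ring C P) = \<U>"
proof -
  have "Units (local_ring C P) = {u \<in> \<O>. \<exists>y\<in>\<O>. y \<otimes>\<^bsub>K\<^esub> u = \<one>\<^bsub>K\<^esub> \<and> u \<otimes>\<^bsub>K\<^esub> y = \<one>\<^bsub>K\<^esub>}"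
    unfolding Units_def local_ring_mult local_ring_one ..
  also have "\<dots> = \<U>"
  proof (intro equalityI subsetI)
    fix u assume "u \<in> {u \<in> \<O>. \<exists>y\<in>\<O>. y \<otimes>\<^bsub>K\<^esub> u = \<one>\<^bsub>K\<^esub> \<and> u \<otimes>\<^bsub>K\<^esub> y = \<one>\<^bsub>K\<^esub>}"
    then obtain y where y: "u \<in> \<O>" "y \<in> \<O>" "u \<otimes>\<^bsub>K\<^esub> y = \<one>\<^bsub>K\<^esub>" by blast
    then have "inv\<^bsub>K\<^esub> u = y" by (intro comm_inv_char) auto
    moreover have "u \<noteq> \<zero>\<^bsub>K\<^esub>" using y by auto
    ultimately show "u \<in> \<U>" using y by (simp add: \<U>_def del: U_O)
  next
    fix u assume u: "u \<in> \<U>"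
    then show "u \<in> {u \<in> \<O>. \<exists>y\<in>\<O>. y \<otimes>\<^bsub>K\<^esub> u = \<one>\<^bsub>K\<^esub> \<and> u \<otimes>\<^bsub>K\<^esub> y = \<one>\<^bsub>K\<^esub>}"
      using U_O[OF u] U_O[OF U_inv[OF u]] U_nonzero[OF u] by (intro CollectI conjI bexI[of _ "inv\<^bsub>K\<^esub> u"]) auto
  qed
  finally show ?thesis .
qed

lemma ord_at_eq: "ord_at C P = val"
  unfolding ord_at_def val_def local_parameter_iff Units_local_ring ..

end

sublocale smooth_curve \<subseteq> valued_curve K "const_fun C" C "ord_at C"
proof
  show "ord_at C P (x \<otimes>\<^bsub>K\<^esub> y) = ord_at C P x + ord_at C P y"
    if "P \<in> C" "x \<in> carrier K" "y \<in> carrier K" "x \<noteq> \<zero>\<^bsub>K\<^esub>" "y \<noteq> \<zero>\<^bsub>K\<^esub>" for P x y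
  proof -
    interpret curve_point C P by unfold_locales (rule that(1))
    show ?thesis unfolding ord_at_eq by (rule val_mult[OF that(2-5)])
  qed
  show "min (ord_at C P x) (ord_at C P y) \<le> ord_at C P (x \<oplus>\<^bsub>K\<^esub> y)"
    if "P \<in> C" "x \<in> carrier K" "y \<in> carrier K" "x \<noteq> \<zero>\<^bsub>K\<^esub>" "y \<noteq> \<zero>\<^bsub>K\<^esub>" "x \<oplus>\<^bsub>K\<^esub> y \<noteq> \<zero>\<^bsub>K\<^esub>" for P x y
  proof -
    interpret curve_point C P by unfold_locales (rule that(1))
    show ?thesis unfolding ord_at_eq by (rule val_add[OF that(2-6)])
  qed
  show "ord_at C P (const_fun C a) = 0" if "P \<in> C" "a \<noteq> 0" for P a
  proof -
    interpret curve_point C P by unfold_locales (rule that(1))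
    show ?thesis unfolding ord_at_eq by (rule val_const[OF that(2)])
  qed
  show "\<exists>a. x \<ominus>\<^bsub>K\<^esub> const_fun C a = \<zero>\<^bsub>K\<^esub> \<or> 0 < ord_at C P (x \<ominus>\<^bsub>K\<^esub> const_fun C a)"
    if "P \<in> C" "x \<in> carrier K" "x \<noteq> \<zero>\<^bsub>K\<^esub>" "0 \<le> ord_at C P x" for P x
  proof -
    interpret curve_point C P by unfold_locales (rule that(1))
    have "x \<in> \<O>" using O_iff that by (simp add: ord_at_eq)
    then obtain a where "x \<ominus>\<^bsub>K\<^esub> const_fun C a \<in> \<MM>" using residue by blast
    then show ?thesis unfolding ord_at_eq using M_iff[of "x \<ominus>\<^bsub>K\<^esub> const_fun C a"] by blast
  qed
  show "\<exists>t\<in>carrier K. t \<noteq> \<zero>\<^bsub>K\<^esub> \<and> ord_at C P t = 1" if "P \<in> C" for P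
  proof -
    interpret curve_point C P by unfold_locales (rule that)
    obtain t where t: "uniformizer t" using exists_uniformizer by blast
    then show ?thesis unfolding ord_at_eq using t_closed[OF t] t_nonzero[OF t] val_uniformizer[OF t] by blast
  qed
  show "\<exists>h\<in>carrier K. h \<noteq> \<zero>\<^bsub>K\<^esub> \<and> (\<forall>R\<in>S. 0 \<le> ord_at C R h) \<and> 0 < ord_at C Q h \<and> ord_at C P h = 0"
    if S: "finite S" "S \<subseteq> C" "P \<in> S" "Q \<in> S" "P \<noteq> Q" for S P Q
  proof -
    have SP: "S \<subseteq> projective_space" using S(2) C_projective by blast
    \<comment> \<open>The separating function is a quotient of linear forms: the numerator
      distinguishes \<open>Q\<close> from \<open>P\<close>, and the denominator is nonzero on the
      whole finite set.\<close>
    obtain L where L: "homogeneous 1 L" "vanishes_at L Q" "\<not> vanishes_at L P"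
      using linear_form_separating_points[of P Q] S SP by blast
    obtain M where M: "homogeneous 1 M" "\<And>R. R \<in> S \<Longrightarrow> \<not> vanishes_at M R"
      using finite_set_avoided_by_linear_form[OF S(1) SP] by blast
    have PC: "P \<in> C" "Q \<in> C" using S by auto
    have LC: "\<not> vanishes_on L C" by (rule not_vanishes_onI[OF PC(1) L(3)])
    have fr: "(L, M) \<in> fractions C"
      using L(1) M(1) not_vanishes_onI[OF PC(1) M(2)[OF S(3)]] by (rule fractionsI)
    define h where "h = frac L M"
    have h: "h \<in> carrier K" "h \<noteq> \<zero>\<^bsub>K\<^esub>"
      using frac_carrier[OF fr] frac_eq_zero_iff[OF fr] LC by (auto simp: h_def)
    have nonneg: "0 \<le> ord_at C R h" if R: "R \<in> S" for R
    proof -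
      interpret curve_point C R using R S by unfold_locales blast
      have "h \<in> \<O>" unfolding h_def by (rule OI[OF L(1) M(1) M(2)[OF R]])
      then show ?thesis using O_iff[OF h] by (simp add: ord_at_eq)
    qed
    have "0 < ord_at C Q h"
    proof -
      interpret curve_point C Q by unfold_locales (rule PC)
      have "h \<in> \<MM>" unfolding h_def by (rule MI[OF L(1) M(1) M(2)[OF S(4)] L(2)])
      then show ?thesis using M_iff[OF h] by (simp add: ord_at_eq)
    qed
    moreover have "\<not> 0 < ord_at C P h"
    proof -
      interpret curve_point C P by unfold_locales (rule PC)
      have "h \<notin> \<MM>" unfolding h_def by (rule not_M[OF L(1) M(1) M(2)[OF S(3)] L(3)])
      then show ?thesis using M_iff[OF h] by (simp add: ord_at_eq)
    qed
    then have "ord_at C P h = 0" using nonneg[OF S(3)] by simp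
    ultimately show ?thesis using h nonneg by blast
  qed
  show "\<exists>N. dep f N" if "f \<in> carrier K" "f \<notin> range (const_fun C)" for f
    by (rule exists_dep_function_field[OF that], rule exI)
qed

section \<open>Field automorphisms and descent\<close>

lemma lookup_const_mult:
  "Poly_Mapping.lookup (Poly_Mapping.single 0 a * F) m = a * Poly_Mapping.lookup (F :: ('n::finite, 'a::comm_ring_1) mpoly) m"
proof (induction F rule: mpoly_induct)
  case (single m' b)
  then show ?case by (simp add: mult_single lookup_single when_def)
qed (simp_all add: lookup_add distrib_left)

section \<open>Conjugation of polynomials by a field automorphism\<close>

locale field_automorphism =
  fixes \<sigma> :: "'a::field \<Rightarrow> 'a"
  assumes bij: "bij \<sigma>" and \<sigma>_add: "\<sigma> (a + b) = \<sigma> a + \<sigma> b" and \<sigma>_mult: "\<sigma> (a * b) = \<sigma> a * \<sigma> b"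
begin

lemma \<sigma>_0 [simp]: "\<sigma> 0 = 0"
  using \<sigma>_add[of 0 0] by (metis add_0 add_left_imp_eq add.right_neutral)

lemma \<sigma>_eq_0_iff [simp]: "\<sigma> a = 0 \<longleftrightarrow> a = 0"
  using bij \<sigma>_0 by (metis bij_def injD)

lemma \<sigma>_1 [simp]: "\<sigma> 1 = 1"
  using \<sigma>_mult[of 1 1] by simp

lemma \<sigma>_minus: "\<sigma> (a - b) = \<sigma> a - \<sigma> b"
  using \<sigma>_add[of "a - b" b] by simp

lemma \<sigma>_power: "\<sigma> (a ^ n) = \<sigma> a ^ n"
  by (induction n) (simp_all add: \<sigma>_mult)

lemma \<sigma>_sum: "\<sigma> (sum f A) = (\<Sum>i\<in>A. \<sigma> (f i))"
  by (induction A rule: infinite_finite_induct) (simp_all add: \<sigma>_add)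

lemma \<sigma>_prod: "\<sigma> (prod f A) = (\<Prod>i\<in>A. \<sigma> (f i))"
  by (induction A rule: infinite_finite_induct) (simp_all add: \<sigma>_mult)

abbreviation conj :: "('n::finite, 'a) mpoly \<Rightarrow> ('n, 'a) mpoly" where
  "conj F \<equiv> Poly_Mapping.map \<sigma> F"

lemma lookup_conj [simp]: "Poly_Mapping.lookup (conj F) m = \<sigma> (Poly_Mapping.lookup F m)"
  by (simp add: map.rep_eq when_def)

lemma keys_conj [simp]: "Poly_Mapping.keys (conj F) = Poly_Mapping.keys F"
  by (auto simp: in_keys_iff)

lemma conj_0 [simp]: "conj 0 = 0"
  by (rule poly_mapping_eqI) simp

lemma conj_single [simp]: "conj (Poly_Mapping.single m a) = Poly_Mapping.single m (\<sigma> a)"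
  by (rule poly_mapping_eqI) (simp add: lookup_single when_def)

lemma conj_1 [simp]: "conj 1 = 1"
  using conj_single[of 0 1] by simp

lemma conj_add: "conj (F + G) = conj F + conj G"
  by (rule poly_mapping_eqI) (simp add: lookup_add \<sigma>_add)

lemma conj_minus: "conj (F - G) = conj F - conj G"
  by (rule poly_mapping_eqI) (simp add: lookup_minus \<sigma>_minus)

lemma conj_mult: "conj (F * G) = conj F * conj G"
proof (induction F rule: mpoly_induct)
  case (single m a)
  show ?case
    by (induction G rule: mpoly_induct) (simp_all add: mult_single \<sigma>_mult distrib_left conj_add)
qed (simp_all add: distrib_right conj_add)

lemma homogeneous_conj [simp]: "homogeneous d (conj F) \<longleftrightarrow> homogeneous d F"
  by (simp add: homogeneous_def)

lemma poly_at_conj: "poly_at (conj F) (\<sigma> \<circ> x) = \<sigma> (poly_at F x)"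
  by (simp add: poly_at_def \<sigma>_sum \<sigma>_mult \<sigma>_prod \<sigma>_power)

lemma vanishes_at_conj [simp]: "vanishes_at (conj F) (galois_point \<sigma> P) \<longleftrightarrow> vanishes_at F P"
  by (simp add: vanishes_at_def galois_point_def poly_at_conj)

lemma conj_surj: obtains G where "conj G = F"
proof -
  have "inv_into UNIV \<sigma> a = 0 \<longleftrightarrow> a = 0" for a using bij by (metis \<sigma>_0 bij_inv_eq_iff)
  then have "conj (Poly_Mapping.map (inv_into UNIV \<sigma>) F) = F"
    using bij by (intro poly_mapping_eqI) (simp add: map.rep_eq when_def bij_is_surj surj_f_inv_f)
  then show ?thesis using that by blast
qed

end

lemma UN_pair_const:
  assumes "s \<in> S" "\<And>a b. (a, b) \<in> S \<Longrightarrow> h a b = Y"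
  shows "(\<Union>(a, b)\<in>S. h a b) = Y"
  using assms by (force simp: split_beta)

context projective_variety
begin

lemma mem_iff: "f \<in> carrier K \<Longrightarrow> (A, B) \<in> f \<longleftrightarrow> (A, B) \<in> fractions C \<and> frac A B = f"
  using carrier_frac mem_frac by metis

end

section \<open>The induced action on rational functions\<close>

locale variety_automorphism = projective_variety C + field_automorphism \<sigma>
  for C :: "('n::finite, 'a::field) point set" and \<sigma> :: "'a \<Rightarrow> 'a" +
  assumes stable: "galois_point \<sigma> ` C = C"
begin

lemma vanishes_on_conj [simp]: "vanishes_on (conj F) C \<longleftrightarrow> vanishes_on F C"
proof -
  have "vanishes_on (conj F) C \<longleftrightarrow> (\<forall>P\<in>galois_point \<sigma> ` C. vanishes_at (conj F) P)"
    unfolding stable vanishes_on_def ..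
  then show ?thesis by (simp add: vanishes_on_def)
qed

lemma fractions_conj [simp]: "(conj F, conj G) \<in> fractions C \<longleftrightarrow> (F, G) \<in> fractions C"
  by (simp add: fractions_def)

text \<open>The Galois action through the coefficients: where \<open>f\<close> is defined, the value
  of \<open>act f\<close> at the conjugate point is the conjugate of the value of
  \<open>f\<close>.\<close>

definition act :: "('n, 'a) ratfun \<Rightarrow> ('n, 'a) ratfun" where
  "act f = (\<Union>(F, G)\<in>f. frac (conj F) (conj G))"

lemma act_frac:
  assumes FG: "(F, G) \<in> fractions C"
  shows "act (frac F G) = frac (conj F) (conj G)"
proof -
  have "frac (conj A) (conj B) = frac (conj F) (conj G)" if "(A, B) \<in> frac F G" for A B
  proof -
    note AB = carrier_frac[OF frac_carrier[OF FG] that]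
    then have "vanishes_on (conj (A * G - F * B)) C" using FG by (metis frac_eq_iff vanishes_on_conj)
    then show ?thesis using AB FG by (subst frac_eq_iff) (auto simp: conj_minus conj_mult)
  qed
  then show ?thesis unfolding act_def by (rule UN_pair_const[OF mem_frac[OF FG]])
qed

lemma act_closed [simp]: "f \<in> carrier K \<Longrightarrow> act f \<in> carrier K"
  by (elim carrierE) (simp add: act_frac frac_carrier)

lemma act_mult: "f \<in> carrier K \<Longrightarrow> h \<in> carrier K \<Longrightarrow> act (f \<otimes>\<^bsub>K\<^esub> h) = act f \<otimes>\<^bsub>K\<^esub> act h"
  by (elim carrierE) (simp add: act_frac frac_mult fractions_mult conj_mult)

lemma act_add: "f \<in> carrier K \<Longrightarrow> h \<in> carrier K \<Longrightarrow> act (f \<oplus>\<^bsub>K\<^esub> h) = act f \<oplus>\<^bsub>K\<^esub> act h"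
  by (elim carrierE) (simp add: act_frac frac_add fractions_mult conj_mult conj_add)

lemma act_const: "act (const_fun C a) = const_fun C (\<sigma> a)"
  by (simp add: const_fun_eq act_frac const_fraction)

lemma act_one [simp]: "act \<one>\<^bsub>K\<^esub> = \<one>\<^bsub>K\<^esub>"
  using act_const[of 1] by simp

lemma act_zero_iff [simp]: "f \<in> carrier K \<Longrightarrow> act f = \<zero>\<^bsub>K\<^esub> \<longleftrightarrow> f = \<zero>\<^bsub>K\<^esub>"
  by (elim carrierE) (simp add: act_frac frac_eq_zero_iff)

lemma act_inv:
  assumes "f \<in> carrier K" "f \<noteq> \<zero>\<^bsub>K\<^esub>"
  shows "act (inv\<^bsub>K\<^esub> f) = inv\<^bsub>K\<^esub> (act f)"
proof -
  have "act f \<otimes>\<^bsub>K\<^esub> act (inv\<^bsub>K\<^esub> f) = \<one>\<^bsub>K\<^esub>"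
    using act_mult[of f "inv\<^bsub>K\<^esub> f"] assms by simp
  then show ?thesis using assms by (intro comm_inv_char[symmetric]) auto
qed

lemma act_pow: "f \<in> carrier K \<Longrightarrow> act (f [^]\<^bsub>K\<^esub> (n::nat)) = act f [^]\<^bsub>K\<^esub> n"
  by (induction n) (simp_all add: act_mult)

lemma act_zpow:
  assumes "f \<in> carrier K" "f \<noteq> \<zero>\<^bsub>K\<^esub>"
  shows "act (f [^]\<^bsub>K\<^esub> (n::int)) = act f [^]\<^bsub>K\<^esub> n"
  using assms by (simp del: pow_nat add: int_pow_def2 act_pow act_inv nat_pow_nonzero)

lemma act_surj:
  assumes "f \<in> carrier K"
  obtains h where "h \<in> carrier K" "act h = f"
proof -
  obtain F G where FG: "(F, G) \<in> fractions C" "f = frac F G" using assms by (rule carrierE)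
  obtain A where A: "conj A = F" using conj_surj by blast
  obtain B where B: "conj B = G" using conj_surj by blast
  have AB: "(A, B) \<in> fractions C" using FG(1) unfolding A[symmetric] B[symmetric] by simp
  show ?thesis using that[of "frac A B"] act_frac[OF AB] frac_carrier[OF AB] A B FG(2) by simp
qed

text \<open>Descent: a fraction representing an invariant function whose denominator, and then whose
  numerator, has the least number of terms has invariant coefficients, up to a common factor.\<close>

theorem invariant_representative:
  assumes f: "f \<in> carrier K" and inv: "act f = f"
  obtains F G where "(F, G) \<in> f" "conj F = F" "conj G = G"
proof -
  have mem: "(A, B) \<in> f \<longleftrightarrow> (A, B) \<in> fractions C \<and> frac A B = f" for A B
    by (rule mem_iff[OF f])
  have conj_mem: "(conj A, conj B) \<in> f" if "(A, B) \<in> f" for A B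
    using that act_frac[of A B] inv unfolding mem by auto
  define \<nu> where "\<nu> = (\<lambda>p :: ('n, 'a) mpoly \<times> ('n, 'a) mpoly. card (Poly_Mapping.keys (snd p)))"
  obtain A0 B0 where AB0: "(A0, B0) \<in> fractions C" "f = frac A0 B0" using f by (rule carrierE)
  define p where "p = (A0, B0)"
  have p: "p \<in> f" unfolding AB0(2) p_def by (rule mem_frac[OF AB0(1)])
  define p0 where "p0 = (ARG_MIN \<nu> p. p \<in> f)"
  obtain F0 G0 where p0: "p0 = (F0, G0)" by (cases p0)
  have FG0: "(F0, G0) \<in> f" using arg_min_natI[of "\<lambda>p. p \<in> f" p \<nu>] p p0 by (simp add: p0_def)
  have min0: "card (Poly_Mapping.keys G0) \<le> card (Poly_Mapping.keys B)" if "(A, B) \<in> f" for A B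
  proof -
    have "\<nu> p0 \<le> \<nu> (A, B)" unfolding p0_def by (rule arg_min_nat_le[of "\<lambda>p. p \<in> f", OF that])
    then show ?thesis by (simp add: \<nu>_def p0)
  qed
  obtain d where d: "homogeneous d F0" "homogeneous d G0" "\<not> vanishes_on G0 C"
    using FG0 by (auto simp: mem elim: fractionsE)
  have "G0 \<noteq> 0" using d(3) by auto
  then obtain m where m: "m \<in> Poly_Mapping.keys G0" by (metis keys_eq_empty ex_in_conv)
  \<comment> \<open>Scaling makes the coefficient at \<open>m\<close> equal to one, which the
    automorphism fixes. The term at \<open>m\<close> then drops out of the difference between
    \<open>G\<close> and its conjugate.\<close>
  define b where "b = inverse (Poly_Mapping.lookup G0 m)"
  have b: "b \<noteq> 0" "b * Poly_Mapping.lookup G0 m = 1" using m by (auto simp: b_def in_keys_iff)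
  let ?b = "Poly_Mapping.single 0 b :: ('n, 'a) mpoly"
  define G where "G = ?b * G0"
  define F1 where "F1 = ?b * F0"
  have keysG: "Poly_Mapping.keys G = Poly_Mapping.keys G0"
    using b by (auto simp: G_def in_keys_iff lookup_const_mult)
  have hG: "homogeneous d G" "homogeneous d F1"
    using homogeneous_mult[OF homogeneous_const d(2)] homogeneous_mult[OF homogeneous_const d(1)]
    by (auto simp: G_def F1_def)
  have b_nv: "\<not> vanishes_on ?b C" using vanishes_on_iff[OF homogeneous_const] nonempty b by auto
  have vG: "\<not> vanishes_on G C"
    unfolding G_def by (rule not_vanishes_on_mult[OF homogeneous_const d(2) b_nv d(3)])
  have F1G: "(F1, G) \<in> f"
  proof -
    have "(F1, G) \<in> fractions C" by (rule fractionsI[OF hG(2,1) vG])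
    moreover have "frac F1 G = frac F0 G0"
      using calculation FG0 by (intro frac_eqI) (auto simp: mem F1_def G_def algebra_simps)
    ultimately show ?thesis using FG0 by (simp add: mem)
  qed
  have minG: "card (Poly_Mapping.keys G) \<le> card (Poly_Mapping.keys B)" if "(A, B) \<in> f" for A B
    using min0[OF that] keysG by simp
  have cross: "vanishes_on (A * B' - A' * B) C" if "(A, B) \<in> f" "(A', B') \<in> f" for A B A' B'
    using that by (metis mem frac_eq_iff)
  define D where "D = conj G - G"
  have D: "homogeneous d D" using hG by (simp add: D_def homogeneous_minus)
  have lookup_D: "Poly_Mapping.lookup D k = \<sigma> (Poly_Mapping.lookup G k) - Poly_Mapping.lookup G k" for k
    by (simp add: D_def lookup_minus)
  have keys_D: "Poly_Mapping.keys D \<subseteq> Poly_Mapping.keys G" by (auto simp: in_keys_iff lookup_D)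
  \<comment> \<open>The conjugate fraction represents the same function. If \<open>D\<close> could
    serve as a denominator, the difference of the numerators over \<open>D\<close> would represent
    it as well, with fewer terms in the denominator than the minimum.\<close>
  have vD: "vanishes_on D C"
  proof (rule ccontr)
    assume nv: "\<not> vanishes_on D C"
    have "(conj F1 - F1, D) \<in> fractions C"
      by (rule fractionsI[of d]) (use hG D nv in \<open>auto simp: homogeneous_minus\<close>)
    moreover have "frac (conj F1 - F1) D = frac F1 G"
    proof (subst frac_eq_iff)
      have "(conj F1 - F1) * G - F1 * D = conj F1 * G - F1 * conj G"
        by (simp add: D_def algebra_simps)
      then show "vanishes_on ((conj F1 - F1) * G - F1 * D) C" using cross[OF conj_mem[OF F1G] F1G] by simp
    qed (use calculation F1G in \<open>auto simp: mem\<close>)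
    ultimately have "(conj F1 - F1, D) \<in> f" using F1G by (simp add: mem)
    then have "card (Poly_Mapping.keys G) \<le> card (Poly_Mapping.keys D)" by (rule minG)
    moreover have "m \<notin> Poly_Mapping.keys D"
      using b by (simp add: in_keys_iff lookup_D G_def lookup_const_mult)
    then have "Poly_Mapping.keys D \<subset> Poly_Mapping.keys G" using keys_D keysG m by auto
    ultimately show False using psubset_card_mono[OF finite_keys] by (metis leD)
  qed
  \<comment> \<open>Adding a form that vanishes on \<open>C\<close> changes no function. The
    difference of \<open>H\<close> and its conjugate is supported on the terms of \<open>H\<close>,
    so a suitable multiple of it removes one of them.\<close>
  have reduce: "\<exists>H'. homogeneous d H' \<and> vanishes_on (H' - H) C \<and>
      card (Poly_Mapping.keys H') < card (Poly_Mapping.keys H)"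
    if H: "homogeneous d H" "vanishes_on (conj H - H) C" "conj H \<noteq> H" for H
  proof -
    let ?D = "conj H - H"
    have lookup_D: "Poly_Mapping.lookup ?D k = \<sigma> (Poly_Mapping.lookup H k) - Poly_Mapping.lookup H k" for k
      by (simp add: lookup_minus)
    obtain k where k: "Poly_Mapping.lookup ?D k \<noteq> 0"
      using H(3) by (metis eq_iff_diff_eq_0 poly_mapping_eqI lookup_zero)
    have kH: "k \<in> Poly_Mapping.keys H" using k by (auto simp: in_keys_iff lookup_D)
    define e where "e = Poly_Mapping.lookup H k / Poly_Mapping.lookup ?D k"
    define H' where "H' = H - ?D * Poly_Mapping.single 0 e"
    have lookup_H': "Poly_Mapping.lookup H' j = Poly_Mapping.lookup H j - e * Poly_Mapping.lookup ?D j" for j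
      by (simp add: H'_def lookup_minus lookup_const_mult mult.commute[of _ "Poly_Mapping.single 0 e"])
    have "Poly_Mapping.keys H' \<subseteq> Poly_Mapping.keys H"
      by (auto simp: in_keys_iff lookup_H' lookup_D)
    moreover have "k \<notin> Poly_Mapping.keys H'" using k by (simp add: in_keys_iff lookup_H' e_def)
    ultimately have "Poly_Mapping.keys H' \<subset> Poly_Mapping.keys H" using kH by auto
    then have "card (Poly_Mapping.keys H') < card (Poly_Mapping.keys H)"
      by (intro psubset_card_mono) auto
    moreover have "homogeneous d H'"
      unfolding H'_def using H(1) homogeneous_mult[of d ?D 0 "Poly_Mapping.single 0 e"]
      by (simp add: homogeneous_minus)
    moreover have "vanishes_on (H' - H) C"
      using vanishes_on_minus[OF vanishes_on_0 vanishes_on_times[OF H(2), of "Poly_Mapping.single 0 e"]]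
      by (simp add: H'_def)
    ultimately show ?thesis by blast
  qed
  have G: "conj G = G"
  proof (rule ccontr)
    assume "conj G \<noteq> G"
    then obtain G' where G': "homogeneous d G'" "vanishes_on (G' - G) C"
        "card (Poly_Mapping.keys G') < card (Poly_Mapping.keys G)"
      using reduce[OF hG(1)] vD by (auto simp: D_def)
    have "\<not> vanishes_on G' C"
    proof
      assume "vanishes_on G' C"
      from vanishes_on_minus[OF this G'(2)] show False using vG by simp
    qed
    then have "(F1, G') \<in> fractions C" using hG G' by (intro fractionsI) auto
    moreover have "frac F1 G' = frac F1 G"
    proof (subst frac_eq_iff)
      have "vanishes_on ((0 - (G' - G)) * F1) C"
        by (rule vanishes_on_times[OF vanishes_on_minus[OF vanishes_on_0 G'(2)]])
      then show "vanishes_on (F1 * G - F1 * G') C" by (simp add: algebra_simps)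
    qed (use calculation F1G in \<open>auto simp: mem\<close>)
    ultimately have "(F1, G') \<in> f" using F1G by (simp add: mem)
    then show False using minG G'(3) by (metis leD)
  qed
  \<comment> \<open>With the invariant denominator now fixed, the same reduction is applied to a
    numerator with the fewest terms.\<close>
  define \<mu> where "\<mu> = (\<lambda>A :: ('n, 'a) mpoly. card (Poly_Mapping.keys A))"
  define F where "F = (ARG_MIN \<mu> A. (A, G) \<in> f)"
  have FG: "(F, G) \<in> f" unfolding F_def by (rule arg_min_natI[of "\<lambda>A. (A, G) \<in> f", OF F1G])
  have minF: "card (Poly_Mapping.keys F) \<le> card (Poly_Mapping.keys A)" if "(A, G) \<in> f" for A
    using arg_min_nat_le[of "\<lambda>A. (A, G) \<in> f", OF that, of \<mu>] by (simp add: \<mu>_def F_def)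
  have hF: "homogeneous d F"
  proof -
    obtain e where e: "homogeneous e F" "homogeneous e G" using FG by (auto simp: mem elim: fractionsE)
    obtain k where k: "k \<in> Poly_Mapping.keys G" using m keysG by blast
    then have "e = d" using e(2) hG(1) unfolding homogeneous_def by (metis)
    then show ?thesis using e by simp
  qed
  have "vanishes_on ((conj F - F) * G) C"
    using cross[OF conj_mem[OF FG] FG] by (simp add: G algebra_simps)
  then have vF: "vanishes_on (conj F - F) C"
    using vanishes_on_mult[OF homogeneous_minus hG(1)] hF vG by (metis homogeneous_conj)
  have "conj F = F"
  proof (rule ccontr)
    assume "conj F \<noteq> F"
    then obtain F' where F': "homogeneous d F'" "vanishes_on (F' - F) C"
        "card (Poly_Mapping.keys F') < card (Poly_Mapping.keys F)"
      using reduce[OF hF vF] by blast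
    have "(F', G) \<in> fractions C" using hG(1) F'(1) vG by (intro fractionsI)
    moreover have "frac F' G = frac F G"
    proof (subst frac_eq_iff)
      show "vanishes_on (F' * G - F * G) C"
        using vanishes_on_times[OF F'(2), of G] by (simp add: algebra_simps)
    qed (use calculation FG in \<open>auto simp: mem\<close>)
    ultimately have "(F', G) \<in> f" using FG by (simp add: mem)
    then show False using minF F'(3) by (metis leD)
  qed
  then show ?thesis using that FG G by blast
qed

end

section \<open>Orders under conjugation\<close>

locale curve_automorphism = smooth_curve C + variety_automorphism C \<sigma>
  for C :: "('n::finite, 'a::alg_closed_field) point set" and \<sigma> :: "'a \<Rightarrow> 'a"
begin

lemma galois_point_C: "P \<in> C \<Longrightarrow> galois_point \<sigma> P \<in> C"
  using stable by blast

lemma ord_act_nonneg: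
  assumes P: "P \<in> C" and f: "f \<in> carrier K" "f \<noteq> \<zero>\<^bsub>K\<^esub>" and "0 \<le> ord_at C P f"
  shows "0 \<le> ord_at C (galois_point \<sigma> P) (act f)"
proof -
  interpret p: curve_point C P by unfold_locales (rule P)
  interpret q: curve_point C "galois_point \<sigma> P" by unfold_locales (rule galois_point_C[OF P])
  have "f \<in> p.\<O>" using p.O_iff[OF f] assms(4) by (simp add: p.ord_at_eq)
  then obtain F G d where FG: "(F, G) \<in> fractions C" "f = frac F G" "\<not> vanishes_at G P" "homogeneous d F" "homogeneous d G"
    by (rule p.OE)
  have "act f \<in> q.\<O>" unfolding FG(2) act_frac[OF FG(1)] by (rule q.OI[of d]) (use FG in auto)
  then show ?thesis using q.O_iff[of "act f"] f by (simp add: q.ord_at_eq)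
qed

lemma ord_act_pos:
  assumes P: "P \<in> C" and f: "f \<in> carrier K" "f \<noteq> \<zero>\<^bsub>K\<^esub>" and "0 < ord_at C P f"
  shows "0 < ord_at C (galois_point \<sigma> P) (act f)"
proof -
  interpret p: curve_point C P by unfold_locales (rule P)
  interpret q: curve_point C "galois_point \<sigma> P" by unfold_locales (rule galois_point_C[OF P])
  have M: "f \<in> p.\<MM>" using p.M_iff[OF f] assms(4) by (simp add: p.ord_at_eq)
  then obtain F G where FG: "(F, G) \<in> f" "\<not> vanishes_at G P" "vanishes_at F P" unfolding p.M_def by blast
  note fr = carrier_frac[OF f(1) FG(1)]
  obtain d where d: "homogeneous d F" "homogeneous d G" using fr(1) by (rule fractionsE)
  have "act f \<in> q.\<MM>" unfolding fr(2) act_frac[OF fr(1)] by (rule q.MI[of d]) (use FG d in auto)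
  then show ?thesis using q.M_iff[of "act f"] f by (simp add: q.ord_at_eq)
qed

text \<open>Functions of order zero at \<open>P\<close> go to functions of order zero at the
  conjugate point, so the action multiplies orders by a fixed \<open>e\<close>, the order of the
  image of a uniformizer. Surjectivity of the action produces the order one, which forces
  \<open>e = 1\<close>.\<close>

lemma ord_act:
  assumes P: "P \<in> C" and f: "f \<in> carrier K" "f \<noteq> \<zero>\<^bsub>K\<^esub>"
  shows "ord_at C (galois_point \<sigma> P) (act f) = ord_at C P f"
proof -
  let ?Q = "galois_point \<sigma> P"
  note Q = galois_point_C[OF P]
  obtain t where t: "t \<in> carrier K" "t \<noteq> \<zero>\<^bsub>K\<^esub>" "ord_at C P t = 1" using v_uniformizer[OF P] by blast
  define e where "e = ord_at C ?Q (act t)"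
  have e: "0 < e" unfolding e_def using ord_act_pos[OF P t(1,2)] t(3) by simp
  have unit: "ord_at C ?Q (act u) = 0" if u: "u \<in> carrier K" "u \<noteq> \<zero>\<^bsub>K\<^esub>" "ord_at C P u = 0" for u
  proof -
    have "0 \<le> ord_at C ?Q (act (inv\<^bsub>K\<^esub> u))"
      by (rule ord_act_nonneg[OF P]) (use u P inv_nonzero in \<open>auto simp: v_inv\<close>)
    then have "0 \<le> - ord_at C ?Q (act u)" using u Q by (simp add: act_inv v_inv)
    then show ?thesis using ord_act_nonneg[OF P u(1,2)] u(3) by simp
  qed
  have nat: "ord_at C ?Q (act h) = e * ord_at C P h"
    if h: "h \<in> carrier K" "h \<noteq> \<zero>\<^bsub>K\<^esub>" "0 \<le> ord_at C P h" for h
  proof -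
    define n where "n = nat (ord_at C P h)"
    define u where "u = h \<otimes>\<^bsub>K\<^esub> inv\<^bsub>K\<^esub> (t [^]\<^bsub>K\<^esub> n)"
    have tn: "t [^]\<^bsub>K\<^esub> n \<in> carrier K" "t [^]\<^bsub>K\<^esub> n \<noteq> \<zero>\<^bsub>K\<^esub>" using t nat_pow_nonzero by auto
    have u: "u \<in> carrier K" "u \<noteq> \<zero>\<^bsub>K\<^esub>" using h tn inv_nonzero by (auto simp: u_def integral_iff)
    have "ord_at C P (t [^]\<^bsub>K\<^esub> n) = int n" using v_pow[OF P t(1,2)] t(3) by simp
    then have "ord_at C P u = ord_at C P h - int n"
      unfolding u_def using h tn P inv_nonzero by (simp add: v_mult v_inv)
    also have "\<dots> = 0" using h(3) by (simp add: n_def)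
    finally have 0: "ord_at C ?Q (act u) = 0" by (rule unit[OF u])
    have "h = u \<otimes>\<^bsub>K\<^esub> t [^]\<^bsub>K\<^esub> n" unfolding u_def using h tn by (simp add: m_assoc)
    then have "act h = act u \<otimes>\<^bsub>K\<^esub> act t [^]\<^bsub>K\<^esub> n" using u t by (simp add: act_mult act_pow)
    then have "ord_at C ?Q (act h) = int n * e"
      using 0 u t Q by (simp add: v_mult v_pow nat_pow_nonzero e_def)
    then show ?thesis using h by (simp add: n_def)
  qed
  have all: "ord_at C ?Q (act h) = e * ord_at C P h" if h: "h \<in> carrier K" "h \<noteq> \<zero>\<^bsub>K\<^esub>" for h
  proof (cases "0 \<le> ord_at C P h")
    case False
    then have "ord_at C ?Q (act (inv\<^bsub>K\<^esub> h)) = e * ord_at C P (inv\<^bsub>K\<^esub> h)"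
      by (intro nat) (use h P inv_nonzero in \<open>auto simp: v_inv\<close>)
    then show ?thesis using h P Q by (simp add: act_inv v_inv)
  qed (rule nat[OF h])
  obtain s where s: "s \<in> carrier K" "s \<noteq> \<zero>\<^bsub>K\<^esub>" "ord_at C ?Q s = 1" using v_uniformizer[OF Q] by blast
  obtain h where h: "h \<in> carrier K" "act h = s" using act_surj[OF s(1)] by blast
  have "h \<noteq> \<zero>\<^bsub>K\<^esub>" using act_zero_iff[OF h(1)] h(2) s(2) by simp
  then have "e * ord_at C P h = 1" using all[OF h(1)] h(2) s(3) by simp
  then have "e = 1" using e by (simp add: zmult_eq_1_iff)
  then show ?thesis using all[OF f] by simp
qed

end

section \<open>The Galois group of a finite field\<close>

text \<open>Multiplication by a nonzero \<open>x\<close> permutes the nonzero elements, and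
  comparing the products over them shows that \<open>x\<close> to the number of nonzero elements is
  one.\<close>

lemma power_card_eq_same:
  fixes x :: "'k::{field,finite}"
  shows "x ^ card (UNIV :: 'k set) = x"
proof (cases "x = 0")
  case False
  let ?U = "UNIV - {0::'k}"
  have "bij_betw ((*) x) ?U ?U"
    by (rule bij_betwI[where g = "\<lambda>y. y / x"]) (use False in auto)
  then have "(\<Prod>y\<in>?U. x * y) = \<Prod>?U" by (rule prod.reindex_bij_betw)
  then have "x ^ card ?U * \<Prod>?U = 1 * \<Prod>?U" by (simp add: prod.distrib)
  then have "x ^ card ?U = 1" by simp
  moreover have "card (UNIV :: 'k set) = Suc (card ?U)" by (rule card.remove) auto
  ultimately show ?thesis by (simp only: power_Suc mult_1_right)
qed (simp add: card_gt_0_iff)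

text \<open>The polynomial \<open>(1 + X) ^ q - X ^ q - 1\<close> has degree below \<open>q\<close>
  and vanishes at all \<open>q\<close> elements, so all its coefficients are zero. This gives
  additivity of the \<open>q\<close>-th power without factoring \<open>q\<close>.\<close>

lemma card_choose_eq_0:
  assumes "0 < j" "j < card (UNIV :: 'k::{field,finite} set)"
  shows "of_nat (card (UNIV :: 'k set) choose j) = (0::'k)"
proof -
  let ?q = "card (UNIV :: 'k set)"
  define p :: "'k poly" where "p = [:1, 1:] ^ ?q - Polynomial.monom 1 ?q - 1"
  have coeff: "Polynomial.coeff p i = of_nat (?q choose i) - (if i = ?q then 1 else 0) - (if i = 0 then 1 else 0)"
    if "i \<le> ?q" for i
    using that coeff_linear_poly_power[of i ?q "1::'k" 1] by (auto simp: p_def)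
  have "p = 0"
  proof (rule ccontr)
    assume p: "p \<noteq> 0"
    have "Polynomial.degree p \<le> ?q" unfolding p_def
      by (intro degree_diff_le) (auto simp: degree_monom_eq degree_linear_power)
    moreover have "Polynomial.coeff p ?q = 0" using coeff[of ?q] by simp
    ultimately have "Polynomial.degree p < ?q" using p by (metis le_neq_implies_less leading_coeff_0_iff)
    moreover have "card {x. poly p x = 0} \<le> Polynomial.degree p" by (rule card_poly_roots_bound[OF p])
    moreover have "poly p x = 0" for x
      using power_card_eq_same[of "1 + x"] power_card_eq_same[of x] by (simp add: p_def poly_monom)
    ultimately show False by simp
  qed
  then show ?thesis using coeff[of j] assms by simp
qed

section \<open>The Frobenius map on the algebraic closure\<close>

definition frobenius :: "'k::{field,finite} alg_closure \<Rightarrow> 'k alg_closure" where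
  "frobenius x = x ^ card (UNIV :: 'k set)"

lemma frobenius_add: "frobenius (x + y) = frobenius x + frobenius (y :: 'k::{field,finite} alg_closure)"
proof -
  let ?q = "card (UNIV :: 'k set)"
  have "frobenius (x + y) = (\<Sum>j\<le>?q. of_nat (?q choose j) * x ^ j * y ^ (?q - j))"
    by (simp add: frobenius_def binomial_ring)
  also have "\<dots> = (\<Sum>j\<in>{0, ?q}. of_nat (?q choose j) * x ^ j * y ^ (?q - j))"
  proof (rule sum.mono_neutral_right)
    show "\<forall>j\<in>{..?q} - {0, ?q}. of_nat (?q choose j) * x ^ j * y ^ (?q - j) = 0"
    proof
      fix j assume "j \<in> {..?q} - {0, ?q}"
      then have "of_nat (?q choose j) = (0::'k)" by (intro card_choose_eq_0) auto
      then have "to_ac (of_nat (?q choose j) :: 'k) = 0" by (simp only: to_ac_0)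
      then show "of_nat (?q choose j) * x ^ j * y ^ (?q - j) = 0" by (simp only: to_ac_of_nat mult_zero_left)
    qed
  qed auto
  also have "\<dots> = frobenius x + frobenius y" by (simp add: frobenius_def)
  finally show ?thesis .
qed

lemma frobenius_mult: "frobenius (x * y) = frobenius x * frobenius y"
  by (simp add: frobenius_def power_mult_distrib)

lemma frobenius_to_ac: "frobenius (to_ac a) = to_ac a"
  by (simp add: frobenius_def power_card_eq_same flip: to_ac_power)

lemma bij_frobenius: "bij (frobenius :: 'k::{field,finite} alg_closure \<Rightarrow> 'k alg_closure)"
proof (rule bijI)
  show "inj (frobenius :: 'k alg_closure \<Rightarrow> 'k alg_closure)"
  proof (rule injI)
    fix x y :: "'k alg_closure" assume "frobenius x = frobenius y"
    then have "frobenius (x - y) = 0" using frobenius_add[of "x - y" y] by simp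
    then show "x = y" by (simp add: frobenius_def)
  qed
  show "surj (frobenius :: 'k alg_closure \<Rightarrow> 'k alg_closure)"
    unfolding surj_def
  proof
    fix y :: "'k alg_closure"
    let ?p = "Polynomial.monom 1 (card (UNIV :: 'k set)) + [:- y:]"
    have "Polynomial.degree ?p = card (UNIV :: 'k set)"
      by (subst degree_add_eq_left) (auto simp: degree_monom_eq finite_UNIV_card_ge_0)
    then obtain x where "poly ?p x = 0"
      using alg_closed_imp_poly_has_root[of ?p] by (auto simp: finite_UNIV_card_ge_0)
    then have "y = frobenius x" by (simp add: frobenius_def poly_monom)
    then show "\<exists>x. y = frobenius x" by blast
  qed
qed

text \<open>\<open>X ^ q - X\<close> has at most \<open>q\<close> roots, and the ground field
  already provides \<open>q\<close> of them.\<close>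

lemma frobenius_fixed:
  fixes x :: "'k::{field,finite} alg_closure"
  assumes "frobenius x = x"
  shows "x \<in> range to_ac"
proof -
  let ?q = "card (UNIV :: 'k set)"
  have q: "1 < ?q" using card_mono[of UNIV "{0, 1 :: 'k}"] by simp
  let ?p = "Polynomial.monom 1 ?q + [:0, - 1 :: 'k alg_closure:]"
  have deg: "Polynomial.degree ?p = ?q"
    using q by (subst degree_add_eq_left) (auto simp: degree_monom_eq)
  then have "?p \<noteq> 0" using q by auto
  have roots: "{x. poly ?p x = 0} = {x. frobenius x = x}" by (auto simp: frobenius_def poly_monom)
  have "finite {x :: 'k alg_closure. frobenius x = x}" "card {x :: 'k alg_closure. frobenius x = x} \<le> ?q"
    using poly_roots_finite[OF \<open>?p \<noteq> 0\<close>] card_poly_roots_bound[OF \<open>?p \<noteq> 0\<close>] deg roots by auto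
  moreover have "range to_ac \<subseteq> {x :: 'k alg_closure. frobenius x = x}" by (auto simp: frobenius_to_ac)
  moreover have "card (range (to_ac :: 'k \<Rightarrow> _)) = ?q" by (rule card_image[OF inj_to_ac])
  ultimately have "range to_ac = {x :: 'k alg_closure. frobenius x = x}" by (metis card_seteq)
  then show ?thesis using assms by blast
qed

lemma frobenius_galois: "frobenius \<in> galois_group"
  unfolding galois_group_def
  by (intro CollectI conjI allI bij_frobenius frobenius_add frobenius_mult frobenius_to_ac)

section \<open>The Galois action on coordinates, points and curves\<close>

lemma galois_automorphism: "\<sigma> \<in> galois_group \<Longrightarrow> field_automorphism \<sigma>"
  by unfold_locales (auto simp: galois_group_def)

lemma galois_to_ac: "\<sigma> \<in> galois_group \<Longrightarrow> \<sigma> (to_ac a) = to_ac a"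
  by (simp add: galois_group_def)

lemma galois_inv:
  assumes "\<sigma> \<in> galois_group"
  shows "inv_into UNIV \<sigma> \<in> galois_group"
proof -
  interpret field_automorphism \<sigma> by (rule galois_automorphism[OF assms])
  have i: "inv_into UNIV \<sigma> a = b \<longleftrightarrow> a = \<sigma> b" for a b using bij by (metis bij_inv_eq_iff)
  have s: "\<sigma> (inv_into UNIV \<sigma> a) = a" for a using i by metis
  show ?thesis
    unfolding galois_group_def using bij_imp_bij_inv[OF bij] galois_to_ac[OF assms]
    by (auto simp: i \<sigma>_add \<sigma>_mult s)
qed

lemma galois_point_inv:
  assumes "\<sigma> \<in> galois_group"
  shows "galois_point (inv_into UNIV \<sigma>) (galois_point \<sigma> P) = P"
    and "galois_point \<sigma> (galois_point (inv_into UNIV \<sigma>) P) = P"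
proof -
  interpret field_automorphism \<sigma> by (rule galois_automorphism[OF assms])
  have "inv_into UNIV \<sigma> \<circ> \<sigma> = id" "\<sigma> \<circ> inv_into UNIV \<sigma> = id"
    using bij by (auto simp: bij_def surj_iff)
  then have "inv_into UNIV \<sigma> \<circ> (\<sigma> \<circ> x) = x" "\<sigma> \<circ> (inv_into UNIV \<sigma> \<circ> x) = x" for x :: "'b \<Rightarrow> _"
    by (simp_all add: comp_assoc[symmetric])
  then show "galois_point (inv_into UNIV \<sigma>) (galois_point \<sigma> P) = P"
    and "galois_point \<sigma> (galois_point (inv_into UNIV \<sigma>) P) = P"
    by (simp_all add: galois_point_def image_image)
qed

lemma galois_point_projective:
  assumes "\<sigma> \<in> galois_group" "P \<in> projective_space"
  shows "galois_point \<sigma> P \<in> projective_space"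
proof -
  interpret field_automorphism \<sigma> by (rule galois_automorphism[OF assms(1)])
  obtain x where x: "P = {\<lambda>i. c * x i | c. c \<noteq> 0}" "\<exists>i. x i \<noteq> 0"
    using assms(2) by (auto simp: projective_space_def)
  have "galois_point \<sigma> P = {\<lambda>i. c * \<sigma> (x i) | c. c \<noteq> 0}"
  proof (intro equalityI subsetI)
    fix z assume "z \<in> galois_point \<sigma> P"
    then obtain c where "c \<noteq> 0" "z = \<sigma> \<circ> (\<lambda>i. c * x i)" using x by (auto simp: galois_point_def)
    then have "z = (\<lambda>i. \<sigma> c * \<sigma> (x i)) \<and> \<sigma> c \<noteq> 0" by (auto simp: \<sigma>_mult)
    then show "z \<in> {\<lambda>i. c * \<sigma> (x i) | c. c \<noteq> 0}" by blast
  next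
    fix z assume "z \<in> {\<lambda>i. c * \<sigma> (x i) | c. c \<noteq> 0}"
    then obtain c where c: "c \<noteq> 0" "z = (\<lambda>i. c * \<sigma> (x i))" by blast
    obtain d where d: "c = \<sigma> d" using bij by (metis bij_pointE)
    then have "z = \<sigma> \<circ> (\<lambda>i. d * x i)" "d \<noteq> 0" using c by (auto simp: \<sigma>_mult)
    then show "z \<in> galois_point \<sigma> P" unfolding galois_point_def x(1) by blast
  qed
  then show ?thesis unfolding projective_space_def using x(2)
    by (intro CollectI exI[of _ "\<lambda>i. \<sigma> (x i)"]) simp
qed

lemma rational_coeffs_conj:
  fixes F :: "('n::finite, 'k::field alg_closure) mpoly"
  assumes "\<sigma> \<in> galois_group" "rational_coeffs F"
  shows "Poly_Mapping.map \<sigma> F = F"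
proof (rule poly_mapping_eqI)
  interpret field_automorphism \<sigma> by (rule galois_automorphism[OF assms(1)])
  fix m
  obtain a where "Poly_Mapping.lookup F m = to_ac a" using assms(2) by (auto simp: rational_coeffs_def)
  then show "Poly_Mapping.lookup (Poly_Mapping.map \<sigma> F) m = Poly_Mapping.lookup F m"
    using galois_to_ac[OF assms(1)] by simp
qed

lemma galois_point_mem:
  assumes \<sigma>: "\<sigma> \<in> galois_group" and C: "defined_over_ground C" and P: "P \<in> C"
  shows "galois_point \<sigma> P \<in> C"
proof -
  interpret field_automorphism \<sigma> by (rule galois_automorphism[OF \<sigma>])
  obtain S where S: "\<forall>F\<in>S. rational_coeffs F \<and> (\<exists>d. homogeneous d F)" "C = zero_locus S"
    using C by (auto simp: defined_over_ground_def)
  have "vanishes_at F (galois_point \<sigma> P)" if F: "F \<in> S" for F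
  proof -
    have "vanishes_at F P" using P F S by (simp add: zero_locus_def)
    moreover have "conj F = F" using rational_coeffs_conj[OF \<sigma>] F S by blast
    ultimately show ?thesis using vanishes_at_conj[of F P] by simp
  qed
  then show ?thesis using P S galois_point_projective[OF \<sigma>] by (auto simp: zero_locus_def)
qed

lemma galois_point_mem_iff:
  assumes "\<sigma> \<in> galois_group" "defined_over_ground C"
  shows "galois_point \<sigma> P \<in> C \<longleftrightarrow> P \<in> C"
  using galois_point_mem[OF assms, of P] galois_point_mem[OF galois_inv[OF assms(1)] assms(2), of "galois_point \<sigma> P"]
  by (auto simp: galois_point_inv[OF assms(1)])

lemma galois_point_stable:
  assumes "\<sigma> \<in> galois_group" "defined_over_ground C"
  shows "galois_point \<sigma> ` C = C"
proof
  show "galois_point \<sigma> ` C \<subseteq> C" using galois_point_mem[OF assms] by blast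
  show "C \<subseteq> galois_point \<sigma> ` C"
  proof
    fix P assume "P \<in> C"
    then have "galois_point (inv_into UNIV \<sigma>) P \<in> C" by (rule galois_point_mem[OF galois_inv[OF assms(1)] assms(2)])
    then show "P \<in> galois_point \<sigma> ` C" using galois_point_inv(2)[OF assms(1), of P] by (metis imageI)
  qed
qed

text \<open>A coordinate vector over the ground field is fixed, so the point and its conjugate share
  a vector, and a projective point is determined by any one of its vectors.\<close>

lemma galois_rational_point:
  assumes \<sigma>: "\<sigma> \<in> galois_group" and C: "C \<subseteq> projective_space" and A: "A \<in> rational_points C"
  shows "galois_point \<sigma> A = A"
proof -
  obtain x where x: "x \<in> A" "\<And>i. x i \<in> range to_ac" using A by (auto simp: rational_points_def)
  have A': "A \<in> projective_space" using A C by (auto simp: rational_points_def)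
  have "\<sigma> (x i) = x i" for i using x(2)[of i] galois_to_ac[OF \<sigma>] by auto
  then have "\<sigma> \<circ> x = x" by auto
  then have "x \<in> galois_point \<sigma> A" using x(1) unfolding galois_point_def by (metis imageI)
  then show ?thesis
    by (rule trans[OF projective_space_member(1)[OF galois_point_projective[OF \<sigma> A']]
          projective_space_member(1)[OF A' x(1), symmetric]])
qed

section \<open>Rational divisors, degrees and effective divisors\<close>

lemma rational_divisor_frag_of:
  assumes C: "C \<subseteq> projective_space" and A: "A \<in> rational_points C"
  shows "rational_divisor (frag_of A)"
  unfolding rational_divisor_def
proof (intro ballI allI)
  fix \<sigma> :: "'b alg_closure \<Rightarrow> 'b alg_closure" and P assume \<sigma>: "\<sigma> \<in> galois_group"
  have "galois_point \<sigma> P = A \<longleftrightarrow> P = A"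
    using galois_rational_point[OF \<sigma> C A] galois_point_inv(1)[OF \<sigma>] by metis
  then show "Poly_Mapping.lookup (frag_of A) (galois_point \<sigma> P) = Poly_Mapping.lookup (frag_of A) P"
    by simp
qed

lemma rational_divisor_add: "rational_divisor D \<Longrightarrow> rational_divisor E \<Longrightarrow> rational_divisor (D + E)"
  by (simp add: rational_divisor_def lookup_add)

lemma rational_divisor_minus: "rational_divisor D \<Longrightarrow> rational_divisor E \<Longrightarrow> rational_divisor (D - E)"
  by (simp add: rational_divisor_def lookup_minus)

lemma rational_divisor_uminus: "rational_divisor D \<Longrightarrow> rational_divisor (- D)"
  by (simp add: rational_divisor_def)

lemma rational_divisor_cmul: "rational_divisor D \<Longrightarrow> rational_divisor (frag_cmul n D)"
  by (simp add: rational_divisor_def)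

lemma rational_divisor_0: "rational_divisor 0"
  by (simp add: rational_divisor_def)

lemma div_degree_superset:
  "finite A \<Longrightarrow> Poly_Mapping.keys D \<subseteq> A \<Longrightarrow> div_degree D = (\<Sum>P\<in>A. Poly_Mapping.lookup D P)"
  unfolding div_degree_def by (rule sum.mono_neutral_left) (auto simp: in_keys_iff)

lemma div_degree_add: "div_degree (D + E) = div_degree D + div_degree E"
proof -
  let ?A = "Poly_Mapping.keys D \<union> Poly_Mapping.keys E"
  have "div_degree F = (\<Sum>P\<in>?A. Poly_Mapping.lookup F P)" if "F \<in> {D, E, D + E}" for F
    by (rule div_degree_superset) (use that keys_add[of D E] in auto)
  then show ?thesis by (simp add: lookup_add sum.distrib)
qed

lemma div_degree_0 [simp]: "div_degree 0 = 0"
  by (simp add: div_degree_def)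

lemma div_degree_uminus: "div_degree (- D) = - div_degree D"
  using div_degree_add[of D "- D"] by simp

lemma div_degree_minus: "div_degree (D - E) = div_degree D - div_degree E"
  using div_degree_add[of D "- E"] by (simp add: div_degree_uminus)

lemma div_degree_frag_of [simp]: "div_degree (frag_of P) = 1"
  by (simp add: div_degree_def)

lemma div_degree_cmul: "div_degree (frag_cmul n D) = n * div_degree D"
proof -
  have "div_degree (frag_cmul n D) = (\<Sum>P\<in>Poly_Mapping.keys D. Poly_Mapping.lookup (frag_cmul n D) P)"
    by (rule div_degree_superset) (auto simp: keys_cmul)
  then show ?thesis by (simp add: div_degree_def sum_distrib_left)
qed

lemma points_divisor_Suc: "points_divisor (Suc g) Z = points_divisor g Z + frag_of (Z (Suc g))"
  by (simp add: points_divisor_def)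

lemma points_divisor_0 [simp]: "points_divisor 0 Z = 0"
  by (simp add: points_divisor_def)

lemma div_degree_points [simp]: "div_degree (points_divisor g Z) = int g"
  by (induction g) (simp_all add: points_divisor_Suc div_degree_add)

lemma lookup_points_nonneg: "0 \<le> Poly_Mapping.lookup (points_divisor g Z) P"
  by (induction g) (simp_all add: points_divisor_Suc lookup_add)

lemma keys_points: "Poly_Mapping.keys (points_divisor g Z) \<subseteq> Z ` {1..g}"
proof (induction g)
  case (Suc g)
  have "Poly_Mapping.keys (points_divisor (Suc g) Z) \<subseteq> Poly_Mapping.keys (points_divisor g Z) \<union> {Z (Suc g)}"
    unfolding points_divisor_Suc using keys_add[of "points_divisor g Z" "frag_of (Z (Suc g))"] by simp
  then show ?case using Suc by (fastforce simp: atLeastAtMostSuc_conv)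
qed simp

text \<open>Peel off one point of the support at a time, which lowers the degree by one and keeps
  the coefficients nonnegative. Points may repeat in the resulting family.\<close>

lemma effective_divisor_points:
  assumes "\<And>P. 0 \<le> Poly_Mapping.lookup D P" "div_degree D = int g"
  obtains Z where "D = points_divisor g Z" "Z ` {1..g} \<subseteq> Poly_Mapping.keys D"
  using assms
proof (induction g arbitrary: D thesis)
  case 0
  have "Poly_Mapping.lookup D P = 0" for P
  proof (cases "P \<in> Poly_Mapping.keys D")
    case True
    then show ?thesis using 0(2,3) sum_nonneg_eq_0_iff[of "Poly_Mapping.keys D" "Poly_Mapping.lookup D"]
      by (simp add: div_degree_def)
  qed (simp add: in_keys_iff)
  then have "D = 0" by (intro poly_mapping_eqI) simp
  then show ?case using 0(1) by simp
next
  case (Suc g)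
  have "D \<noteq> 0" using Suc(4) by auto
  then obtain P where P: "P \<in> Poly_Mapping.keys D" by (metis keys_eq_empty ex_in_conv)
  then have pos: "1 \<le> Poly_Mapping.lookup D P" using Suc(3)[of P] by (simp add: in_keys_iff)
  define E where "E = D - frag_of P"
  have "0 \<le> Poly_Mapping.lookup E Q" for Q using Suc(3)[of Q] pos by (simp add: E_def lookup_minus)
  moreover have "div_degree E = int g" using Suc(4) by (simp add: E_def div_degree_minus)
  ultimately obtain Z where Z: "E = points_divisor g Z" "Z ` {1..g} \<subseteq> Poly_Mapping.keys E"
    using Suc(1) by blast
  define Z' where "Z' = Z(Suc g := P)"
  have eq: "points_divisor g Z' = points_divisor g Z"
    unfolding points_divisor_def by (rule sum.cong) (auto simp: Z'_def)
  have "D = points_divisor (Suc g) Z'"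
    unfolding points_divisor_Suc eq using Z(1) by (simp add: Z'_def E_def algebra_simps)
  moreover have "Poly_Mapping.keys E \<subseteq> Poly_Mapping.keys D"
  proof
    fix Q assume "Q \<in> Poly_Mapping.keys E"
    then show "Q \<in> Poly_Mapping.keys D" using P by (cases "Q = P") (auto simp: in_keys_iff E_def lookup_minus)
  qed
  then have "Z' ` {1..Suc g} \<subseteq> Poly_Mapping.keys D"
    using Z(2) P by (auto simp: Z'_def image_subset_iff atLeastAtMostSuc_conv)
  ultimately show ?case by (rule Suc(2))
qed

section \<open>Leading coefficients and divisor classes\<close>

lemma (in ring) dimension_1D:
  assumes "dimension 1 k W" "k \<subseteq> carrier R"
  obtains w where "w \<in> carrier R" "w \<noteq> \<zero>" "W = {a \<otimes> w | a. a \<in> k}"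
proof -
  have "dimension (Suc 0) k W" using assms by simp
  then show ?thesis
  proof (cases rule: dimension.cases)
    case (Suc_dim w E)
    from Suc_dim(4) have "E = {\<zero>}" by (cases rule: dimension.cases) auto
    then have "W = {a \<otimes> w | a. a \<in> k}"
      using Suc_dim assms(2) by (auto simp: line_extension_mem_iff subset_iff)
    then show ?thesis using that Suc_dim \<open>E = {\<zero>}\<close> by auto
  qed
qed

section \<open>Leading coefficients\<close>

context curve_point
begin

text \<open>Write \<open>f\<close> as a power of \<open>t\<close> times a unit. The coefficient is
  the residue of that unit, nonzero because a unit lies outside the maximal ideal.\<close>

lemma leading_coefficient_exists:
  assumes t: "local_parameter C P t" and f: "f \<in> carrier K" "f \<noteq> \<zero>\<^bsub>K\<^esub>"
  shows "\<exists>a. leading_coefficient C P t f a"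
proof -
  have t': "uniformizer t" using t by (simp add: local_parameter_iff)
  note [simp] = t_closed[OF t'] t_nonzero[OF t']
  obtain m u where u: "u \<in> \<U>" "f = t [^]\<^bsub>K\<^esub> (m::int) \<otimes>\<^bsub>K\<^esub> u" using exists_power_unit[OF t' f] by blast
  obtain a where a: "u \<ominus>\<^bsub>K\<^esub> const_fun C a \<in> \<MM>" using residue[OF U_O[OF u(1)]] by blast
  have uM: "u \<notin> \<MM>" using u(1) by (simp add: U_iff)
  have a0: "a \<noteq> 0"
  proof
    assume "a = 0"
    then show False using a uM u(1) by (simp add: a_minus_def)
  qed
  obtain w where w: "w \<in> \<O>" "u \<ominus>\<^bsub>K\<^esub> const_fun C a = w \<otimes>\<^bsub>K\<^esub> t" using a unfolding M_eq[OF t'] by blast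
  have "u = const_fun C a \<oplus>\<^bsub>K\<^esub> (u \<ominus>\<^bsub>K\<^esub> const_fun C a)"
    using u(1) by (simp add: a_minus_def a_lcomm r_neg)
  then have ueq: "u = const_fun C a \<oplus>\<^bsub>K\<^esub> w \<otimes>\<^bsub>K\<^esub> t" using w(2) by simp
  have "f = t [^]\<^bsub>K\<^esub> m \<otimes>\<^bsub>K\<^esub> (const_fun C a \<oplus>\<^bsub>K\<^esub> w \<otimes>\<^bsub>K\<^esub> t)" using u(2) ueq by simp
  also have "\<dots> = const_fun C a \<otimes>\<^bsub>K\<^esub> t [^]\<^bsub>K\<^esub> m \<oplus>\<^bsub>K\<^esub> (t [^]\<^bsub>K\<^esub> m \<otimes>\<^bsub>K\<^esub> t) \<otimes>\<^bsub>K\<^esub> w"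
    using w(1) by (simp add: r_distr m_ac O_closed)
  also have "t [^]\<^bsub>K\<^esub> m \<otimes>\<^bsub>K\<^esub> t = t [^]\<^bsub>K\<^esub> (m + 1)"
    by (subst zpow_add) (auto simp: int_pow_def2 simp del: pow_nat)
  finally show ?thesis unfolding leading_coefficient_def using a0 w(1) by blast
qed

lemma leading_coefficient_unit:
  assumes t: "uniformizer t" and a: "a \<noteq> 0" and u: "u \<in> \<O>"
    and f: "f = const_fun C a \<otimes>\<^bsub>K\<^esub> t [^]\<^bsub>K\<^esub> (m::int) \<oplus>\<^bsub>K\<^esub> t [^]\<^bsub>K\<^esub> (m + 1) \<otimes>\<^bsub>K\<^esub> u"
  shows "const_fun C a \<oplus>\<^bsub>K\<^esub> t \<otimes>\<^bsub>K\<^esub> u \<in> \<U>"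
    and "f = t [^]\<^bsub>K\<^esub> m \<otimes>\<^bsub>K\<^esub> (const_fun C a \<oplus>\<^bsub>K\<^esub> t \<otimes>\<^bsub>K\<^esub> u)"
proof -
  note [simp] = t_closed[OF t] t_nonzero[OF t]
  show "const_fun C a \<oplus>\<^bsub>K\<^esub> t \<otimes>\<^bsub>K\<^esub> u \<in> \<U>"
    by (rule U_add_M[OF U_const[OF a] M_absorb[OF t_M[OF t] u]])
  have "t [^]\<^bsub>K\<^esub> (m + 1) = t [^]\<^bsub>K\<^esub> m \<otimes>\<^bsub>K\<^esub> t"
    by (subst zpow_add) (auto simp: int_pow_def2 simp del: pow_nat)
  then show "f = t [^]\<^bsub>K\<^esub> m \<otimes>\<^bsub>K\<^esub> (const_fun C a \<oplus>\<^bsub>K\<^esub> t \<otimes>\<^bsub>K\<^esub> u)"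
    unfolding f using u by (simp add: r_distr m_ac O_closed)
qed

text \<open>The exponent is the order of \<open>f\<close>, hence common to both expansions. After
  cancelling the power of \<open>t\<close>, the difference of the coefficients is a constant in the
  maximal ideal, so it is zero.\<close>

lemma leading_coefficient_unique:
  assumes t: "local_parameter C P t" and "leading_coefficient C P t f a" "leading_coefficient C P t f b"
  shows "a = b"
proof -
  have t': "uniformizer t" using t by (simp add: local_parameter_iff)
  note [simp] = t_closed[OF t'] t_nonzero[OF t']
  obtain m u where 1: "a \<noteq> 0" "u \<in> \<O>"
      "f = const_fun C a \<otimes>\<^bsub>K\<^esub> t [^]\<^bsub>K\<^esub> (m::int) \<oplus>\<^bsub>K\<^esub> t [^]\<^bsub>K\<^esub> (m + 1) \<otimes>\<^bsub>K\<^esub> u"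
    using assms(2) unfolding leading_coefficient_def by blast
  obtain n w where 2: "b \<noteq> 0" "w \<in> \<O>"
      "f = const_fun C b \<otimes>\<^bsub>K\<^esub> t [^]\<^bsub>K\<^esub> (n::int) \<oplus>\<^bsub>K\<^esub> t [^]\<^bsub>K\<^esub> (n + 1) \<otimes>\<^bsub>K\<^esub> w"
    using assms(3) unfolding leading_coefficient_def by blast
  note U1 = leading_coefficient_unit[OF t' 1] and U2 = leading_coefficient_unit[OF t' 2]
  have "m = n" using val_eq[OF t' U1(1), of m] val_eq[OF t' U2(1), of n] U1(2) U2(2) by metis
  let ?x = "const_fun C a \<oplus>\<^bsub>K\<^esub> t \<otimes>\<^bsub>K\<^esub> u" and ?y = "const_fun C b \<oplus>\<^bsub>K\<^esub> t \<otimes>\<^bsub>K\<^esub> w"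
  have "t [^]\<^bsub>K\<^esub> m \<otimes>\<^bsub>K\<^esub> ?x = t [^]\<^bsub>K\<^esub> m \<otimes>\<^bsub>K\<^esub> ?y" using U1(2) U2(2) \<open>m = n\<close> by metis
  then have eq: "?x = ?y"
    by (subst (asm) m_lcancel) (use zpow_nonzero[of t m] U1(1) U2(1) in \<open>auto simp del: U_O intro: U_closed\<close>)
  have "\<not> a \<noteq> b"
  proof
    assume "a \<noteq> b"
    then have U: "const_fun C (a - b) \<in> \<U>" by (intro U_const) simp
    have "const_fun C (a - b) = const_fun C a \<ominus>\<^bsub>K\<^esub> const_fun C b" by (rule c_minus)
    also have "\<dots> = (?x \<ominus>\<^bsub>K\<^esub> t \<otimes>\<^bsub>K\<^esub> u) \<ominus>\<^bsub>K\<^esub> const_fun C b"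
      using 1(2) by (simp add: a_minus_def a_assoc r_neg O_closed)
    also have "\<dots> = (?y \<ominus>\<^bsub>K\<^esub> t \<otimes>\<^bsub>K\<^esub> u) \<ominus>\<^bsub>K\<^esub> const_fun C b" by (simp only: eq)
    also have "\<dots> = (const_fun C b \<oplus>\<^bsub>K\<^esub> \<ominus>\<^bsub>K\<^esub> const_fun C b) \<oplus>\<^bsub>K\<^esub> (t \<otimes>\<^bsub>K\<^esub> w \<oplus>\<^bsub>K\<^esub> \<ominus>\<^bsub>K\<^esub> (t \<otimes>\<^bsub>K\<^esub> u))"
      using 1(2) 2(2) by (simp add: a_minus_def a_ac O_closed)
    also have "\<dots> = t \<otimes>\<^bsub>K\<^esub> w \<oplus>\<^bsub>K\<^esub> \<ominus>\<^bsub>K\<^esub> (t \<otimes>\<^bsub>K\<^esub> u)"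
      using 1(2) 2(2) by (simp add: r_neg O_closed)
    also have "\<dots> \<in> \<MM>"
      by (intro M_add M_uminus M_absorb t_M[OF t'] 1(2) 2(2))
    finally show False using U by (simp add: U_iff)
  qed
  then show ?thesis by simp
qed

lemma leading_coefficient_scale:
  assumes "leading_coefficient C P t f a" "b \<noteq> 0" "local_parameter C P t"
  shows "leading_coefficient C P t (const_fun C b \<otimes>\<^bsub>K\<^esub> f) (b * a)"
proof -
  have t': "uniformizer t" using assms(3) by (simp add: local_parameter_iff)
  note [simp] = t_closed[OF t'] t_nonzero[OF t']
  obtain m u where 1: "a \<noteq> 0" "u \<in> \<O>"
      "f = const_fun C a \<otimes>\<^bsub>K\<^esub> t [^]\<^bsub>K\<^esub> (m::int) \<oplus>\<^bsub>K\<^esub> t [^]\<^bsub>K\<^esub> (m + 1) \<otimes>\<^bsub>K\<^esub> u"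
    using assms(1) unfolding leading_coefficient_def by blast
  have "const_fun C b \<otimes>\<^bsub>K\<^esub> f = const_fun C (b * a) \<otimes>\<^bsub>K\<^esub> t [^]\<^bsub>K\<^esub> m
      \<oplus>\<^bsub>K\<^esub> t [^]\<^bsub>K\<^esub> (m + 1) \<otimes>\<^bsub>K\<^esub> (const_fun C b \<otimes>\<^bsub>K\<^esub> u)"
    unfolding 1(3) using 1(2) by (simp add: r_distr c_mult m_ac O_closed)
  moreover have "const_fun C b \<otimes>\<^bsub>K\<^esub> u \<in> \<O>" using 1(2) by (intro O_mult c_O)
  ultimately show ?thesis unfolding leading_coefficient_def using 1(1) assms(2) by auto
qed

end

section \<open>Principal divisors\<close>

context smooth_curve
begin

lemma finite_principal_support:
  assumes "f \<in> carrier K" "f \<noteq> \<zero>\<^bsub>K\<^esub>"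
  shows "finite {P. (ord_at C P f when P \<in> C) \<noteq> 0}"
proof -
  have "{P. (ord_at C P f when P \<in> C) \<noteq> 0} = {P \<in> C. ord_at C P f \<noteq> 0}" by (auto simp: when_def)
  then show ?thesis using finite_support[OF assms] by simp
qed

lemma lookup_principal_divisor:
  assumes "f \<in> carrier K" "f \<noteq> \<zero>\<^bsub>K\<^esub>"
  shows "Poly_Mapping.lookup (principal_divisor C f) P = (if P \<in> C then ord_at C P f else 0)"
  unfolding principal_divisor_def lookup_Abs_poly_mapping[OF finite_principal_support[OF assms]] by (simp add: when_def)

lemma keys_principal_divisor:
  assumes "f \<in> carrier K" "f \<noteq> \<zero>\<^bsub>K\<^esub>"
  shows "Poly_Mapping.keys (principal_divisor C f) = {P \<in> C. ord_at C P f \<noteq> 0}"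
  by (auto simp: in_keys_iff lookup_principal_divisor[OF assms] split: if_splits)

lemma principal_divisor_mult:
  assumes "f \<in> carrier K" "f \<noteq> \<zero>\<^bsub>K\<^esub>" "h \<in> carrier K" "h \<noteq> \<zero>\<^bsub>K\<^esub>"
  shows "principal_divisor C (f \<otimes>\<^bsub>K\<^esub> h) = principal_divisor C f + principal_divisor C h"
  using assms by (intro poly_mapping_eqI) (simp add: lookup_principal_divisor lookup_add v_mult integral_iff)

lemma principal_divisor_inv:
  assumes "f \<in> carrier K" "f \<noteq> \<zero>\<^bsub>K\<^esub>"
  shows "principal_divisor C (inv\<^bsub>K\<^esub> f) = - principal_divisor C f"
  using assms inv_nonzero by (intro poly_mapping_eqI) (simp add: lookup_principal_divisor v_inv)

lemma principal_divisor_const: "a \<noteq> 0 \<Longrightarrow> principal_divisor C (const_fun C a) = 0"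
  by (intro poly_mapping_eqI) (simp add: lookup_principal_divisor v_const)

end

text \<open>Constancy of regular functions is a locale assumption because it is deduced from general
  position, which enters only in the final theorem. The degree formula for principal divisors rests
  on it.\<close>

locale rational_curve = smooth_curve C
  for C :: "('n::finite, 'k::{field,finite} alg_closure) point set" +
  assumes over_ground: "defined_over_ground C"
    and regular_constant: "f \<in> carrier K \<Longrightarrow> (\<And>P. P \<in> C \<Longrightarrow> ge P 0 f) \<Longrightarrow> f \<in> range (const_fun C)"
begin

lemma automorphism: "\<tau> \<in> galois_group \<Longrightarrow> curve_automorphism C \<tau>"
  by (intro curve_automorphism.intro variety_automorphism.intro variety_automorphism_axioms.intro
      galois_automorphism galois_point_stable over_ground smooth_curve_axioms projective_variety_axioms)

lemma degree_principal_divisor: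
  assumes "f \<in> carrier K" "f \<noteq> \<zero>\<^bsub>K\<^esub>"
  shows "div_degree (principal_divisor C f) = 0"
proof -
  have "div_degree (principal_divisor C f) = (\<Sum>P | P \<in> C \<and> ord_at C P f \<noteq> 0. ord_at C P f)"
    unfolding div_degree_def keys_principal_divisor[OF assms]
    by (rule sum.cong) (auto simp: lookup_principal_divisor[OF assms])
  then show ?thesis using degree_zero[OF regular_constant assms] by simp
qed

lemma rational_functions_closed: "f \<in> rational_functions C \<Longrightarrow> f \<in> carrier K"
  by (simp add: rational_functions_def)

lemma act_rational:
  assumes "\<tau> \<in> galois_group" "f \<in> rational_functions C"
  shows "variety_automorphism.act C \<tau> f = f"
proof -
  interpret curve_automorphism C \<tau> by (rule automorphism[OF assms(1)])
  obtain F G where FG: "(F, G) \<in> f" "rational_coeffs F" "rational_coeffs G" and f: "f \<in> carrier K"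
    using assms(2) by (auto simp: rational_functions_def)
  note fr = carrier_frac[OF f FG(1)]
  show ?thesis
    unfolding fr(2) act_frac[OF fr(1)]
    using rational_coeffs_conj[OF assms(1) FG(2)] rational_coeffs_conj[OF assms(1) FG(3)] by simp
qed

text \<open>Descent gives a fraction whose coefficients are fixed by Frobenius, and these lie in the
  ground field. Invariance under this one automorphism therefore decides rationality.\<close>

lemma rational_functionI:
  assumes f: "f \<in> carrier K" and inv: "variety_automorphism.act C frobenius f = f"
  shows "f \<in> rational_functions C"
proof -
  interpret curve_automorphism C frobenius by (rule automorphism[OF frobenius_galois])
  obtain F G where FG: "(F, G) \<in> f" "conj F = F" "conj G = G"
    using invariant_representative[OF f inv] by blast
  have "rational_coeffs H" if "conj H = H" for H
    unfolding rational_coeffs_def using that lookup_conj[of H] frobenius_fixed by metis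
  then show ?thesis using FG f by (auto simp: rational_functions_def)
qed

lemma rational_functions_mult_inv:
  assumes f: "f \<in> rational_functions C" "f \<noteq> \<zero>\<^bsub>K\<^esub>" and h: "h \<in> rational_functions C"
  shows "f \<otimes>\<^bsub>K\<^esub> h \<in> rational_functions C" "inv\<^bsub>K\<^esub> f \<in> rational_functions C"
proof -
  interpret curve_automorphism C frobenius by (rule automorphism[OF frobenius_galois])
  note c = rational_functions_closed[OF f(1)] rational_functions_closed[OF h]
  note a = act_rational[OF frobenius_galois f(1)] act_rational[OF frobenius_galois h]
  show "f \<otimes>\<^bsub>K\<^esub> h \<in> rational_functions C"
    using c a by (intro rational_functionI) (simp_all add: act_mult)
  show "inv\<^bsub>K\<^esub> f \<in> rational_functions C"
    using c a f(2) by (intro rational_functionI) (simp_all add: act_inv)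
qed

lemma one_rational_function: "\<one>\<^bsub>K\<^esub> \<in> rational_functions C"
proof -
  interpret curve_automorphism C frobenius by (rule automorphism[OF frobenius_galois])
  show ?thesis by (rule rational_functionI) simp_all
qed

lemma rational_principal_divisor:
  assumes f: "f \<in> rational_functions C" "f \<noteq> \<zero>\<^bsub>K\<^esub>"
  shows "rational_divisor (principal_divisor C f)"
  unfolding rational_divisor_def
proof (intro ballI allI)
  fix \<tau> :: "'k alg_closure \<Rightarrow> 'k alg_closure" and P assume \<tau>: "\<tau> \<in> galois_group"
  interpret curve_automorphism C \<tau> by (rule automorphism[OF \<tau>])
  note fc = rational_functions_closed[OF f(1)] f(2)
  show "Poly_Mapping.lookup (principal_divisor C f) (galois_point \<tau> P) = Poly_Mapping.lookup (principal_divisor C f) P"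
    unfolding lookup_principal_divisor[OF fc] galois_point_mem_iff[OF \<tau> over_ground]
    using ord_act[OF _ fc, of P] act_rational[OF \<tau> f(1)] by simp
qed

lemma act_riemann_roch_space:
  assumes \<tau>: "\<tau> \<in> galois_group" and D: "rational_divisor D" and f: "f \<in> riemann_roch_space C D"
  shows "variety_automorphism.act C \<tau> f \<in> riemann_roch_space C D"
proof -
  interpret curve_automorphism C \<tau> by (rule automorphism[OF \<tau>])
  have fc: "f \<in> carrier K" using f by (simp add: riemann_roch_space_def)
  show ?thesis
  proof (cases "f = \<zero>\<^bsub>K\<^esub>")
    case False
    have "- Poly_Mapping.lookup D P \<le> ord_at C P (act f)" if P: "P \<in> C" for P
    proof -
      obtain Q where Q: "Q \<in> C" "P = galois_point \<tau> Q" using P stable by blast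
      have "Poly_Mapping.lookup D P = Poly_Mapping.lookup D Q"
        using D \<tau> unfolding Q(2) rational_divisor_def by blast
      moreover have "ord_at C P (act f) = ord_at C Q f" unfolding Q(2) by (rule ord_act[OF Q(1) fc False])
      moreover have "- Poly_Mapping.lookup D Q \<le> ord_at C Q f"
        using f False Q(1) by (simp add: riemann_roch_space_def)
      ultimately show ?thesis by simp
    qed
    then show ?thesis using fc by (simp add: riemann_roch_space_def)
  qed (use f in \<open>simp add: riemann_roch_space_def\<close>)
qed

text \<open>A rational parameter is fixed by the action, so conjugating the expansion conjugates its
  coefficient; the remainder stays regular because the point is fixed.\<close>

lemma act_leading_coefficient:
  assumes \<tau>: "\<tau> \<in> galois_group" and A: "A \<in> C" "galois_point \<tau> A = A"
    and t: "t \<in> rational_functions C" "local_parameter C A t" and l: "leading_coefficient C A t f a"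
  shows "leading_coefficient C A t (variety_automorphism.act C \<tau> f) (\<tau> a)"
proof -
  interpret curve_automorphism C \<tau> by (rule automorphism[OF \<tau>])
  interpret p: curve_point C A by unfold_locales (rule A)
  have t': "p.uniformizer t" using t by (simp add: p.local_parameter_iff)
  note [simp] = p.t_closed[OF t'] p.t_nonzero[OF t']
  obtain m u where 1: "a \<noteq> 0" "u \<in> p.\<O>"
      "f = const_fun C a \<otimes>\<^bsub>K\<^esub> t [^]\<^bsub>K\<^esub> (m::int) \<oplus>\<^bsub>K\<^esub> t [^]\<^bsub>K\<^esub> (m + 1) \<otimes>\<^bsub>K\<^esub> u"
    using l unfolding leading_coefficient_def by blast
  have u: "u \<in> carrier K" using 1(2) p.O_closed by blast
  have "act f = const_fun C (\<tau> a) \<otimes>\<^bsub>K\<^esub> t [^]\<^bsub>K\<^esub> m \<oplus>\<^bsub>K\<^esub> t [^]\<^bsub>K\<^esub> (m + 1) \<otimes>\<^bsub>K\<^esub> act u"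
    unfolding 1(3) using u by (simp add: act_add act_mult act_const act_zpow act_rational[OF \<tau> t(1)])
  moreover have "act u \<in> p.\<O>"
  proof (cases "u = \<zero>\<^bsub>K\<^esub>")
    case False
    have "0 \<le> ord_at C (galois_point \<tau> A) (act u)"
      by (rule ord_act_nonneg[OF A(1) u False]) (use p.O_iff[OF u False] 1(2) in \<open>simp add: p.ord_at_eq\<close>)
    then show ?thesis using p.O_iff[of "act u"] u False unfolding A(2) by (simp add: p.ord_at_eq)
  next
    case True
    then have "act u = \<zero>\<^bsub>K\<^esub>" using act_zero_iff[OF u] by simp
    then show ?thesis by simp
  qed
  ultimately show ?thesis unfolding leading_coefficient_def using 1(1) by auto
qed

section \<open>The class group of rational divisors of degree zero\<close>

abbreviation G where "G \<equiv> rational_div0_group C"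
abbreviation H where "H \<equiv> rational_principal_divisors C"

lemma G_simps [simp]: "x \<otimes>\<^bsub>G\<^esub> y = x + y" "\<one>\<^bsub>G\<^esub> = 0"
  by (simp_all add: rational_div0_group_def free_Abelian_group_def)

lemma carrier_G: "D \<in> carrier G \<longleftrightarrow> Poly_Mapping.keys D \<subseteq> C \<and> rational_divisor D \<and> div_degree D = 0"
  by (auto simp: rational_div0_group_def free_Abelian_group_def)

lemma subgroup_G: "subgroup (carrier G) (free_Abelian_group C)"
proof
  show "inv\<^bsub>free_Abelian_group C\<^esub> x \<in> carrier G" if "x \<in> carrier G" for x
    using that by (simp add: carrier_G rational_divisor_uminus div_degree_uminus)
qed (use keys_add in \<open>fastforce simp: carrier_G free_Abelian_group_def rational_divisor_add rational_divisor_0 div_degree_add\<close>)+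

lemma G_eq: "G = (free_Abelian_group C)\<lparr>carrier := carrier G\<rparr>"
  by (simp add: rational_div0_group_def)

sublocale G: comm_group G
proof (rule group.group_comm_groupI)
  show "group G"
    using group.subgroup_imp_group[OF group_free_Abelian_group subgroup_G] G_eq by simp
qed (simp add: add.commute)

lemma G_int_pow:
  assumes "x \<in> carrier G"
  shows "x [^]\<^bsub>G\<^esub> (n::int) = frag_cmul n x"
proof -
  have "x [^]\<^bsub>free_Abelian_group C\<^esub> n = x [^]\<^bsub>(free_Abelian_group C)\<lparr>carrier := carrier G\<rparr>\<^esub> n"
    by (rule group.int_pow_consistent[OF group_free_Abelian_group subgroup_G assms])
  moreover have "x [^]\<^bsub>free_Abelian_group C\<^esub> n = frag_cmul n x"
    by (rule int_pow_free_Abelian_group) (use assms in \<open>simp add: carrier_G free_Abelian_group_def\<close>)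
  ultimately show ?thesis using G_eq by simp
qed

lemma HE:
  assumes "D \<in> H"
  obtains f where "f \<in> rational_functions C" "f \<noteq> \<zero>\<^bsub>K\<^esub>" "D = principal_divisor C f"
  using assms by (auto simp: rational_principal_divisors_def)

lemma HI: "f \<in> rational_functions C \<Longrightarrow> f \<noteq> \<zero>\<^bsub>K\<^esub> \<Longrightarrow> principal_divisor C f \<in> H"
  by (auto simp: rational_principal_divisors_def)

lemma H_subset: "H \<subseteq> carrier G"
proof
  fix D assume "D \<in> H"
  then obtain f where f: "f \<in> rational_functions C" "f \<noteq> \<zero>\<^bsub>K\<^esub>" "D = principal_divisor C f" by (rule HE)
  note fc = rational_functions_closed[OF f(1)] f(2)
  show "D \<in> carrier G"
    using keys_principal_divisor[OF fc] degree_principal_divisor[OF fc] rational_principal_divisor[OF f(1,2)]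
    by (simp add: carrier_G f(3))
qed

lemma subgroup_H: "subgroup H G"
proof (rule G.subgroupI)
  show "H \<subseteq> carrier G" by (rule H_subset)
  show "H \<noteq> {}" using HI[OF one_rational_function one_not_zero] by blast
  show "inv\<^bsub>G\<^esub> D \<in> H" if D: "D \<in> H" for D
  proof -
    obtain f where f: "f \<in> rational_functions C" "f \<noteq> \<zero>\<^bsub>K\<^esub>" "D = principal_divisor C f" using D by (rule HE)
    note fc = rational_functions_closed[OF f(1)] f(2)
    have i: "principal_divisor C (inv\<^bsub>K\<^esub> f) \<in> H"
      by (rule HI[OF rational_functions_mult_inv(2)[OF f(1,2,1)] inv_nonzero[OF fc]])
    then have "- D \<in> H" by (simp add: f(3) principal_divisor_inv[OF fc])
    moreover have "inv\<^bsub>G\<^esub> D = - D"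
      using H_subset D calculation by (intro G.inv_equality) auto
    ultimately show ?thesis by simp
  qed
  show "D \<otimes>\<^bsub>G\<^esub> E \<in> H" if DE: "D \<in> H" "E \<in> H" for D E
  proof -
    obtain f where f: "f \<in> rational_functions C" "f \<noteq> \<zero>\<^bsub>K\<^esub>" "D = principal_divisor C f" using DE(1) by (rule HE)
    obtain h where h: "h \<in> rational_functions C" "h \<noteq> \<zero>\<^bsub>K\<^esub>" "E = principal_divisor C h" using DE(2) by (rule HE)
    have "principal_divisor C (f \<otimes>\<^bsub>K\<^esub> h) \<in> H"
      using rational_functions_mult_inv(1)[OF f(1,2) h(1)] f h rational_functions_closed
      by (intro HI) (auto simp: integral_iff)
    then show ?thesis
      using f h rational_functions_closed by (simp add: principal_divisor_mult)
  qed
qed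

sublocale H: normal H G
  using G.normal_iff_subgroup subgroup_H by blast

lemma Pic0_eq: "Pic0 C = G Mod H"
  by (simp add: Pic0_def)

lemma class_eq: "divisor_class C D = H #>\<^bsub>G\<^esub> D"
  by (simp add: divisor_class_def)

lemma class_closed: "D \<in> carrier G \<Longrightarrow> divisor_class C D \<in> carrier (Pic0 C)"
  unfolding Pic0_eq class_eq by (simp add: FactGroup_def G.rcosetsI[OF H_subset])

lemma class_add:
  "D \<in> carrier G \<Longrightarrow> E \<in> carrier G \<Longrightarrow>
    divisor_class C (D + E) = divisor_class C D \<otimes>\<^bsub>Pic0 C\<^esub> divisor_class C E"
  unfolding Pic0_eq class_eq using H.rcos_sum by (simp add: FactGroup_def)

lemma class_cmul:
  "D \<in> carrier G \<Longrightarrow> divisor_class C (frag_cmul n D) = divisor_class C D [^]\<^bsub>Pic0 C\<^esub> n"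
  unfolding Pic0_eq class_eq using H.FactGroup_int_pow by (simp add: G_int_pow)

lemma mem_class_iff: "E \<in> divisor_class C D \<longleftrightarrow> E - D \<in> H"
proof -
  have "E \<in> divisor_class C D \<longleftrightarrow> (\<exists>h\<in>H. E = h + D)"
    unfolding class_eq r_coset_def by auto
  also have "\<dots> \<longleftrightarrow> E - D \<in> H" by (metis add_diff_cancel diff_add_cancel)
  finally show ?thesis .
qed

end

section \<open>Wave functions\<close>

context rational_curve
begin

context
  fixes D A t
  assumes D: "rational_divisor D" and A: "A \<in> C" "galois_point frobenius A = A"
    and t: "t \<in> rational_functions C" "local_parameter C A t"
    and dim: "dimension 1 (range (const_fun C)) (riemann_roch_space C D)"
begin

lemma sections_proportional:
  obtains w where "w \<in> carrier K" "w \<noteq> \<zero>\<^bsub>K\<^esub>" "riemann_roch_space C D = {const_fun C a \<otimes>\<^bsub>K\<^esub> w | a. True}"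
proof -
  obtain w where "w \<in> carrier K" "w \<noteq> \<zero>\<^bsub>K\<^esub>" "riemann_roch_space C D = {a \<otimes>\<^bsub>K\<^esub> w | a. a \<in> range (const_fun C)}"
    using dimension_1D[OF dim] by blast
  then show ?thesis using that[of w] by blast
qed

text \<open>The nonzero sections are the nonzero constant multiples of one of them, and the leading
  coefficient scales with the constant, so it takes the value one exactly once.\<close>

lemma normalized_section_unique: "\<exists>!\<psi>. \<psi> \<in> riemann_roch_space C D \<and> \<psi> \<noteq> \<zero>\<^bsub>K\<^esub> \<and> leading_coefficient C A t \<psi> 1"
proof -
  interpret p: curve_point C A by unfold_locales (rule A)
  obtain w where w: "w \<in> carrier K" "w \<noteq> \<zero>\<^bsub>K\<^esub>" "riemann_roch_space C D = {const_fun C a \<otimes>\<^bsub>K\<^esub> w | a. True}"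
    by (rule sections_proportional)
  obtain b where b: "leading_coefficient C A t w b" using p.leading_coefficient_exists[OF t(2) w(1,2)] by blast
  have b0: "b \<noteq> 0" using b by (simp add: leading_coefficient_def)
  have lead: "leading_coefficient C A t (const_fun C a \<otimes>\<^bsub>K\<^esub> w) 1 \<longleftrightarrow> a = inverse b" if "a \<noteq> 0" for a
  proof -
    have l: "leading_coefficient C A t (const_fun C a \<otimes>\<^bsub>K\<^esub> w) (a * b)"
      by (rule p.leading_coefficient_scale[OF b that t(2)])
    then have "leading_coefficient C A t (const_fun C a \<otimes>\<^bsub>K\<^esub> w) 1 \<longleftrightarrow> a * b = 1"
      using p.leading_coefficient_unique[OF t(2) l, of 1] by metis
    then show ?thesis using b0 by (auto simp: field_simps)
  qed
  show ?thesis
  proof (rule ex1I)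
    show "const_fun C (inverse b) \<otimes>\<^bsub>K\<^esub> w \<in> riemann_roch_space C D \<and> const_fun C (inverse b) \<otimes>\<^bsub>K\<^esub> w \<noteq> \<zero>\<^bsub>K\<^esub> \<and>
        leading_coefficient C A t (const_fun C (inverse b) \<otimes>\<^bsub>K\<^esub> w) 1"
      using lead[of "inverse b"] b0 w by (auto simp: integral_iff)
    fix \<psi> assume \<psi>: "\<psi> \<in> riemann_roch_space C D \<and> \<psi> \<noteq> \<zero>\<^bsub>K\<^esub> \<and> leading_coefficient C A t \<psi> 1"
    then obtain a where a: "\<psi> = const_fun C a \<otimes>\<^bsub>K\<^esub> w" using w(3) by blast
    then have "a \<noteq> 0" using \<psi> w(1) by auto
    then show "\<psi> = const_fun C (inverse b) \<otimes>\<^bsub>K\<^esub> w" using lead[of a] \<psi> a by simp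
  qed
qed

lemma normalized_section_rational:
  assumes \<psi>: "\<psi> \<in> riemann_roch_space C D" "\<psi> \<noteq> \<zero>\<^bsub>K\<^esub>" "leading_coefficient C A t \<psi> 1"
  shows "\<psi> \<in> rational_functions C"
proof (rule rational_functionI)
  interpret curve_automorphism C frobenius by (rule automorphism[OF frobenius_galois])
  show c: "\<psi> \<in> carrier K" using \<psi>(1) by (simp add: riemann_roch_space_def)
  have "act \<psi> \<in> riemann_roch_space C D" by (rule act_riemann_roch_space[OF frobenius_galois D \<psi>(1)])
  moreover have "act \<psi> \<noteq> \<zero>\<^bsub>K\<^esub>" using c \<psi>(2) by simp
  moreover have "leading_coefficient C A t (act \<psi>) 1"
    using act_leading_coefficient[OF frobenius_galois A t \<psi>(3)] by (simp add: frobenius_def)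
  ultimately show "act \<psi> = \<psi>" using normalized_section_unique \<psi> by blast
qed

lemma sections_same_divisor:
  assumes "\<psi> \<in> riemann_roch_space C D" "\<psi> \<noteq> \<zero>\<^bsub>K\<^esub>" "\<phi> \<in> riemann_roch_space C D" "\<phi> \<noteq> \<zero>\<^bsub>K\<^esub>"
  shows "principal_divisor C \<phi> = principal_divisor C \<psi>"
proof -
  obtain w where w: "w \<in> carrier K" "w \<noteq> \<zero>\<^bsub>K\<^esub>" "riemann_roch_space C D = {const_fun C a \<otimes>\<^bsub>K\<^esub> w | a. True}"
    by (rule sections_proportional)
  have "principal_divisor C f = principal_divisor C w" if f: "f \<in> riemann_roch_space C D" "f \<noteq> \<zero>\<^bsub>K\<^esub>" for f
  proof -
    obtain a where a: "f = const_fun C a \<otimes>\<^bsub>K\<^esub> w" using f(1) w(3) by blast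
    then have "a \<noteq> 0" using f(2) w(1) by auto
    then show ?thesis unfolding a using w by (simp add: principal_divisor_mult principal_divisor_const)
  qed
  then show ?thesis using assms by metis
qed

end

end

text \<open>Effectivity of \<open>D\<close> places the regular functions in the space. Because the
  constant one is a multiple of the spanning section, that section is itself constant.\<close>

lemma (in smooth_curve) regular_functions_constant:
  assumes D: "\<And>P. 0 \<le> Poly_Mapping.lookup D P"
    and dim: "dimension 1 (range (const_fun C)) (riemann_roch_space C D)"
    and f: "f \<in> carrier K" "\<And>P. P \<in> C \<Longrightarrow> ge P 0 f"
  shows "f \<in> range (const_fun C)"
proof -
  obtain w where w: "w \<in> carrier K" "w \<noteq> \<zero>\<^bsub>K\<^esub>" "riemann_roch_space C D = {a \<otimes>\<^bsub>K\<^esub> w | a. a \<in> range (const_fun C)}"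
    using dimension_1D[OF dim] by blast
  have mem: "h \<in> riemann_roch_space C D" if h: "h \<in> carrier K" "\<And>P. P \<in> C \<Longrightarrow> ge P 0 h" for h
  proof -
    have "- Poly_Mapping.lookup D P \<le> ord_at C P h" if "P \<in> C" "h \<noteq> \<zero>\<^bsub>K\<^esub>" for P
      using h(2)[OF that(1)] that(2) D[of P] by (simp add: ge_def)
    then show ?thesis using h(1) by (auto simp: riemann_roch_space_def)
  qed
  have "\<one>\<^bsub>K\<^esub> \<in> riemann_roch_space C D" using ge_const[of _ 1] by (intro mem) auto
  then obtain a where a: "\<one>\<^bsub>K\<^esub> = const_fun C a \<otimes>\<^bsub>K\<^esub> w" using w(3) by blast
  then have "a \<noteq> 0" using w(1) by auto
  have "w = const_fun C (inverse a) \<otimes>\<^bsub>K\<^esub> (const_fun C a \<otimes>\<^bsub>K\<^esub> w)"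
    using w(1) \<open>a \<noteq> 0\<close> by (simp add: m_assoc[symmetric] c_mult[symmetric])
  then have weq: "w = const_fun C (inverse a)" by (simp flip: a)
  obtain b where "f = const_fun C b \<otimes>\<^bsub>K\<^esub> w" using mem[OF f] w(3) by blast
  then have "f = const_fun C (b * inverse a)" unfolding weq by (simp add: c_mult)
  then show ?thesis by blast
qed

theorem corollary3:
  fixes C :: "('n::finite, 'k::{field,finite} alg_closure) point set"
    and A0 A1 A2 A3 :: "('n, 'k alg_closure) point"
    and g :: nat
    and B :: "nat \<Rightarrow> ('n, 'k alg_closure) point"
    and t0 :: "('n, 'k alg_closure) ratfun"
  assumes curve: "nonsingular_curve C" "defined_over_ground C"
    and genus: "genus C = int g"
    and A_points: "{A0, A1, A2, A3} \<subseteq> rational_points C"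
    and A_distinct: "card {A0, A1, A2, A3} = 4"
    and B_points: "B ` {1..g} \<subseteq> C"
    and B_distinct: "inj_on B {1..g}" "B ` {1..g} \<inter> {A0, A1, A2, A3} = {}"
    and B_rational: "rational_divisor (points_divisor g B)"
    and B_nonspecial: "nonspecial C (points_divisor g B)"
    and t0: "t0 \<in> rational_functions C" "local_parameter C A0 t0"
    and general_position: "\<And>n1 n2 n3 :: int.
      (ring.dimension (function_field C) 1 over constants C)
        (wave_space C A0 A1 A2 A3 g B n1 n2 n3)"
  shows "(\<forall>i\<in>{A1, A2, A3}. divisor_class C (frag_of A0 - frag_of i) \<in> carrier (Pic0 C)) \<and>
    (\<forall>n1 n2 n3 :: int.
      divisor_class C (flow_divisor A0 A1 A2 A3 g B n1 n2 n3) \<in> carrier (Pic0 C)) \<and>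
    (\<forall>n1 n2 n3 :: int.
      divisor_class C (flow_divisor A0 A1 A2 A3 g B n1 n2 n3) =
        divisor_class C (flow_divisor A0 A1 A2 A3 g B 0 0 0)
        \<otimes>\<^bsub>Pic0 C\<^esub> divisor_class C (frag_of A0 - frag_of A1) [^]\<^bsub>Pic0 C\<^esub> n1
        \<otimes>\<^bsub>Pic0 C\<^esub> divisor_class C (frag_of A0 - frag_of A2) [^]\<^bsub>Pic0 C\<^esub> n2
        \<otimes>\<^bsub>Pic0 C\<^esub> divisor_class C (frag_of A0 - frag_of A3) [^]\<^bsub>Pic0 C\<^esub> n3) \<and>
    (\<forall>n1 n2 n3 :: int.
      divisor_class C (flow_divisor A0 A1 A2 A3 g B (n1 + 1) n2 n3) =
        divisor_class C (flow_divisor A0 A1 A2 A3 g B n1 n2 n3)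
        \<otimes>\<^bsub>Pic0 C\<^esub> divisor_class C (frag_of A0 - frag_of A1) \<and>
      divisor_class C (flow_divisor A0 A1 A2 A3 g B n1 (n2 + 1) n3) =
        divisor_class C (flow_divisor A0 A1 A2 A3 g B n1 n2 n3)
        \<otimes>\<^bsub>Pic0 C\<^esub> divisor_class C (frag_of A0 - frag_of A2) \<and>
      divisor_class C (flow_divisor A0 A1 A2 A3 g B n1 n2 (n3 + 1)) =
        divisor_class C (flow_divisor A0 A1 A2 A3 g B n1 n2 n3)
        \<otimes>\<^bsub>Pic0 C\<^esub> divisor_class C (frag_of A0 - frag_of A3)) \<and>
    (\<forall>n1 n2 n3 :: int.
      \<exists>!\<psi>. wave_function C A0 A1 A2 A3 g B t0 n1 n2 n3 \<psi>) \<and>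
    (\<forall>n1 n2 n3 :: int. \<forall>\<psi>. wave_function C A0 A1 A2 A3 g B t0 n1 n2 n3 \<psi> \<longrightarrow>
      (\<exists>Z. Z ` {1..g} \<subseteq> C \<and>
        points_divisor g Z - frag_cmul (int g) (frag_of A0)
          \<in> divisor_class C (flow_divisor A0 A1 A2 A3 g B n1 n2 n3) \<and>
        (\<forall>W. W ` {1..g} \<subseteq> C \<and>
          points_divisor g W - frag_cmul (int g) (frag_of A0)
            \<in> divisor_class C (flow_divisor A0 A1 A2 A3 g B n1 n2 n3) \<longrightarrow>
          points_divisor g W = points_divisor g Z) \<and>
        principal_divisor C \<psi> =
          frag_cmul n1 (frag_of A1 - frag_of A0) + frag_cmul n2 (frag_of A2 - frag_of A0)
          + frag_cmul n3 (frag_of A3 - frag_of A0)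
          + points_divisor g Z - points_divisor g B))"
proof -
  \<comment> \<open>The divisor whose Riemann-Roch space is the wave space. It has degree
    \<open>g\<close>, and subtracting \<open>g\<close> times \<open>A0\<close> turns it into the
    flow divisor.\<close>
  define wave where "wave n1 n2 n3 = frag_cmul (n1 + n2 + n3) (frag_of A0)
      - (frag_cmul n1 (frag_of A1) + frag_cmul n2 (frag_of A2) + frag_cmul n3 (frag_of A3))
      + points_divisor g B" for n1 n2 n3
  define flow where "flow = flow_divisor A0 A1 A2 A3 g B"
  have wave_space: "wave_space C A0 A1 A2 A3 g B n1 n2 n3 = riemann_roch_space C (wave n1 n2 n3)" for n1 n2 n3
    by (simp add: wave_space_def wave_def)
  interpret smooth_curve C by unfold_locales (rule curve(1))
  have constants_eq: "constants C = range (const_fun C)" by (simp add: constants_def)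
  have dim: "dimension 1 (range (const_fun C)) (riemann_roch_space C (wave n1 n2 n3))" for n1 n2 n3
    using general_position[of n1 n2 n3] by (simp add: over_def constants_eq wave_space)
  interpret rational_curve C
  proof
    show "defined_over_ground C" by (rule curve(2))
    show "f \<in> range (const_fun C)" if "f \<in> carrier K" "\<And>P. P \<in> C \<Longrightarrow> ge P 0 f" for f
    proof (rule regular_functions_constant[OF _ dim[of 0 0 0] that])
      \<comment> \<open>At the origin the multiples of the \<open>A\<close> points disappear and the
        effective divisor of the points \<open>B\<close> remains.\<close>
      show "0 \<le> Poly_Mapping.lookup (wave 0 0 0) P" for P
        by (simp add: wave_def lookup_points_nonneg)
    qed
  qed
  have proj: "C \<subseteq> projective_space" using C_projective by blast
  have A_rat: "A0 \<in> rational_points C" "A1 \<in> rational_points C" "A2 \<in> rational_points C" "A3 \<in> rational_points C"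
    using A_points by auto
  then have A_C: "A0 \<in> C" "A1 \<in> C" "A2 \<in> C" "A3 \<in> C" by (auto simp: rational_points_def)
  note A_div = A_rat[THEN rational_divisor_frag_of[OF proj]]
  have keys_B: "Poly_Mapping.keys (points_divisor g B) \<subseteq> C" using keys_points[of g B] B_points by blast
  have keys_C: "Poly_Mapping.keys E \<subseteq> C \<longleftrightarrow> (\<forall>P. P \<notin> C \<longrightarrow> Poly_Mapping.lookup E P = 0)" for E :: "('n, 'k alg_closure) point \<Rightarrow>\<^sub>0 int"
    by (auto simp: in_keys_iff)
  have B0: "Poly_Mapping.lookup (points_divisor g B) P = 0" if "P \<notin> C" for P
    using keys_B that unfolding keys_C by blast
  have wave_lookup0: "Poly_Mapping.lookup (wave n1 n2 n3) P = 0" if "P \<notin> C" for n1 n2 n3 P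
    using A_C that B0[OF that] by (auto simp: wave_def lookup_add lookup_minus)
  have wave_deg: "div_degree (wave n1 n2 n3) = int g" for n1 n2 n3
    by (simp add: wave_def div_degree_add div_degree_minus div_degree_cmul)
  have wave_rat: "rational_divisor (wave n1 n2 n3)" for n1 n2 n3
    unfolding wave_def by (intro rational_divisor_add rational_divisor_minus rational_divisor_cmul A_div B_rational)
  have flow_wave: "flow n1 n2 n3 = wave n1 n2 n3 - frag_cmul (int g) (frag_of A0)" for n1 n2 n3
    by (rule poly_mapping_eqI) (simp add: flow_def flow_divisor_def wave_def lookup_add lookup_minus algebra_simps)
  have flow_G: "flow n1 n2 n3 \<in> carrier G" for n1 n2 n3
  proof -
    have "Poly_Mapping.keys (flow n1 n2 n3) \<subseteq> C"
      unfolding keys_C flow_wave using wave_lookup0 A_C by (auto simp: lookup_minus)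
    moreover have "rational_divisor (flow n1 n2 n3)"
      unfolding flow_wave by (intro rational_divisor_minus rational_divisor_cmul A_div wave_rat)
    ultimately show ?thesis
      by (simp add: carrier_G) (simp add: flow_wave div_degree_minus div_degree_cmul wave_deg)
  qed
  have diff_G: "frag_of A0 - frag_of A \<in> carrier G" if "A \<in> {A1, A2, A3}" for A
  proof -
    have A: "A \<in> C" "rational_divisor (frag_of A)" using that A_C A_div by auto
    have "Poly_Mapping.keys (frag_of A0 - frag_of A) \<subseteq> C"
      unfolding keys_C using A_C A by (auto simp: lookup_minus)
    then show ?thesis using A A_div by (simp add: carrier_G rational_divisor_minus div_degree_minus)
  qed
  have cmul_G: "frag_cmul n D \<in> carrier G" if "D \<in> carrier G" for n D
    using that keys_cmul[of n D] by (auto simp: carrier_G rational_divisor_cmul div_degree_cmul)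
  have add_G: "D + E \<in> carrier G" if "D \<in> carrier G" "E \<in> carrier G" for D E
    using G.m_closed[OF that] by simp
  let ?d1 = "frag_of A0 - frag_of A1" and ?d2 = "frag_of A0 - frag_of A2" and ?d3 = "frag_of A0 - frag_of A3"
  have d: "?d1 \<in> carrier G" "?d2 \<in> carrier G" "?d3 \<in> carrier G" using diff_G by auto
  have flow_sum: "flow n1 n2 n3 = flow 0 0 0 + frag_cmul n1 ?d1 + frag_cmul n2 ?d2 + frag_cmul n3 ?d3" for n1 n2 n3
    by (simp add: flow_def flow_divisor_def algebra_simps)
  have flow_class: "divisor_class C (flow n1 n2 n3) = divisor_class C (flow 0 0 0)
      \<otimes>\<^bsub>Pic0 C\<^esub> divisor_class C ?d1 [^]\<^bsub>Pic0 C\<^esub> n1 \<otimes>\<^bsub>Pic0 C\<^esub> divisor_class C ?d2 [^]\<^bsub>Pic0 C\<^esub> n2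
      \<otimes>\<^bsub>Pic0 C\<^esub> divisor_class C ?d3 [^]\<^bsub>Pic0 C\<^esub> n3" for n1 n2 n3
    unfolding flow_sum[of n1 n2 n3]
    by (simp add: class_add class_cmul add_G cmul_G d flow_G)
  have flow_step: "flow (n1 + 1) n2 n3 = flow n1 n2 n3 + ?d1" "flow n1 (n2 + 1) n3 = flow n1 n2 n3 + ?d2"
    "flow n1 n2 (n3 + 1) = flow n1 n2 n3 + ?d3" for n1 n2 n3
    by (simp_all add: flow_def flow_divisor_def frag_cmul_distrib algebra_simps)
  have A0_fixed: "galois_point frobenius A0 = A0" by (rule galois_rational_point[OF frobenius_galois proj A_rat(1)])
  note sect = wave_rat A_C(1) A0_fixed t0 dim
  have wf: "wave_function C A0 A1 A2 A3 g B t0 n1 n2 n3 \<psi> \<longleftrightarrow> \<psi> \<in> riemann_roch_space C (wave n1 n2 n3) \<and>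
      \<psi> \<noteq> \<zero>\<^bsub>K\<^esub> \<and> leading_coefficient C A0 t0 \<psi> 1" for n1 n2 n3 \<psi>
    by (simp add: wave_function_def wave_space)
  have last: "\<exists>Z. Z ` {1..g} \<subseteq> C \<and>
        points_divisor g Z - frag_cmul (int g) (frag_of A0) \<in> divisor_class C (flow n1 n2 n3) \<and>
        (\<forall>W. W ` {1..g} \<subseteq> C \<and>
          points_divisor g W - frag_cmul (int g) (frag_of A0) \<in> divisor_class C (flow n1 n2 n3) \<longrightarrow>
          points_divisor g W = points_divisor g Z) \<and>
        principal_divisor C \<psi> =
          frag_cmul n1 (frag_of A1 - frag_of A0) + frag_cmul n2 (frag_of A2 - frag_of A0)
          + frag_cmul n3 (frag_of A3 - frag_of A0) + points_divisor g Z - points_divisor g B"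
    if \<psi>: "wave_function C A0 A1 A2 A3 g B t0 n1 n2 n3 \<psi>" for n1 n2 n3 \<psi>
  proof -
    have \<psi>': "\<psi> \<in> riemann_roch_space C (wave n1 n2 n3)" "\<psi> \<noteq> \<zero>\<^bsub>K\<^esub>" "leading_coefficient C A0 t0 \<psi> 1"
      using \<psi> by (auto simp: wf)
    then have \<psi>c: "\<psi> \<in> carrier K" by (simp add: riemann_roch_space_def)
    have \<psi>r: "\<psi> \<in> rational_functions C" by (rule normalized_section_rational[OF sect \<psi>'])
    \<comment> \<open>The zeros that the divisor bound leaves free: \<open>E\<close> is effective
      since the wave function is a section, and of degree \<open>g\<close> since principal divisors
      have degree zero. Its points are the \<open>X\<close> of the informal statement.\<close>
    define E where "E = principal_divisor C \<psi> + wave n1 n2 n3"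
    have "0 \<le> Poly_Mapping.lookup E P" for P
    proof (cases "P \<in> C")
      case True
      then have "- Poly_Mapping.lookup (wave n1 n2 n3) P \<le> ord_at C P \<psi>"
        using \<psi>'(1,2) by (simp add: riemann_roch_space_def)
      then show ?thesis using True by (simp add: E_def lookup_add lookup_principal_divisor[OF \<psi>c \<psi>'(2)])
    next
      case False
      then show ?thesis
        by (simp add: E_def lookup_add lookup_principal_divisor[OF \<psi>c \<psi>'(2)] wave_lookup0)
    qed
    moreover have "div_degree E = int g"
      by (simp add: E_def div_degree_add wave_deg degree_principal_divisor[OF \<psi>c \<psi>'(2)])
    ultimately obtain Z where Z: "E = points_divisor g Z" "Z ` {1..g} \<subseteq> Poly_Mapping.keys E"
      using effective_divisor_points by blast
    have "Poly_Mapping.keys E \<subseteq> C"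
      unfolding keys_C by (simp add: E_def lookup_add lookup_principal_divisor[OF \<psi>c \<psi>'(2)] wave_lookup0)
    then have ZC: "Z ` {1..g} \<subseteq> C" using Z(2) by blast
    \<comment> \<open>The difference from the flow divisor is the divisor of the wave function, and
      rationality of that function makes the two equivalent over the ground field.\<close>
    have "points_divisor g Z - frag_cmul (int g) (frag_of A0) - flow n1 n2 n3 = principal_divisor C \<psi>"
      unfolding Z(1)[symmetric] E_def flow_wave by simp
    then have mem: "points_divisor g Z - frag_cmul (int g) (frag_of A0) \<in> divisor_class C (flow n1 n2 n3)"
      unfolding mem_class_iff using HI[OF \<psi>r \<psi>'(2)] by simp
    \<comment> \<open>A second effective representative differs from the flow divisor by the divisor
      of some function, which must again be a section of the same one-dimensional space;
      proportional sections have equal divisors.\<close>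
    have uniq: "points_divisor g W = points_divisor g Z"
      if W: "points_divisor g W - frag_cmul (int g) (frag_of A0) \<in> divisor_class C (flow n1 n2 n3)" for W
    proof -
      obtain \<phi> where \<phi>: "\<phi> \<in> rational_functions C" "\<phi> \<noteq> \<zero>\<^bsub>K\<^esub>"
          "points_divisor g W - frag_cmul (int g) (frag_of A0) - flow n1 n2 n3 = principal_divisor C \<phi>"
        using W unfolding mem_class_iff by (metis HE)
      note \<phi>c = rational_functions_closed[OF \<phi>(1)]
      have W_eq: "points_divisor g W = principal_divisor C \<phi> + wave n1 n2 n3"
        using \<phi>(3) by (simp add: flow_wave algebra_simps)
      have "- Poly_Mapping.lookup (wave n1 n2 n3) P \<le> ord_at C P \<phi>" if P: "P \<in> C" for P
      proof -
        have "0 \<le> Poly_Mapping.lookup (points_divisor g W) P" by (rule lookup_points_nonneg)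
        then show ?thesis unfolding W_eq using P by (simp add: lookup_add lookup_principal_divisor[OF \<phi>c \<phi>(2)])
      qed
      then have "\<phi> \<in> riemann_roch_space C (wave n1 n2 n3)" using \<phi>c by (simp add: riemann_roch_space_def)
      then have "principal_divisor C \<phi> = principal_divisor C \<psi>"
        by (rule sections_same_divisor[OF sect \<psi>'(1,2) _ \<phi>(2)])
      then show ?thesis using W_eq Z(1) by (simp add: E_def)
    qed
    have "principal_divisor C \<psi> = frag_cmul n1 (frag_of A1 - frag_of A0) + frag_cmul n2 (frag_of A2 - frag_of A0)
          + frag_cmul n3 (frag_of A3 - frag_of A0) + points_divisor g Z - points_divisor g B"
    proof -
      have "principal_divisor C \<psi> = points_divisor g Z - wave n1 n2 n3" by (simp add: E_def flip: Z(1))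
      also have "\<dots> = frag_cmul n1 (frag_of A1 - frag_of A0) + frag_cmul n2 (frag_of A2 - frag_of A0)
          + frag_cmul n3 (frag_of A3 - frag_of A0) + points_divisor g Z - points_divisor g B"
        by (rule poly_mapping_eqI) (simp add: wave_def lookup_add lookup_minus algebra_simps)
      finally show ?thesis .
    qed
    then show ?thesis using ZC mem uniq by (intro exI[of _ Z]) blast
  qed
  have wave_unique: "\<exists>!\<psi>. wave_function C A0 A1 A2 A3 g B t0 n1 n2 n3 \<psi>" for n1 n2 n3
    unfolding wf by (rule normalized_section_unique[OF sect])
  show ?thesis
    unfolding flow_def[symmetric]
  proof (intro conjI allI impI ballI)
    show "divisor_class C (frag_of A0 - frag_of i) \<in> carrier (Pic0 C)" if "i \<in> {A1, A2, A3}" for i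
      by (rule class_closed[OF diff_G[OF that]])
    show "divisor_class C (flow n1 n2 n3) \<in> carrier (Pic0 C)" for n1 n2 n3
      by (rule class_closed[OF flow_G])
    show "divisor_class C (flow (n1 + 1) n2 n3) = divisor_class C (flow n1 n2 n3) \<otimes>\<^bsub>Pic0 C\<^esub> divisor_class C ?d1"
      "divisor_class C (flow n1 (n2 + 1) n3) = divisor_class C (flow n1 n2 n3) \<otimes>\<^bsub>Pic0 C\<^esub> divisor_class C ?d2"
      "divisor_class C (flow n1 n2 (n3 + 1)) = divisor_class C (flow n1 n2 n3) \<otimes>\<^bsub>Pic0 C\<^esub> divisor_class C ?d3"
      for n1 n2 n3
      unfolding flow_step by (rule class_add[OF flow_G d(1)] class_add[OF flow_G d(2)] class_add[OF flow_G d(3)])+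
  qed (rule flow_class wave_unique last; assumption?)+
qed

end
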